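(* Let $d\ge 1$ and let $V:\mathbb{R}^d\to[0,+\infty)$ be continuous with $\liminf_{|x|\to+\infty}V(x)>0$ and $\inf V=\min V=0$. For $h>0$ let $P=-h^2\Delta+V$ on $L^2(\mathbb{R}^d)$. Then the set $V^{-1}(0)$ is $1$-null if and only if $$\lim_{h\to 0}\frac{\lambda_1(P)}{h^2}=+\infty .$$
   Context: The operator $P=-h^2\Delta+V$ is the non-negative self-adjoint operator on $L^2(\mathbb{R}^d)$ associated with the quadratic form $u\mapsto h^2\|\nabla u\|^2+\|V^{1/2}u\|^2$ on $\{u\in H^1(\mathbb{R}^d): V^{1/2}u\in L^2(\mathbb{R}^d)\}$; it depends on the semiclassical parameter $h>0$. For a non-negative self-adjoint operator $T$, $\lambda_k(T)$ denotes its $k$-th eigenvalue (in increasing order, counted with multiplicity), or the bottom of its essential spectrum if $T$ has fewer than $k$ eigenvalues below it (equivalently, the $k$-th max-min value of $T$). A set $E\subset\mathbb{R}^d$ is called $1$-null if the only function $f\in H^1(\mathbb{R}^d)$ such that $\operatorname{supp}(f)\subset E$ is the zero function. *)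

theory Defs
  imports "HOL-Analysis.Analysis"
begin

section \<open>The space \<open>L\<^sup>2(\<real>\<^sup>d)\<close>\<close>

text \<open>The space \<open>\<real>\<^sup>d\<close> is an arbitrary Euclidean space \<open>'a\<close> with \<open>DIM('a) = d \<ge> 1\<close>.  An element of
  the complex space \<open>L\<^sup>2\<close> is given by a Borel representative; equality in \<open>L\<^sup>2\<close> is equality almost
  everywhere and is written out wherever it matters.\<close>

definition L2 :: "('a::euclidean_space \<Rightarrow> complex) set" where
  "L2 = {f \<in> borel_measurable lborel. integrable lborel (\<lambda>x. (norm (f x))\<^sup>2)}"

definition L2_inner :: "('a::euclidean_space \<Rightarrow> complex) \<Rightarrow> ('a \<Rightarrow> complex) \<Rightarrow> complex" where
  "L2_inner f g = (\<integral>x. f x * cnj (g x) \<partial>lborel)"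

definition L2_norm :: "('a::euclidean_space \<Rightarrow> complex) \<Rightarrow> real" where
  "L2_norm f = sqrt (\<integral>x. (norm (f x))\<^sup>2 \<partial>lborel)"

text \<open>Linear independence of the classes of \<open>u 0, \<dots>, u (n - 1)\<close> in \<open>L\<^sup>2\<close>.\<close>

definition L2_independent :: "nat \<Rightarrow> (nat \<Rightarrow> 'a::euclidean_space \<Rightarrow> complex) \<Rightarrow> bool" where
  "L2_independent n u \<longleftrightarrow>
     (\<forall>c :: nat \<Rightarrow> complex.
        (AE x in lborel. (\<Sum>i<n. c i * u i x) = 0) \<longrightarrow> (\<forall>i<n. c i = 0))"

section \<open>The Sobolev space \<open>H\<^sup>1(\<real>\<^sup>d)\<close>\<close>

primrec C_k :: "nat \<Rightarrow> ('a::euclidean_space \<Rightarrow> real) \<Rightarrow> bool" where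
  "C_k 0 \<phi> \<longleftrightarrow> continuous_on UNIV \<phi>"
| "C_k (Suc k) \<phi> \<longleftrightarrow> \<phi> differentiable_on UNIV \<and>
     (\<forall>b\<in>Basis. C_k k (\<lambda>x. frechet_derivative \<phi> (at x) b))"

definition test_function :: "('a::euclidean_space \<Rightarrow> real) \<Rightarrow> bool" where
  "test_function \<phi> \<longleftrightarrow> (\<forall>k. C_k k \<phi>) \<and> compact (closure {x. \<phi> x \<noteq> 0})"

text \<open>\<open>g \<in> L\<^sup>2\<close> is the distributional derivative of \<open>u\<close> in the direction \<open>b\<close>.\<close>

definition has_weak_deriv ::
    "('a::euclidean_space \<Rightarrow> complex) \<Rightarrow> 'a \<Rightarrow> ('a \<Rightarrow> complex) \<Rightarrow> bool" where
  "has_weak_deriv u b g \<longleftrightarrow> g \<in> L2 \<and>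
     (\<forall>\<phi>. test_function \<phi> \<longrightarrow>
        (\<integral>x. frechet_derivative \<phi> (at x) b *\<^sub>R u x \<partial>lborel) = - (\<integral>x. \<phi> x *\<^sub>R g x \<partial>lborel))"

definition H1 :: "('a::euclidean_space \<Rightarrow> complex) set" where
  "H1 = {u \<in> L2. \<forall>b\<in>Basis. \<exists>g. has_weak_deriv u b g}"

text \<open>The weak derivative is unique up to null sets, so this choice does not affect the integrals
  in which it is used.\<close>

definition weak_deriv :: "('a::euclidean_space \<Rightarrow> complex) \<Rightarrow> 'a \<Rightarrow> ('a \<Rightarrow> complex)" where
  "weak_deriv u b = (SOME g. has_weak_deriv u b g)"

text \<open>The support in the sense of distributions: the complement of the largest open set on which
  \<open>f\<close> vanishes almost everywhere.\<close>

definition ess_support :: "('a::euclidean_space \<Rightarrow> complex) \<Rightarrow> 'a set" where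
  "ess_support f = - \<Union>{U. open U \<and> (AE x in lborel. x \<in> U \<longrightarrow> f x = 0)}"

definition one_null :: "'a::euclidean_space set \<Rightarrow> bool" where
  "one_null E \<longleftrightarrow> (\<forall>f\<in>H1. ess_support f \<subseteq> E \<longrightarrow> (AE x in lborel. f x = 0))"

section \<open>Unbounded operators on \<open>L\<^sup>2(\<real>\<^sup>d)\<close> and their spectra\<close>

text \<open>An unbounded operator \<open>T\<close> is given by its graph: \<open>(u, f) \<in> T\<close> means that \<open>u\<close> lies in the domain
  of \<open>T\<close> and \<open>T u = f\<close>, both up to null sets.\<close>

type_synonym 'a L2_operator = "(('a \<Rightarrow> complex) \<times> ('a \<Rightarrow> complex)) set"

text \<open>The operator associated with a sesquilinear form \<open>a\<close> on the form domain \<open>Q\<close>.  When the form is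
  densely defined, closed, Hermitian and non-negative, this is the non-negative self-adjoint
  operator of the representation theorem.\<close>

definition form_operator ::
    "('a::euclidean_space \<Rightarrow> complex) set \<Rightarrow> (('a \<Rightarrow> complex) \<Rightarrow> ('a \<Rightarrow> complex) \<Rightarrow> complex)
      \<Rightarrow> 'a L2_operator" where
  "form_operator Q a = {(u, f). u \<in> Q \<and> f \<in> L2 \<and> (\<forall>v\<in>Q. a u v = L2_inner f v)}"

text \<open>\<open>z\<close> is in the resolvent set if \<open>T - z\<close> is a bijection from the domain of \<open>T\<close> onto \<open>L\<^sup>2\<close> with
  bounded inverse; note that \<open>(T - z) u = f\<close> means \<open>(u, f + z u) \<in> T\<close>.\<close>

definition resolvent_set :: "'a::euclidean_space L2_operator \<Rightarrow> complex set" where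
  "resolvent_set T = {z. \<exists>C. \<forall>f\<in>L2. \<exists>u.
      (u, \<lambda>x. f x + z * u x) \<in> T \<and> L2_norm u \<le> C * L2_norm f \<and>
      (\<forall>w. (w, \<lambda>x. f x + z * w x) \<in> T \<longrightarrow> (AE x in lborel. w x = u x))}"

definition spectrum :: "'a::euclidean_space L2_operator \<Rightarrow> complex set" where
  "spectrum T = - resolvent_set T"

definition eigenspace :: "'a::euclidean_space L2_operator \<Rightarrow> complex \<Rightarrow> ('a \<Rightarrow> complex) set" where
  "eigenspace T z = {u. (u, \<lambda>x. z * u x) \<in> T}"

text \<open>The number of eigenvalues in \<open>S\<close>, counted with multiplicity.  Eigenspaces of different
  eigenvalues being linearly independent, it is the maximal number of linearly independent
  eigenfunctions with eigenvalues in \<open>S\<close>.\<close>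

definition eigenvalue_count :: "'a::euclidean_space L2_operator \<Rightarrow> complex set \<Rightarrow> enat" where
  "eigenvalue_count T S =
     Sup {enat n | n. \<exists>u. L2_independent n u \<and> (\<forall>i<n. \<exists>z\<in>S. u i \<in> eigenspace T z)}"

definition multiplicity :: "'a::euclidean_space L2_operator \<Rightarrow> complex \<Rightarrow> enat" where
  "multiplicity T z = eigenvalue_count T {z}"

text \<open>For self-adjoint \<open>T\<close>, the discrete spectrum consists of the eigenvalues of finite multiplicity
  that are isolated points of the spectrum, and the essential spectrum is the rest.\<close>

definition discrete_spectrum :: "'a::euclidean_space L2_operator \<Rightarrow> complex set" where
  "discrete_spectrum T =
     {z \<in> spectrum T. \<not> z islimpt spectrum T \<and> 0 < multiplicity T z \<and> multiplicity T z < \<infinity>}"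

definition essential_spectrum :: "'a::euclidean_space L2_operator \<Rightarrow> complex set" where
  "essential_spectrum T = spectrum T - discrete_spectrum T"

text \<open>The bottom of the essential spectrum is \<open>\<infinity>\<close> if the latter is empty.  The spectrum of a
  self-adjoint operator is real.\<close>

definition essential_bottom :: "'a::euclidean_space L2_operator \<Rightarrow> ereal" where
  "essential_bottom T = Inf {ereal \<mu> | \<mu>. complex_of_real \<mu> \<in> essential_spectrum T}"

text \<open>\<open>eigval k T\<close> is the number \<open>\<lambda>\<^sub>k(T)\<close>, for \<open>k \<ge> 1\<close> and \<open>T\<close> self-adjoint and non-negative.  Its
  \<open>k\<close>-th eigenvalue is the smallest eigenvalue \<open>\<mu>\<close> such that at least \<open>k\<close> eigenvalues, counted with
  multiplicity, are \<open>\<le> \<mu>\<close>.\<close>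

definition eigval :: "nat \<Rightarrow> 'a::euclidean_space L2_operator \<Rightarrow> ereal" where
  "eigval k T =
     (if enat k \<le> eigenvalue_count T {complex_of_real \<mu> | \<mu>. ereal \<mu> < essential_bottom T}
      then Inf {ereal \<mu> | \<mu>. 0 < multiplicity T (complex_of_real \<mu>) \<and>
                  enat k \<le> eigenvalue_count T (complex_of_real ` {..\<mu>})}
      else essential_bottom T)"

section \<open>The operator \<open>- h\<^sup>2 \<Delta> + V\<close>\<close>

definition sqrt_mult :: "('a::euclidean_space \<Rightarrow> real) \<Rightarrow> ('a \<Rightarrow> complex) \<Rightarrow> ('a \<Rightarrow> complex)" where
  "sqrt_mult V u = (\<lambda>x. complex_of_real (sqrt (V x)) * u x)"

definition schrodinger_domain :: "('a::euclidean_space \<Rightarrow> real) \<Rightarrow> ('a \<Rightarrow> complex) set" where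
  "schrodinger_domain V = {u \<in> H1. sqrt_mult V u \<in> L2}"

text \<open>The sesquilinear form whose quadratic form is \<open>u \<mapsto> h\<^sup>2 \<parallel>\<nabla>u\<parallel>\<^sup>2 + \<parallel>V\<^sup>1\<^sup>/\<^sup>2 u\<parallel>\<^sup>2\<close>.\<close>

definition schrodinger_form ::
    "real \<Rightarrow> ('a::euclidean_space \<Rightarrow> real) \<Rightarrow> ('a \<Rightarrow> complex) \<Rightarrow> ('a \<Rightarrow> complex) \<Rightarrow> complex" where
  "schrodinger_form h V u v =
     complex_of_real (h\<^sup>2) * (\<Sum>b\<in>Basis. L2_inner (weak_deriv u b) (weak_deriv v b))
     + L2_inner (sqrt_mult V u) (sqrt_mult V v)"

definition schrodinger :: "real \<Rightarrow> ('a::euclidean_space \<Rightarrow> real) \<Rightarrow> 'a L2_operator" where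
  "schrodinger h V = form_operator (schrodinger_domain V) (schrodinger_form h V)"

end

theory Submission
  imports Defs
begin

text \<open>
  Write \<open>q\<^sub>h u = h\<^sup>2 \<parallel>\<nabla>u\<parallel>\<^sup>2 + \<parallel>V\<^sup>1\<^sup>/\<^sup>2 u\<parallel>\<^sup>2\<close> for the quadratic form of the operator.  The first
  eigenvalue is the infimum of the Rayleigh quotient \<open>q\<^sub>h u / \<parallel>u\<parallel>\<^sup>2\<close>, so the question is whether
  \<open>\<parallel>\<nabla>u\<parallel>\<^sup>2 + h\<^sup>-\<^sup>2 \<parallel>V\<^sup>1\<^sup>/\<^sup>2 u\<parallel>\<^sup>2\<close> can stay bounded on the unit sphere of \<open>L\<^sup>2\<close> as \<open>h\<close> tends to \<open>0\<close>.  If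
  \<open>f \<noteq> 0\<close> is an \<open>H\<^sup>1\<close> function supported in the zero set of \<open>V\<close>, the potential term vanishes at \<open>f\<close>,
  and the quotient divided by \<open>h\<^sup>2\<close> is the constant \<open>\<parallel>\<nabla>f\<parallel>\<^sup>2 / \<parallel>f\<parallel>\<^sup>2\<close>.  Conversely, a bounded
  sequence as \<open>h\<close> tends to \<open>0\<close> should have a limit point in \<open>H\<^sup>1\<close> that is supported in the zero set
  and is not zero, because nothing is lost locally (Rellich) nor at infinity (the lower limit of
  \<open>V\<close> is positive).

  The first eigenvalue is tied to the Rayleigh quotient without the spectral theorem.  A number
  below the infimum lies in the resolvent set, since the shifted form is coercive and the Riesz
  representation theorem solves the resolvent equation (\<open>eigval_1_schrodinger_ge\<close>).  The infimum
  itself lies in the spectrum, since a bounded inverse would contradict the Cauchy-Schwarz inequality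
  for the shifted form along a minimising sequence; and the first eigenvalue is at most every
  real point of the spectrum (\<open>eigval_1_schrodinger_le\<close>).

  The compactness argument is carried out quantitatively, without subsequences.  Given
  \<open>f \<in> L\<^sup>2\<close>, let \<open>w\<^sub>n\<close> represent \<open>\<langle>f, \<cdot>\<rangle>\<close> with respect to the form
  \<open>\<parallel>u\<parallel>\<^sup>2 + \<parallel>\<nabla>u\<parallel>\<^sup>2 + n \<parallel>V\<^sup>1\<^sup>/\<^sup>2 u\<parallel>\<^sup>2\<close>.  The numbers \<open>\<langle>f, w\<^sub>n\<rangle>\<close> decrease, and their differences control
  the distances between the \<open>w\<^sub>n\<close>; hence \<open>w\<^sub>n\<close> converges in \<open>H\<^sup>1\<close>, the limit is supported in the
  zero set of \<open>V\<close>, and it is \<open>0\<close> when this set is \<open>1\<close>-null.  Then \<open>\<langle>f, w\<^sub>n\<rangle>\<close> tends to \<open>0\<close>, which says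
  that \<open>\<langle>f, u\<rangle>\<close> is uniformly small for all \<open>u\<close> of bounded energy (\<open>pairing_small_of_one_null\<close>).  This
  is applied to the indicators \<open>f\<close> of finitely many small cubes that cover a large ball.  On a small
  cube, \<open>\<parallel>u\<parallel>\<^sup>2\<close> is controlled by the mean of \<open>u\<close> and by \<open>\<parallel>\<nabla>u\<parallel>\<^sup>2\<close>
  (\<open>square_integral_over_cells_le\<close>, which rests on the estimate \<open>translation_square_le\<close> for
  translations), and outside the ball by the potential term.  Together these bounds give
  \<open>rayleigh_lower_bound_of_one_null\<close>.
\<close>

section \<open>Semi-inner-product spaces of functions and the Riesz representation\<close>

lemma nonneg_quadratic_discriminant:
  fixes a p q :: real
  assumes "\<And>t. 0 \<le> a + 2 * t * p + t\<^sup>2 * q"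
  shows "p\<^sup>2 \<le> a * q"
proof (cases "q > 0")
  case True
  have "0 \<le> (a + 2 * (- p / q) * p + (- p / q)\<^sup>2 * q) * q"
    using assms[of "- p / q"] True by (intro mult_nonneg_nonneg) auto
  also have "\<dots> = a * q - p\<^sup>2"
    using True by (simp add: field_simps power2_eq_square)
  finally show ?thesis by simp
next
  case False
  have p: "p = 0"
  proof (rule ccontr)
    assume "p \<noteq> 0"
    \<comment> \<open>Without a positive quadratic term, a non-zero slope would make the value at this \<open>t\<close> negative.\<close>
    define t where "t = - (\<bar>a\<bar> + 1) / p"
    have "t * p = - (\<bar>a\<bar> + 1)" using \<open>p \<noteq> 0\<close> by (simp add: t_def)
    moreover have "t\<^sup>2 * q \<le> 0" using False by (simp add: mult_nonneg_nonpos)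
    ultimately show False using assms[of t] by (simp add: mult.assoc)
  qed
  have a: "a \<ge> 0" using assms[of 0] by simp
  have "a * q \<ge> 0"
  proof (cases "q = 0")
    case False
    with \<open>\<not> q > 0\<close> have q: "q < 0" by simp
    define t where "t = sqrt ((a + 1) / - q)"
    have "t\<^sup>2 * q = - (a + 1)" using q a by (simp add: t_def divide_nonneg_nonneg field_simps)
    with assms[of t] p show ?thesis by simp
  qed simp
  with p show ?thesis by simp
qed

text \<open>The elements are functions, not classes of functions modulo null sets, so the form is only
  semi-definite.  The locale is used for \<open>L\<^sup>2\<close> itself and for the domain of the Schroedinger form with
  various energies.\<close>

locale semi_inner_space =
  fixes Q :: "('b \<Rightarrow> complex) set"
    and B :: "('b \<Rightarrow> complex) \<Rightarrow> ('b \<Rightarrow> complex) \<Rightarrow> complex"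
  assumes nonempty: "Q \<noteq> {}"
    and mem_add: "u \<in> Q \<Longrightarrow> v \<in> Q \<Longrightarrow> (\<lambda>x. u x + v x) \<in> Q"
    and mem_scale: "u \<in> Q \<Longrightarrow> (\<lambda>x. c * u x) \<in> Q"
    and add_left: "u \<in> Q \<Longrightarrow> v \<in> Q \<Longrightarrow> w \<in> Q \<Longrightarrow> B (\<lambda>x. u x + v x) w = B u w + B v w"
    and scale_left: "u \<in> Q \<Longrightarrow> w \<in> Q \<Longrightarrow> B (\<lambda>x. c * u x) w = c * B u w"
    and hermitian: "u \<in> Q \<Longrightarrow> v \<in> Q \<Longrightarrow> B v u = cnj (B u v)"
    and nonneg: "u \<in> Q \<Longrightarrow> 0 \<le> Re (B u u)"
begin

lemma add_right: "u \<in> Q \<Longrightarrow> v \<in> Q \<Longrightarrow> w \<in> Q \<Longrightarrow> B w (\<lambda>x. u x + v x) = B w u + B w v"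
  using hermitian[of "\<lambda>x. u x + v x" w] hermitian[of u w] hermitian[of v w]
  by (simp add: mem_add add_left)

lemma scale_right: "u \<in> Q \<Longrightarrow> w \<in> Q \<Longrightarrow> B w (\<lambda>x. c * u x) = cnj c * B w u"
  using hermitian[of "\<lambda>x. c * u x" w] hermitian[of u w]
  by (simp add: mem_scale scale_left)

lemma mem_diff: "u \<in> Q \<Longrightarrow> v \<in> Q \<Longrightarrow> (\<lambda>x. u x - v x) \<in> Q"
  using mem_add[of u "\<lambda>x. (-1) * v x"] mem_scale[of v "-1"] by simp

lemma diff_left: "u \<in> Q \<Longrightarrow> v \<in> Q \<Longrightarrow> w \<in> Q \<Longrightarrow> B (\<lambda>x. u x - v x) w = B u w - B v w"
  using add_left[of u "\<lambda>x. (-1) * v x" w] scale_left[of v w "-1"] mem_scale[of v "-1"] by simp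

lemma diff_right: "u \<in> Q \<Longrightarrow> v \<in> Q \<Longrightarrow> w \<in> Q \<Longrightarrow> B w (\<lambda>x. u x - v x) = B w u - B w v"
  using add_right[of u "\<lambda>x. (-1) * v x" w] scale_right[of v w "-1"] mem_scale[of v "-1"] by simp

lemma quadratic_add:
  assumes "u \<in> Q" "v \<in> Q"
  shows "Re (B (\<lambda>x. u x + v x) (\<lambda>x. u x + v x)) = Re (B u u) + 2 * Re (B u v) + Re (B v v)"
  using assms hermitian[of u v] by (simp add: add_left add_right mem_add)

lemma quadratic_scale:
  assumes "u \<in> Q"
  shows "Re (B (\<lambda>x. c * u x) (\<lambda>x. c * u x)) = (cmod c)\<^sup>2 * Re (B u u)"
proof -
  have "B (\<lambda>x. c * u x) (\<lambda>x. c * u x) = c * cnj c * B u u"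
    using assms by (simp add: scale_left scale_right mem_scale)
  also have "c * cnj c = complex_of_real ((cmod c)\<^sup>2)"
    by (simp only: complex_norm_square)
  finally show ?thesis by simp
qed

lemma quadratic_diff:
  assumes "u \<in> Q" "v \<in> Q"
  shows "Re (B (\<lambda>x. u x - v x) (\<lambda>x. u x - v x)) = Re (B u u) - 2 * Re (B u v) + Re (B v v)"
  using assms hermitian[of u v] by (simp add: diff_left diff_right mem_diff)

lemma quadratic_add_le:
  assumes "u \<in> Q" "v \<in> Q"
  shows "Re (B (\<lambda>x. u x + v x) (\<lambda>x. u x + v x)) \<le> 2 * Re (B u u) + 2 * Re (B v v)"
  using quadratic_add[OF assms] quadratic_diff[OF assms] nonneg[OF mem_diff[OF assms]] by linarith

lemma Cauchy_Schwarz: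
  assumes u: "u \<in> Q" and v: "v \<in> Q"
  shows "(cmod (B u v))\<^sup>2 \<le> Re (B u u) * Re (B v v)"
proof -
  define z where "z = B u v"
  have "0 \<le> Re (B u u) + 2 * t * (- (cmod z)\<^sup>2) + t\<^sup>2 * ((cmod z)\<^sup>2 * Re (B v v))" for t
  proof -
    let ?w = "\<lambda>x. (- of_real t * z) * v x"
    have w: "?w \<in> Q" using v by (rule mem_scale)
    have "Re (B u ?w) = Re (cnj (- of_real t * z) * z)"
      by (simp only: scale_right[OF v u] z_def)
    also have "\<dots> = - t * Re (z * cnj z)" by (simp add: algebra_simps)
    also have "z * cnj z = complex_of_real ((cmod z)\<^sup>2)" by (simp only: complex_norm_square)
    finally have 1: "Re (B u ?w) = - t * (cmod z)\<^sup>2" by simp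
    have 2: "Re (B ?w ?w) = t\<^sup>2 * (cmod z)\<^sup>2 * Re (B v v)"
      using quadratic_scale[OF v, of "- of_real t * z"] by (simp add: norm_mult power_mult_distrib)
    show ?thesis using nonneg[OF mem_add[OF u w]] quadratic_add[OF u w] 1 2
      by (simp add: algebra_simps)
  qed
  from nonneg_quadratic_discriminant[OF this]
  have *: "(cmod z)\<^sup>2 * (cmod z)\<^sup>2 \<le> (cmod z)\<^sup>2 * (Re (B u u) * Re (B v v))"
    by (simp add: power2_eq_square algebra_simps)
  show ?thesis
  proof (cases "z = 0")
    case True
    then show ?thesis using nonneg[OF u] nonneg[OF v] by (simp add: z_def)
  next
    case False
    then have "(cmod z)\<^sup>2 > 0" by simp
    from mult_left_le_imp_le[OF * this] show ?thesis by (simp add: z_def)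
  qed
qed

text \<open>The functional \<open>J v = B v v - 2 Re (L v)\<close> is bounded below, and its minimiser represents \<open>L\<close>.
  Completeness is a hypothesis and not part of the locale, because the Cauchy-Schwarz inequality is
  also applied to forms that need not be complete, such as the one shifted by the infimum of the
  Rayleigh quotient.\<close>

lemma Riesz_representation:
  fixes L :: "('b \<Rightarrow> complex) \<Rightarrow> complex"
  assumes complete: "\<And>s. (\<And>n. s n \<in> Q) \<Longrightarrow>
      (\<And>e::real. e > 0 \<Longrightarrow> \<exists>N::nat. \<forall>m\<ge>N. \<forall>n\<ge>N. Re (B (\<lambda>x. s m x - s n x) (\<lambda>x. s m x - s n x)) \<le> e) \<Longrightarrow>
      \<exists>w\<in>Q. (\<lambda>n. Re (B (\<lambda>x. s n x - w x) (\<lambda>x. s n x - w x))) \<longlonglongrightarrow> 0"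
    and l_add: "\<And>u v. u \<in> Q \<Longrightarrow> v \<in> Q \<Longrightarrow> L (\<lambda>x. u x + v x) = L u + L v"
    and l_scale: "\<And>u c. u \<in> Q \<Longrightarrow> L (\<lambda>x. c * u x) = cnj c * L u"
    and l_bound: "\<And>u. u \<in> Q \<Longrightarrow> (cmod (L u))\<^sup>2 \<le> K * Re (B u u)"
    and K: "K \<ge> 0"
  shows "\<exists>w\<in>Q. \<forall>v\<in>Q. B w v = L v"
proof -
  define J where "J = (\<lambda>v. Re (B v v) - 2 * Re (L v))"
  have J_ge: "J v \<ge> - K" if "v \<in> Q" for v
  proof -
    have "(Re (L v))\<^sup>2 \<le> (cmod (L v))\<^sup>2"
      using abs_Re_le_cmod[of "L v"] by (metis abs_ge_zero power2_abs power_mono)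
    also have "\<dots> \<le> K * Re (B v v)" using that by (rule l_bound)
    also have "\<dots> \<le> ((K + Re (B v v)) / 2)\<^sup>2"
      using sum_squares_ge_zero[of "K - Re (B v v)" 0] by (simp add: power2_eq_square field_simps)
    finally have "\<bar>Re (L v)\<bar> \<le> (K + Re (B v v)) / 2"
      using K nonneg[OF that] by (metis abs_le_square_iff abs_of_nonneg add_nonneg_nonneg divide_nonneg_nonneg zero_le_numeral)
    then show ?thesis by (simp add: J_def)
  qed
  define m where "m = Inf (J ` Q)"
  have bdd: "bdd_below (J ` Q)" using J_ge by (auto intro!: bdd_belowI2)
  have m_le: "m \<le> J v" if "v \<in> Q" for v
    unfolding m_def using bdd that by (rule cINF_lower)
  have "\<exists>v\<in>Q. J v < m + 1 / real (Suc n)" for n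
    using cInf_lessD[of "J ` Q" "m + 1 / real (Suc n)"] nonempty by (auto simp: m_def)
  then obtain s where s: "\<And>n. s n \<in> Q" and sJ: "\<And>n. J (s n) < m + 1 / real (Suc n)"
    by metis
  \<comment> \<open>The parallelogram law makes a minimising sequence a Cauchy sequence.\<close>
  have par: "Re (B (\<lambda>x. s i x - s j x) (\<lambda>x. s i x - s j x)) \<le> 2 / real (Suc i) + 2 / real (Suc j)" for i j
  proof -
    let ?h = "\<lambda>x. (1/2) * (s i x + s j x)"
    have h: "?h \<in> Q" by (intro mem_scale mem_add s)
    have "L ?h = (1/2) * (L (s i) + L (s j))"
      using l_scale[OF mem_add[OF s[of i] s[of j]], of "1/2"] by (simp only: l_add[OF s s]) simp
    then have "Re (L ?h) = (Re (L (s i)) + Re (L (s j))) / 2" by (simp only:) simp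
    moreover have "Re (B ?h ?h) = Re (B (\<lambda>x. s i x + s j x) (\<lambda>x. s i x + s j x)) / 4"
      using quadratic_scale[OF mem_add[OF s[of i] s[of j]], of "1/2"]
      by (simp only:) (simp add: power2_eq_square)
    ultimately have "J ?h = Re (B (\<lambda>x. s i x + s j x) (\<lambda>x. s i x + s j x)) / 4 - Re (L (s i)) - Re (L (s j))"
      unfolding J_def by argo
    then show ?thesis
      using m_le[OF h] sJ[of i] sJ[of j] quadratic_add[OF s[of i] s[of j]] quadratic_diff[OF s[of i] s[of j]]
      unfolding J_def by (simp add: algebra_simps)
  qed
  have "\<exists>w\<in>Q. (\<lambda>n. Re (B (\<lambda>x. s n x - w x) (\<lambda>x. s n x - w x))) \<longlonglongrightarrow> 0"
  proof (rule complete[OF s])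
    fix e :: real assume "e > 0"
    then obtain N where N: "1 / real (Suc N) < e / 4"
      by (metis nat_approx_posE zero_less_divide_iff zero_less_numeral)
    have "Re (B (\<lambda>x. s i x - s j x) (\<lambda>x. s i x - s j x)) \<le> e" if "i \<ge> N" "j \<ge> N" for i j
    proof -
      have "1 / real (Suc i) \<le> 1 / real (Suc N)" "1 / real (Suc j) \<le> 1 / real (Suc N)"
        using that by (auto intro!: divide_left_mono)
      then show ?thesis using par[of i j] N by simp
    qed
    then show "\<exists>N. \<forall>i\<ge>N. \<forall>j\<ge>N. Re (B (\<lambda>x. s i x - s j x) (\<lambda>x. s i x - s j x)) \<le> e" by blast
  qed
  then obtain w where w: "w \<in> Q"
    and lim: "(\<lambda>n. Re (B (\<lambda>x. s n x - w x) (\<lambda>x. s n x - w x))) \<longlonglongrightarrow> 0" by blast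
  have conv: "(\<lambda>n. B (s n) v) \<longlonglongrightarrow> B w v" if v: "v \<in> Q" for v
  proof (rule LIM_zero_cancel, rule tendsto_norm_zero_cancel)
    have "(\<lambda>n. sqrt (Re (B (\<lambda>x. s n x - w x) (\<lambda>x. s n x - w x)) * Re (B v v))) \<longlonglongrightarrow> sqrt (0 * Re (B v v))"
      by (intro tendsto_intros lim)
    then have lim': "(\<lambda>n. sqrt (Re (B (\<lambda>x. s n x - w x) (\<lambda>x. s n x - w x)) * Re (B v v))) \<longlonglongrightarrow> 0" by simp
    show "(\<lambda>n. cmod (B (s n) v - B w v)) \<longlonglongrightarrow> 0"
    proof (rule tendsto_sandwich[OF _ _ tendsto_const lim'])
      show "\<forall>\<^sub>F n in sequentially. cmod (B (s n) v - B w v)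
          \<le> sqrt (Re (B (\<lambda>x. s n x - w x) (\<lambda>x. s n x - w x)) * Re (B v v))"
        using Cauchy_Schwarz[OF mem_diff[OF s w] v] diff_left[OF s w v]
        by (auto intro!: always_eventually real_le_rsqrt)
    qed simp
  qed
  have Re_eq: "Re (B w v) = Re (L v)" if v: "v \<in> Q" for v
  proof -
    define p where "p = (\<lambda>n. Re (B (s n) v) - Re (L v))"
    have plim: "p \<longlonglongrightarrow> Re (B w v) - Re (L v)"
      unfolding p_def by (intro tendsto_intros conv v)
    have "0 \<le> 0 + 2 * t * (Re (B w v) - Re (L v)) + t\<^sup>2 * Re (B v v)" for t
    proof (rule LIMSEQ_le_const)
      show "(\<lambda>n. 1 / real (Suc n) + 2 * t * p n + t\<^sup>2 * Re (B v v))
          \<longlonglongrightarrow> 0 + 2 * t * (Re (B w v) - Re (L v)) + t\<^sup>2 * Re (B v v)"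
        by (intro tendsto_intros plim LIMSEQ_Suc[OF lim_1_over_n])
      have "0 \<le> 1 / real (Suc n) + 2 * t * p n + t\<^sup>2 * Re (B v v)" for n
      proof -
        have tv: "(\<lambda>x. of_real t * v x) \<in> Q" using v by (rule mem_scale)
        have "J (\<lambda>x. s n x + of_real t * v x) = J (s n) + 2 * t * p n + t\<^sup>2 * Re (B v v)"
          using quadratic_add[OF s tv, of n] quadratic_scale[OF v, of "of_real t"]
            scale_right[OF v s, where c = "of_real t"] l_add[OF s tv, of n] l_scale[OF v, of "of_real t"]
          by (simp add: J_def p_def algebra_simps)
        then show ?thesis using m_le[OF mem_add[OF s tv], of n] sJ[of n] by simp
      qed
      then show "\<exists>N. \<forall>n\<ge>N. 0 \<le> 1 / real (Suc n) + 2 * t * p n + t\<^sup>2 * Re (B v v)" by blast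
    qed
    \<comment> \<open>A quadratic polynomial with minimum \<open>0\<close> at the origin has no linear term.\<close>
    from nonneg_quadratic_discriminant[OF this] show ?thesis by simp
  qed
  \<comment> \<open>The imaginary part follows from the real part at \<open>\<i> v\<close>.\<close>
  have "B w v = L v" if v: "v \<in> Q" for v
  proof (rule complex_eqI)
    show "Re (B w v) = Re (L v)" using v by (rule Re_eq)
    show "Im (B w v) = Im (L v)"
      using Re_eq[OF mem_scale[OF v, of \<i>]] scale_right[OF v w, of \<i>] l_scale[OF v, of \<i>] by simp
  qed
  with w show ?thesis by blast
qed

end

section \<open>The Hilbert space of square-integrable functions\<close>

lemma L2I:
  assumes "f \<in> borel_measurable lborel" "integrable lborel (\<lambda>x. (norm (f x))\<^sup>2)"
  shows "f \<in> L2"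
  using assms by (simp add: L2_def)

lemma L2_measurable [measurable_dest]: "f \<in> L2 \<Longrightarrow> f \<in> borel_measurable lborel"
  by (simp add: L2_def)

lemma L2_square_integrable: "f \<in> L2 \<Longrightarrow> integrable lborel (\<lambda>x. (norm (f x))\<^sup>2)"
  by (simp add: L2_def)

lemma L2_iff_nn_integral:
  "f \<in> L2 \<longleftrightarrow> f \<in> borel_measurable lborel \<and> (\<integral>\<^sup>+x. ennreal ((norm (f x))\<^sup>2) \<partial>lborel) < \<infinity>"
  by (auto simp: L2_def integrable_iff_bounded)

lemma nn_integral_L2_norm:
  assumes "f \<in> L2"
  shows "(\<integral>\<^sup>+x. ennreal ((norm (f x))\<^sup>2) \<partial>lborel) = ennreal ((L2_norm f)\<^sup>2)"
  using L2_square_integrable[OF assms]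
  by (subst nn_integral_eq_integral) (auto simp: L2_norm_def integral_nonneg_AE)

lemma L2_norm_square_eq: "(L2_norm f)\<^sup>2 = (\<integral>x. (norm (f x))\<^sup>2 \<partial>lborel)"
  by (simp add: L2_norm_def)

lemma L2_norm_nonneg: "L2_norm f \<ge> 0"
  by (simp add: L2_norm_def)

lemma L2_mult_integrable:
  assumes "f \<in> L2" "g \<in> L2"
  shows "integrable lborel (\<lambda>x. f x * g x)"
proof (rule Bochner_Integration.integrable_bound)
  show "integrable lborel (\<lambda>x. (norm (f x))\<^sup>2 + (norm (g x))\<^sup>2)"
    using assms by (intro Bochner_Integration.integrable_add L2_square_integrable)
  show "(\<lambda>x. f x * g x) \<in> borel_measurable lborel"
    using assms[THEN L2_measurable] by measurable
  have "norm (f x * g x) \<le> norm ((norm (f x))\<^sup>2 + (norm (g x))\<^sup>2)" for x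
  proof -
    have "0 \<le> norm (f x) * norm (g x)" by simp
    then have "norm (f x) * norm (g x) \<le> (norm (f x))\<^sup>2 + (norm (g x))\<^sup>2"
      using sum_squares_bound[of "norm (f x)" "norm (g x)"] by linarith
    then show ?thesis by (simp add: norm_mult)
  qed
  then show "AE x in lborel. norm (f x * g x) \<le> norm ((norm (f x))\<^sup>2 + (norm (g x))\<^sup>2)" by simp
qed

lemma L2_cnj: "f \<in> L2 \<Longrightarrow> (\<lambda>x. cnj (f x)) \<in> L2"
  unfolding L2_def by (auto intro!: borel_measurable_continuous_on[where f = cnj] continuous_intros)

lemma L2_inner_integrable: "f \<in> L2 \<Longrightarrow> g \<in> L2 \<Longrightarrow> integrable lborel (\<lambda>x. f x * cnj (g x))"
  using L2_mult_integrable L2_cnj by blast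

lemma L2_inner_self: "L2_inner f f = complex_of_real ((L2_norm f)\<^sup>2)"
proof -
  have "L2_inner f f = (\<integral>x. complex_of_real ((norm (f x))\<^sup>2) \<partial>lborel)"
    unfolding L2_inner_def by (intro Bochner_Integration.integral_cong) (simp_all only: complex_norm_square)
  also have "\<dots> = complex_of_real (\<integral>x. (norm (f x))\<^sup>2 \<partial>lborel)"
    by (rule integral_complex_of_real)
  finally show ?thesis by (simp only: L2_norm_square_eq)
qed

lemma Re_L2_inner_self: "Re (L2_inner f f) = (L2_norm f)\<^sup>2"
  by (simp add: L2_inner_self del: of_real_power)

lemma L2_inner_commute: "L2_inner g f = cnj (L2_inner f g)"
  unfolding L2_inner_def by (subst Bochner_Integration.integral_cnj[symmetric]) (simp add: mult.commute)

lemma L2_add: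
  assumes "f \<in> L2" "g \<in> L2"
  shows "(\<lambda>x. f x + g x) \<in> L2"
proof (rule L2I)
  show "(\<lambda>x. f x + g x) \<in> borel_measurable lborel"
    using assms[THEN L2_measurable] by measurable
  show "integrable lborel (\<lambda>x. (norm (f x + g x))\<^sup>2)"
  proof (rule Bochner_Integration.integrable_bound)
    show "integrable lborel (\<lambda>x. 2 * (norm (f x))\<^sup>2 + 2 * (norm (g x))\<^sup>2)"
      using assms by (intro Bochner_Integration.integrable_add integrable_mult_right L2_square_integrable)
    show "(\<lambda>x. (norm (f x + g x))\<^sup>2) \<in> borel_measurable lborel"
      using assms[THEN L2_measurable] by measurable
    have "(norm (f x + g x))\<^sup>2 \<le> 2 * (norm (f x))\<^sup>2 + 2 * (norm (g x))\<^sup>2" for x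
    proof -
      have "(norm (f x + g x))\<^sup>2 \<le> (norm (f x) + norm (g x))\<^sup>2"
        by (intro power_mono norm_triangle_ineq norm_ge_zero)
      then show ?thesis using sum_squares_bound[of "norm (f x)" "norm (g x)"]
        by (simp add: power2_sum)
    qed
    then show "AE x in lborel. norm ((norm (f x + g x))\<^sup>2) \<le> norm (2 * (norm (f x))\<^sup>2 + 2 * (norm (g x))\<^sup>2)"
      by simp
  qed
qed

lemma L2_scale: "f \<in> L2 \<Longrightarrow> (\<lambda>x. c * f x) \<in> L2"
  unfolding L2_def by (auto simp: norm_mult power_mult_distrib)

lemma L2_zero: "(\<lambda>x. 0) \<in> L2"
  by (simp add: L2_def)

interpretation L2: semi_inner_space "L2 :: ('a::euclidean_space \<Rightarrow> complex) set" L2_inner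
proof
  show "(L2 :: ('a \<Rightarrow> complex) set) \<noteq> {}" using L2_zero by blast
  show "(\<lambda>x. f x + g x) \<in> L2" if "f \<in> L2" "g \<in> L2" for f g :: "'a \<Rightarrow> complex"
    using that by (rule L2_add)
  show "(\<lambda>x. c * f x) \<in> L2" if "f \<in> L2" for c and f :: "'a \<Rightarrow> complex"
    using that by (rule L2_scale)
  show "L2_inner (\<lambda>x. f x + g x) w = L2_inner f w + L2_inner g w"
    if "f \<in> L2" "g \<in> L2" "w \<in> L2" for f g w :: "'a \<Rightarrow> complex"
    unfolding L2_inner_def
    using that by (simp add: distrib_right Bochner_Integration.integral_add L2_inner_integrable)
  show "L2_inner (\<lambda>x. c * f x) w = c * L2_inner f w" for c and f w :: "'a \<Rightarrow> complex"
    unfolding L2_inner_def by (simp add: mult.assoc)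
  show "L2_inner g f = cnj (L2_inner f g)" for f g :: "'a \<Rightarrow> complex"
    by (rule L2_inner_commute)
  show "0 \<le> Re (L2_inner f f)" for f :: "'a \<Rightarrow> complex"
    by (simp add: Re_L2_inner_self)
qed

lemma L2_Cauchy_Schwarz:
  assumes "f \<in> L2" "g \<in> L2"
  shows "cmod (L2_inner f g) \<le> L2_norm f * L2_norm g"
proof (rule power2_le_imp_le)
  show "(cmod (L2_inner f g))\<^sup>2 \<le> (L2_norm f * L2_norm g)\<^sup>2"
    using L2.Cauchy_Schwarz[OF assms] by (simp add: Re_L2_inner_self power_mult_distrib)
qed (simp add: L2_norm_nonneg)

lemma L2_norm_triangle:
  assumes "f \<in> L2" "g \<in> L2"
  shows "L2_norm (\<lambda>x. f x + g x) \<le> L2_norm f + L2_norm g"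
proof (rule power2_le_imp_le)
  have "Re (L2_inner f g) \<le> L2_norm f * L2_norm g"
    using L2_Cauchy_Schwarz[OF assms] complex_Re_le_cmod order_trans by blast
  then show "(L2_norm (\<lambda>x. f x + g x))\<^sup>2 \<le> (L2_norm f + L2_norm g)\<^sup>2"
    using L2.quadratic_add[OF assms] by (simp add: Re_L2_inner_self power2_sum)
qed (simp add: L2_norm_nonneg)

lemma L2_norm_eq_0_iff:
  assumes "f \<in> L2"
  shows "L2_norm f = 0 \<longleftrightarrow> (AE x in lborel. f x = 0)"
  using integral_nonneg_eq_0_iff_AE[OF L2_square_integrable[OF assms]]
  by (simp add: L2_norm_def)

lemma L2_inner_cong_AE:
  assumes "AE x in lborel. f x = f' x" "AE x in lborel. g x = g' x"
    and "f \<in> L2" "f' \<in> L2" "g \<in> L2" "g' \<in> L2"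
  shows "L2_inner f g = L2_inner f' g'"
  unfolding L2_inner_def
proof (rule integral_cong_AE)
  show "(\<lambda>x. f x * cnj (g x)) \<in> borel_measurable lborel" "(\<lambda>x. f' x * cnj (g' x)) \<in> borel_measurable lborel"
    using L2_inner_integrable[OF assms(3,5)] L2_inner_integrable[OF assms(4,6)] by auto
  show "AE x in lborel. f x * cnj (g x) = f' x * cnj (g' x)"
    using assms(1,2) by eventually_elim simp
qed

lemma L2_norm_cong_AE:
  assumes "AE x in lborel. f x = g x" "f \<in> L2" "g \<in> L2"
  shows "L2_norm f = L2_norm g"
proof -
  have "(L2_norm f)\<^sup>2 = (L2_norm g)\<^sup>2"
    using L2_inner_cong_AE[OF assms(1) assms(1) assms(2,3) assms(2,3)] by (metis Re_L2_inner_self)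
  then show ?thesis using L2_norm_nonneg by (metis power2_eq_iff_nonneg)
qed

lemma ennreal_term_le_suminf:
  fixes f :: "nat \<Rightarrow> ennreal"
  shows "f k \<le> suminf f"
proof -
  have "sum f {k} \<le> suminf f" by (rule sum_le_suminf) (auto intro: summableI)
  then show ?thesis by simp
qed

text \<open>The weights \<open>2\<^sup>k\<close> turn the square-summability that comes from \<open>L\<^sup>2\<close> norms into geometric decay of
  the terms.\<close>

lemma summable_of_weighted_squares:
  fixes d :: "nat \<Rightarrow> complex"
  assumes "(\<Sum>k. ennreal (2 ^ k * (norm (d k))\<^sup>2)) < \<infinity>"
  shows "summable d"
proof -
  have "\<exists>K\<ge>0. S = ennreal K" if "S < \<infinity>" for S :: ennreal
    using that by (cases S) auto
  from this[OF assms] obtain K where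
    K: "(\<Sum>k. ennreal (2 ^ k * (norm (d k))\<^sup>2)) = ennreal K" "K \<ge> 0" by blast
  have "norm (d k) \<le> sqrt K * (sqrt (1/2)) ^ k" for k
  proof -
    have "ennreal (2 ^ k * (norm (d k))\<^sup>2) \<le> ennreal K"
      unfolding K(1)[symmetric] by (rule ennreal_term_le_suminf)
    then have "2 ^ k * (norm (d k))\<^sup>2 \<le> K" using K(2) by simp
    then have "(norm (d k))\<^sup>2 \<le> K * (1/2) ^ k" by (simp add: power_one_over pos_le_divide_eq mult.commute)
    then have "norm (d k) \<le> sqrt (K * (1/2) ^ k)" by (rule real_le_rsqrt)
    then show ?thesis by (simp add: real_sqrt_mult real_sqrt_power)
  qed
  moreover have "sqrt (1/2::real) < 1" by simp
  then have "summable (\<lambda>k. sqrt K * (sqrt (1/2)) ^ k)"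
    by (intro summable_mult summable_geometric) auto
  ultimately show ?thesis
    by (intro summable_comparison_test[of d "\<lambda>k. sqrt K * (sqrt (1/2)) ^ k"] exI[of _ 0]) blast+
qed

text \<open>The Riesz-Fischer theorem.  Along a subsequence whose consecutive \<open>L\<^sup>2\<close> distances decay fast, the
  series of weighted squares of the increments has a finite integral, so the subsequence converges
  almost everywhere; Fatou's lemma shows that the pointwise limit is the \<open>L\<^sup>2\<close> limit.\<close>

theorem L2_complete:
  fixes s :: "nat \<Rightarrow> 'a::euclidean_space \<Rightarrow> complex"
  assumes s: "\<And>n. s n \<in> L2"
    and Cauchy: "\<And>e::real. e > 0 \<Longrightarrow> \<exists>N. \<forall>m\<ge>N. \<forall>n\<ge>N. (L2_norm (\<lambda>x. s m x - s n x))\<^sup>2 \<le> e"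
  shows "\<exists>f\<in>L2. (\<lambda>n. (L2_norm (\<lambda>x. s n x - f x))\<^sup>2) \<longlonglongrightarrow> 0"
proof -
  have [measurable]: "s n \<in> borel_measurable lborel" for n using s by (rule L2_measurable)
  have diff: "(\<lambda>x. s m x - s n x) \<in> L2" for m n by (intro L2.mem_diff s)
  have "\<exists>N. \<forall>m\<ge>N. \<forall>n\<ge>N. (L2_norm (\<lambda>x. s m x - s n x))\<^sup>2 \<le> (1/4) ^ k" for k :: nat
    by (rule Cauchy) simp
  then obtain N where N: "\<And>k m n. m \<ge> N k \<Longrightarrow> n \<ge> N k \<Longrightarrow> (L2_norm (\<lambda>x. s m x - s n x))\<^sup>2 \<le> (1/4) ^ k"
    by metis
  \<comment> \<open>The sum makes the chosen indices increase and dominate both \<open>N k\<close> and \<open>k\<close>.\<close>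
  define r where "r = (\<lambda>k. \<Sum>i\<le>k. Suc (N i))"
  have rN: "r k \<ge> N k" for k
    unfolding r_def using member_le_sum[of k "{..k}" "\<lambda>i. Suc (N i)"] by simp
  have rS: "r (Suc k) \<ge> r k" for k by (simp add: r_def)
  have rk: "r k \<ge> k" for k by (induction k) (auto simp: r_def)
  define d where "d = (\<lambda>k x. s (r (Suc k)) x - s (r k) x)"
  have d_L2: "d k \<in> L2" for k unfolding d_def by (rule diff)
  have [measurable]: "d k \<in> borel_measurable lborel" for k using d_L2 by (rule L2_measurable)
  have d_le: "(L2_norm (d k))\<^sup>2 \<le> (1/4) ^ k" for k
    unfolding d_def by (rule N) (use rN[of k] rS[of k] in linarith)+
  define S where "S = (\<lambda>x. \<Sum>k. ennreal (2 ^ k * (norm (d k x))\<^sup>2))"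
  have [measurable]: "S \<in> borel_measurable lborel" unfolding S_def by measurable
  have "integral\<^sup>N lborel S = (\<Sum>k. \<integral>\<^sup>+x. ennreal (2 ^ k * (norm (d k x))\<^sup>2) \<partial>lborel)"
    unfolding S_def by (rule nn_integral_suminf) measurable
  also have "\<dots> \<le> (\<Sum>k. ennreal ((1/2) ^ k))"
  proof (intro suminf_le allI summableI)
    fix k
    have "(\<integral>\<^sup>+x. ennreal (2 ^ k * (norm (d k x))\<^sup>2) \<partial>lborel) = ennreal (2 ^ k) * ennreal ((L2_norm (d k))\<^sup>2)"
    proof -
      have "ennreal (2 ^ k * (norm z)\<^sup>2) = ennreal (2 ^ k) * ennreal ((norm z)\<^sup>2)" for z :: complex
        by (rule ennreal_mult) simp_all
      then have "(\<integral>\<^sup>+x. ennreal (2 ^ k * (norm (d k x))\<^sup>2) \<partial>lborel)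
          = (\<integral>\<^sup>+x. ennreal (2 ^ k) * ennreal ((norm (d k x))\<^sup>2) \<partial>lborel)" by (simp only:)
      also have "\<dots> = ennreal (2 ^ k) * (\<integral>\<^sup>+x. ennreal ((norm (d k x))\<^sup>2) \<partial>lborel)"
        by (rule nn_integral_cmult) measurable
      finally show ?thesis by (simp only: nn_integral_L2_norm[OF d_L2])
    qed
    also have "\<dots> = ennreal (2 ^ k * (L2_norm (d k))\<^sup>2)" by (rule ennreal_mult[symmetric]) simp_all
    also have "\<dots> \<le> ennreal (2 ^ k * (1/4) ^ k)"
      by (intro ennreal_leI mult_left_mono d_le) simp
    also have "(2::real) ^ k * (1/4) ^ k = (1/2) ^ k" by (simp flip: power_mult_distrib)
    finally show "(\<integral>\<^sup>+x. ennreal (2 ^ k * (norm (d k x))\<^sup>2) \<partial>lborel) \<le> ennreal ((1/2) ^ k)" .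
  qed
  also have "\<dots> = ennreal (\<Sum>k. (1/2) ^ k)"
    by (rule suminf_ennreal2) (auto intro: summable_geometric)
  also have "\<dots> < \<infinity>" by simp
  finally have "AE x in lborel. S x \<noteq> \<infinity>"
    by (intro nn_integral_PInf_AE) auto
  then have conv: "AE x in lborel. convergent (\<lambda>k. s (r k) x)"
  proof eventually_elim
    case (elim x)
    then have "S x < \<infinity>" by (simp add: less_top)
    then have "summable (\<lambda>k. d k x)"
      unfolding S_def by (rule summable_of_weighted_squares)
    then have "convergent (\<lambda>n. \<Sum>k<n. d k x)" by (simp add: summable_iff_convergent)
    then have "convergent (\<lambda>n. s (r n) x - s (r 0) x)"
      unfolding d_def by (subst (asm) sum_lessThan_telescope)
    then show ?case by (simp add: convergent_diff_const_right_iff)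
  qed
  define f where "f = (\<lambda>x. lim (\<lambda>k. s (r k) x))"
  have f_meas [measurable]: "f \<in> borel_measurable lborel"
    unfolding f_def by measurable
  have close: "(\<integral>\<^sup>+x. ennreal ((norm (s n x - f x))\<^sup>2) \<partial>lborel) \<le> ennreal e"
    if "\<And>m. m \<ge> M \<Longrightarrow> (L2_norm (\<lambda>x. s n x - s m x))\<^sup>2 \<le> e" for n M e
  proof -
    have "(\<integral>\<^sup>+x. ennreal ((norm (s n x - f x))\<^sup>2) \<partial>lborel)
        = (\<integral>\<^sup>+x. liminf (\<lambda>k. ennreal ((norm (s n x - s (r k) x))\<^sup>2)) \<partial>lborel)"
    proof (rule nn_integral_cong_AE, use conv in eventually_elim)
      case (elim x)
      then have "(\<lambda>k. s (r k) x) \<longlonglongrightarrow> f x" by (simp add: f_def convergent_LIMSEQ_iff)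
      then have "(\<lambda>k. ennreal ((norm (s n x - s (r k) x))\<^sup>2)) \<longlonglongrightarrow> ennreal ((norm (s n x - f x))\<^sup>2)"
        by (intro tendsto_intros)
      from lim_imp_Liminf[OF _ this] show ?case by simp
    qed
    also have "\<dots> \<le> liminf (\<lambda>k. \<integral>\<^sup>+x. ennreal ((norm (s n x - s (r k) x))\<^sup>2) \<partial>lborel)"
      by (rule nn_integral_liminf) measurable
    also have "\<dots> = liminf (\<lambda>k. ennreal ((L2_norm (\<lambda>x. s n x - s (r k) x))\<^sup>2))"
      by (simp add: nn_integral_L2_norm[OF diff])
    also have "\<dots> \<le> liminf (\<lambda>k. ennreal e)"
    proof (rule Liminf_mono)
      show "\<forall>\<^sub>F k in sequentially. ennreal ((L2_norm (\<lambda>x. s n x - s (r k) x))\<^sup>2) \<le> ennreal e"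
        using eventually_ge_at_top[of M]
      proof eventually_elim
        case (elim k)
        then show ?case using that[of "r k"] rk[of k] by (intro ennreal_leI) linarith
      qed
    qed
    also have "\<dots> = ennreal e" by (simp add: Liminf_const)
    finally show ?thesis .
  qed
  \<comment> \<open>The index \<open>N 0\<close> is one whose later terms stay within distance \<open>1\<close>.\<close>
  have sf: "(\<lambda>x. s (N 0) x - f x) \<in> L2"
    unfolding L2_iff_nn_integral
    using close[of "N 0" "N 0" 1] N[of 0 "N 0"] by (auto intro: le_less_trans)
  have f: "f \<in> L2"
    using L2.mem_diff[OF s[of "N 0"] sf] by simp
  moreover have "(\<lambda>n. (L2_norm (\<lambda>x. s n x - f x))\<^sup>2) \<longlonglongrightarrow> 0"
  proof (rule LIMSEQ_I)
    fix e :: real assume "e > 0"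
    then obtain M where M: "\<And>m n. m \<ge> M \<Longrightarrow> n \<ge> M \<Longrightarrow> (L2_norm (\<lambda>x. s m x - s n x))\<^sup>2 \<le> e / 2"
      using Cauchy[of "e / 2"] by auto
    have "norm ((L2_norm (\<lambda>x. s n x - f x))\<^sup>2 - 0) < e" if "n \<ge> M" for n
    proof -
      have "ennreal ((L2_norm (\<lambda>x. s n x - f x))\<^sup>2) \<le> ennreal (e / 2)"
        using close[of M n "e / 2"] M[OF that] by (simp add: nn_integral_L2_norm[OF L2.mem_diff[OF s f]])
      then show ?thesis using \<open>e > 0\<close> by simp
    qed
    then show "\<exists>no. \<forall>n\<ge>no. norm ((L2_norm (\<lambda>x. s n x - f x))\<^sup>2 - 0) < e" by blast
  qed
  ultimately show ?thesis by blast
qed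

section \<open>Test functions and the fundamental lemma of the calculus of variations\<close>

lemma frechet_derivative_eqI:
  "(f has_derivative f') (at x) \<Longrightarrow> frechet_derivative f (at x) = f'"
  by (rule frechet_derivative_at[symmetric])

lemma has_derivative_frechet:
  "\<phi> differentiable_on UNIV \<Longrightarrow> (\<phi> has_derivative frechet_derivative \<phi> (at x)) (at x)"
  by (simp add: differentiable_on_def flip: frechet_derivative_works)

lemma C_k_SucD: "C_k (Suc k) \<phi> \<Longrightarrow> C_k k \<phi>"
proof (induction k arbitrary: \<phi>)
  case 0
  then show ?case by (auto intro: differentiable_imp_continuous_on)
next
  case (Suc k)
  then show ?case by (metis C_k.simps(2))
qed

lemma C_k_const: "C_k k (\<lambda>x. c)"
  by (induction k arbitrary: c) auto

lemma C_k_add: "C_k k \<phi> \<Longrightarrow> C_k k \<psi> \<Longrightarrow> C_k k (\<lambda>x. \<phi> x + \<psi> x)"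
proof (induction k arbitrary: \<phi> \<psi>)
  case 0
  then show ?case by (auto intro: continuous_intros)
next
  case (Suc k)
  have "frechet_derivative (\<lambda>x. \<phi> x + \<psi> x) (at x)
      = (\<lambda>y. frechet_derivative \<phi> (at x) y + frechet_derivative \<psi> (at x) y)" for x
    by (rule frechet_derivative_eqI) (use Suc.prems in \<open>auto intro!: derivative_intros has_derivative_frechet\<close>)
  then show ?case using Suc by (auto intro!: derivative_intros)
qed

lemma C_k_mult: "C_k k \<phi> \<Longrightarrow> C_k k \<psi> \<Longrightarrow> C_k k (\<lambda>x. \<phi> x * \<psi> x)"
proof (induction k arbitrary: \<phi> \<psi>)
  case 0
  then show ?case by (auto intro: continuous_intros)
next
  case (Suc k)
  have "frechet_derivative (\<lambda>x. \<phi> x * \<psi> x) (at x)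
      = (\<lambda>y. \<phi> x * frechet_derivative \<psi> (at x) y + frechet_derivative \<phi> (at x) y * \<psi> x)" for x
    by (rule frechet_derivative_eqI) (use Suc.prems in \<open>auto intro!: derivative_intros has_derivative_frechet\<close>)
  then show ?case using Suc C_k_SucD[OF Suc.prems(1)] C_k_SucD[OF Suc.prems(2)]
    by (auto intro!: derivative_intros C_k_add)
qed

lemma C_k_prod: "finite A \<Longrightarrow> (\<And>i. i \<in> A \<Longrightarrow> C_k k (\<phi> i)) \<Longrightarrow> C_k k (\<lambda>x. \<Prod>i\<in>A. \<phi> i x)"
  by (induction A rule: finite_induct) (auto intro: C_k_const C_k_mult)

lemma has_derivative_translate:
  assumes "\<phi> differentiable_on UNIV"
  shows "((\<lambda>x. \<phi> (x + z)) has_derivative frechet_derivative \<phi> (at (x + z))) (at x)"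
proof -
  have "((\<lambda>x. x + z) has_derivative (\<lambda>y. y)) (at x)"
    by (auto intro!: derivative_eq_intros)
  from has_derivative_compose[OF this has_derivative_frechet[OF assms]] show ?thesis by simp
qed

lemmas frechet_derivative_translate = has_derivative_translate[THEN frechet_derivative_eqI]

lemma C_k_translate: "C_k k \<phi> \<Longrightarrow> C_k k (\<lambda>x. \<phi> (x + z))"
proof (induction k arbitrary: \<phi>)
  case 0
  then show ?case
    by (auto intro!: continuous_on_compose2[of UNIV \<phi>] continuous_intros)
next
  case (Suc k)
  then have diff: "\<phi> differentiable_on UNIV" by simp
  have "(\<lambda>x. \<phi> (x + z)) differentiable_on UNIV"
    using has_derivative_translate[OF diff] by (auto simp: differentiable_on_def differentiable_def)
  then show ?case using Suc.IH Suc.prems by (auto simp: frechet_derivative_translate[OF diff])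
qed

text \<open>With \<open>p = 1\<close> this is the classical smooth function that is \<open>0\<close> on the negative axis and positive
  on the positive one.  The polynomial factor makes the family closed under differentiation, so that
  smoothness is an induction.\<close>

definition flat :: "real poly \<Rightarrow> real \<Rightarrow> real" where
  "flat p t = (if t \<le> 0 then 0 else poly p (1 / t) * exp (- (1 / t)))"

definition flat_deriv :: "real poly \<Rightarrow> real poly" where
  "flat_deriv p = [:0, 0, 1:] * (p - pderiv p)"

lemma poly_exp_tendsto_0: "((\<lambda>x::real. poly p x * exp (- x)) \<longlongrightarrow> 0) at_top"
proof -
  have "((\<lambda>x. \<Sum>i\<le>degree p. coeff p i * (x ^ i / exp x)) \<longlongrightarrow> (\<Sum>i\<le>degree p. coeff p i * 0)) at_top"
    by (intro tendsto_intros tendsto_power_div_exp_0)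
  then show ?thesis
    by (simp add: poly_altdef sum_distrib_right exp_minus divide_inverse mult.assoc)
qed

lemma flat_has_derivative: "(flat p has_real_derivative flat (flat_deriv p) t) (at t)"
proof -
  consider "t < 0" | "t = 0" | "t > 0" by linarith
  then show ?thesis
  proof cases
    case 1
    have "((\<lambda>_. 0) has_real_derivative 0) (at t)" by simp
    then have "(flat p has_real_derivative 0) (at t)"
      by (rule has_field_derivative_transform_within_open[of _ _ _ "{..<0}"])
         (use 1 in \<open>auto simp: flat_def\<close>)
    then show ?thesis using 1 by (simp add: flat_def)
  next
    case 2
    \<comment> \<open>At the origin the factor \<open>1 / h\<close> of the difference quotient is absorbed into the polynomial.\<close>
    have 1: "((\<lambda>h. flat p h / h) \<longlongrightarrow> 0) (at_right 0)"
    proof -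
      have "filterlim (\<lambda>h::real. 1 / h) at_top (at_right 0)"
        using filterlim_inverse_at_top_right by (simp add: inverse_eq_divide)
      from filterlim_compose[OF poly_exp_tendsto_0[of "[:0,1:] * p"] this]
      have "((\<lambda>h. 1 / h * poly p (1 / h) * exp (- (1 / h))) \<longlongrightarrow> 0) (at_right 0)" by simp
      then show ?thesis
        by (rule Lim_transform_eventually)
           (auto simp: flat_def eventually_at_filter)
    qed
    have 2: "((\<lambda>h. flat p h / h) \<longlongrightarrow> 0) (at_left 0)"
      by (rule Lim_transform_eventually[OF tendsto_const])
         (auto simp: flat_def eventually_at_filter)
    have "((\<lambda>h. flat p h / h) \<longlongrightarrow> 0) (at 0)"
      using 1 2 by (simp add: filterlim_split_at)
    then show ?thesis using \<open>t = 0\<close> by (simp add: DERIV_def flat_def)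
  next
    case 3
    have "((\<lambda>t. poly p (1 / t) * exp (- (1 / t))) has_real_derivative
        poly p (1 / t) * (exp (- (1 / t)) * (1 / t\<^sup>2)) + poly (pderiv p) (1 / t) * (- 1 / t\<^sup>2) * exp (- (1 / t))) (at t)"
      using 3 by (auto intro!: derivative_eq_intros DERIV_chain2[OF poly_DERIV] simp: power2_eq_square)
    also have "poly p (1 / t) * (exp (- (1 / t)) * (1 / t\<^sup>2)) + poly (pderiv p) (1 / t) * (- 1 / t\<^sup>2) * exp (- (1 / t))
      = flat (flat_deriv p) t"
      using 3 by (simp add: flat_def flat_deriv_def field_simps power2_eq_square)
    finally show ?thesis
      by (rule has_field_derivative_transform_within_open[of _ _ _ "{0<..}"])
         (use 3 in \<open>auto simp: flat_def\<close>)
  qed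
qed

lemma C_k_flat: "C_k k (\<lambda>x. flat p (x \<bullet> v + d))"
proof (induction k arbitrary: p)
  case 0
  have "continuous_on UNIV (flat p)"
    by (intro DERIV_continuous_on) (rule has_field_derivative_at_within[OF flat_has_derivative])
  then show ?case
    by (auto intro!: continuous_on_compose2[of UNIV "flat p"] continuous_intros)
next
  case (Suc k)
  have der: "((\<lambda>x. flat p (x \<bullet> v + d)) has_derivative (\<lambda>y. flat (flat_deriv p) (x \<bullet> v + d) * (y \<bullet> v))) (at x)" for x
    by (rule has_derivative_compose[of "\<lambda>x. x \<bullet> v + d" "\<lambda>y. y \<bullet> v" x UNIV "flat p", simplified])
       (auto intro!: derivative_eq_intros flat_has_derivative[THEN has_field_derivative_imp_has_derivative])
  have "frechet_derivative (\<lambda>x. flat p (x \<bullet> v + d)) (at x) = (\<lambda>y. flat (flat_deriv p) (x \<bullet> v + d) * (y \<bullet> v))" for x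
    using der by (rule frechet_derivative_eqI)
  moreover have "(\<lambda>x. flat p (x \<bullet> v + d)) differentiable_on UNIV"
    using der by (auto simp: differentiable_on_def differentiable_def)
  ultimately show ?case using Suc by (auto intro!: C_k_mult C_k_const)
qed

lemma test_function_C_k: "test_function \<phi> \<Longrightarrow> C_k k \<phi>"
  by (simp add: test_function_def)

lemma test_function_continuous: "test_function \<phi> \<Longrightarrow> continuous_on UNIV \<phi>"
  using test_function_C_k[of \<phi> 0] by simp

lemma test_function_differentiable: "test_function \<phi> \<Longrightarrow> \<phi> differentiable_on UNIV"
  using test_function_C_k[of \<phi> 1] by simp

lemma compact_closure_subset:
  fixes S :: "'a::euclidean_space set"
  assumes "compact K" "S \<subseteq> K"
  shows "compact (closure S)"
  using assms by (meson bounded_subset compact_closure compact_imp_bounded)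

lemma test_function_derivative:
  assumes "test_function \<phi>" "b \<in> Basis"
  shows "test_function (\<lambda>x. frechet_derivative \<phi> (at x) b)"
proof -
  have "C_k k (\<lambda>x. frechet_derivative \<phi> (at x) b)" for k
    using test_function_C_k[OF assms(1), of "Suc k"] assms(2) by simp
  moreover have "{x. frechet_derivative \<phi> (at x) b \<noteq> 0} \<subseteq> closure {x. \<phi> x \<noteq> 0}"
  proof (rule subsetI, rule ccontr)
    fix x assume x: "x \<in> {x. frechet_derivative \<phi> (at x) b \<noteq> 0}" "x \<notin> closure {x. \<phi> x \<noteq> 0}"
    have "((\<lambda>_. 0) has_derivative (\<lambda>_. 0)) (at x)" by simp
    then have "(\<phi> has_derivative (\<lambda>_. 0)) (at x)"
      by (rule has_derivative_transform_within_open[of _ _ _ _ "- closure {x. \<phi> x \<noteq> 0}"])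
         (use x(2) in \<open>auto intro: subsetD[OF closure_subset]\<close>)
    from frechet_derivative_eqI[OF this] x(1) show False by simp
  qed
  ultimately show ?thesis
    using assms(1) compact_closure_subset unfolding test_function_def by blast
qed

lemma test_function_translate:
  assumes "test_function \<phi>"
  shows "test_function (\<lambda>x. \<phi> (x + z))"
proof -
  have "compact ((\<lambda>x. x - z) ` closure {x. \<phi> x \<noteq> 0})"
    using assms by (intro compact_continuous_image continuous_intros) (simp add: test_function_def)
  moreover have "{x. \<phi> (x + z) \<noteq> 0} \<subseteq> (\<lambda>x. x - z) ` closure {x. \<phi> x \<noteq> 0}"
  proof
    fix x assume "x \<in> {x. \<phi> (x + z) \<noteq> 0}"
    then have "x + z \<in> closure {x. \<phi> x \<noteq> 0}" by (intro subsetD[OF closure_subset]) simp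
    then show "x \<in> (\<lambda>x. x - z) ` closure {x. \<phi> x \<noteq> 0}" by (auto intro!: image_eqI[of _ _ "x + z"])
  qed
  ultimately show ?thesis
    using assms compact_closure_subset C_k_translate unfolding test_function_def by blast
qed

lemma continuous_L2_indicator_compact:
  fixes f :: "'a::euclidean_space \<Rightarrow> complex"
  assumes "compact K" "continuous_on K f"
  shows "(\<lambda>x. indicator K x *\<^sub>R f x) \<in> L2"
proof (rule L2I)
  show "(\<lambda>x. indicator K x *\<^sub>R f x) \<in> borel_measurable lborel"
    by (rule borel_measurable_integrable[OF borel_integrable_compact[OF assms]])
  have "integrable lborel (\<lambda>x. indicator K x *\<^sub>R (norm (f x))\<^sup>2)"
    using assms by (intro borel_integrable_compact continuous_intros)
  then show "integrable lborel (\<lambda>x. (norm (indicator K x *\<^sub>R f x))\<^sup>2)"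
    by (rule Bochner_Integration.integrable_cong[THEN iffD1, rotated 2]) (auto split: split_indicator)
qed

lemma test_function_L2:
  assumes "test_function \<phi>"
  shows "(\<lambda>x. complex_of_real (\<phi> x)) \<in> L2"
proof -
  let ?K = "closure {x. \<phi> x \<noteq> 0}"
  have "(\<lambda>x. indicator ?K x *\<^sub>R complex_of_real (\<phi> x)) \<in> L2"
    using assms by (intro continuous_L2_indicator_compact continuous_intros
        continuous_on_subset[OF test_function_continuous]) (auto simp: test_function_def)
  moreover have "indicator ?K x *\<^sub>R complex_of_real (\<phi> x) = complex_of_real (\<phi> x)" for x
    using closure_subset[of "{x. \<phi> x \<noteq> 0}"] by (auto split: split_indicator)
  ultimately show ?thesis by simp
qed

lemma test_function_integrable:
  assumes "test_function \<phi>" "g \<in> L2"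
  shows "integrable lborel (\<lambda>x. \<phi> x *\<^sub>R g x)"
  using L2_mult_integrable[OF test_function_L2[OF assms(1)] assms(2)] by (simp add: scaleR_conv_of_real)

text \<open>As \<open>n\<close> grows, these test functions converge pointwise to the indicator of the open box, because
  \<open>exp (- 1 / (n t))\<close> tends to \<open>1\<close> for \<open>t > 0\<close>.\<close>

definition box_bump :: "nat \<Rightarrow> 'a::euclidean_space \<Rightarrow> 'a \<Rightarrow> 'a \<Rightarrow> real" where
  "box_bump n a c x = (\<Prod>b\<in>Basis. flat 1 (real n * ((x - a) \<bullet> b)) * flat 1 (real n * ((c - x) \<bullet> b)))"

lemma flat_1_bounds: "0 \<le> flat 1 t" "flat 1 t \<le> 1"
  by (auto simp: flat_def)

lemma box_bump_bounds: "0 \<le> box_bump n a c x" "box_bump n a c x \<le> 1"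
  unfolding box_bump_def
  by (auto intro!: prod_nonneg prod_le_1 mult_nonneg_nonneg mult_le_one flat_1_bounds)

lemma box_bump_outside: "x \<notin> box a c \<Longrightarrow> box_bump n a c x = 0"
proof -
  assume "x \<notin> box a c"
  then obtain b where b: "b \<in> Basis" "x \<bullet> b \<le> a \<bullet> b \<or> c \<bullet> b \<le> x \<bullet> b"
    by (auto simp: box_def not_less)
  then have "real n * ((x - a) \<bullet> b) \<le> 0 \<or> real n * ((c - x) \<bullet> b) \<le> 0"
    by (auto simp: inner_diff_left mult_nonneg_nonpos)
  then have "flat 1 (real n * ((x - a) \<bullet> b)) * flat 1 (real n * ((c - x) \<bullet> b)) = 0"
    by (auto simp: flat_def)
  with b(1) show ?thesis
    unfolding box_bump_def by (intro prod_zero) auto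
qed

lemma box_bump_test: "test_function (box_bump n a c)"
proof -
  have "C_k k (\<lambda>x. flat 1 (real n * ((x - a) \<bullet> b)) * flat 1 (real n * ((c - x) \<bullet> b)))" for k b
    using C_k_mult[OF C_k_flat[of k 1 "real n *\<^sub>R b" "- real n * (a \<bullet> b)"] C_k_flat[of k 1 "- real n *\<^sub>R b" "real n * (c \<bullet> b)"]]
    by (simp add: inner_diff_left algebra_simps)
  then have "C_k k (box_bump n a c)" for k
    unfolding box_bump_def[abs_def] by (intro C_k_prod) auto
  moreover have "{x. box_bump n a c x \<noteq> 0} \<subseteq> cbox a c"
    using box_bump_outside box_subset_cbox by blast
  ultimately show ?thesis
    unfolding test_function_def using compact_closure_subset compact_cbox by blast
qed

lemma flat_1_tendsto: "t > 0 \<Longrightarrow> (\<lambda>n. flat 1 (real n * t)) \<longlonglongrightarrow> 1"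
proof -
  assume t: "t > 0"
  have "(\<lambda>n. exp (- (1 / real n * (1 / t)))) \<longlonglongrightarrow> exp (- (0 * (1 / t)))"
    by (intro tendsto_intros lim_1_over_n)
  then have "(\<lambda>n. exp (- (1 / real n * (1 / t)))) \<longlonglongrightarrow> 1" by simp
  then show ?thesis
    by (rule Lim_transform_eventually)
       (use t eventually_gt_at_top[of 0] in \<open>auto elim!: eventually_mono simp: flat_def mult_le_0_iff\<close>)
qed

lemma box_bump_tendsto: "(\<lambda>n. box_bump n a c x) \<longlonglongrightarrow> indicator (box a c) x"
proof (cases "x \<in> box a c")
  case True
  then have "(\<lambda>n. flat 1 (real n * ((x - a) \<bullet> b)) * flat 1 (real n * ((c - x) \<bullet> b))) \<longlonglongrightarrow> 1 * 1"
    if "b \<in> Basis" for b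
    using that by (intro tendsto_mult flat_1_tendsto) (auto simp: box_def inner_diff_left)
  then have "(\<lambda>n. box_bump n a c x) \<longlonglongrightarrow> (\<Prod>b\<in>(Basis::'a set). 1 * 1)"
    unfolding box_bump_def by (intro tendsto_prod)
  then show ?thesis using True by simp
next
  case False
  then show ?thesis by (simp add: box_bump_outside)
qed

lemma indicator_L2:
  assumes "A \<in> sets lborel" "bounded A"
  shows "(\<lambda>x. indicator A x :: complex) \<in> L2"
proof (rule L2I)
  show "(\<lambda>x. indicator A x :: complex) \<in> borel_measurable lborel" using assms by measurable
  have "integrable lborel (\<lambda>x. indicator A x :: real)"
    using assms emeasure_bounded_finite[OF assms(2)] by (auto simp: less_top)
  moreover have "(norm (indicator A x :: complex))\<^sup>2 = indicator A x" for x
    by (auto split: split_indicator)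
  ultimately show "integrable lborel (\<lambda>x. (norm (indicator A x :: complex))\<^sup>2)" by simp
qed

lemma L2_set_integrable:
  assumes "A \<in> sets lborel" "bounded A" "g \<in> L2"
  shows "set_integrable lborel A g"
proof -
  have "indicator A x * g x = indicator A x *\<^sub>R g x" for x
    by (auto split: split_indicator)
  then show ?thesis
    unfolding set_integrable_def using L2_mult_integrable[OF indicator_L2[OF assms(1,2)] assms(3)] by simp
qed

text \<open>Dominated convergence passes from the smooth bumps to the indicators of boxes, and a
  Dynkin argument from boxes to all Borel subsets of a bounded region.\<close>

theorem fundamental_lemma:
  fixes g :: "'a::euclidean_space \<Rightarrow> complex"
  assumes g: "g \<in> L2"
    and orth: "\<And>\<phi>. test_function \<phi> \<Longrightarrow> (\<integral>x. \<phi> x *\<^sub>R g x \<partial>lborel) = 0"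
  shows "AE x in lborel. g x = 0"
proof -
  have [measurable]: "g \<in> borel_measurable borel" using L2_measurable[OF g] by simp
  have box: "(LINT x:box a c|lborel. g x) = 0" for a c :: 'a
  proof -
    have "(\<lambda>n. \<integral>x. box_bump n a c x *\<^sub>R g x \<partial>lborel) \<longlonglongrightarrow> (\<integral>x. indicator (box a c) x *\<^sub>R g x \<partial>lborel)"
    proof (rule integral_dominated_convergence)
      show "(\<lambda>x. indicator (box a c) x *\<^sub>R g x) \<in> borel_measurable lborel" by measurable
      show "(\<lambda>x. box_bump n a c x *\<^sub>R g x) \<in> borel_measurable lborel" for n
        by (rule borel_measurable_integrable[OF test_function_integrable[OF box_bump_test g]])
      show "integrable lborel (\<lambda>x. norm (indicator (box a c) x *\<^sub>R g x))"
        using L2_set_integrable[OF _ bounded_box g] by (intro integrable_norm) (auto simp: set_integrable_def)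
      show "AE x in lborel. (\<lambda>n. box_bump n a c x *\<^sub>R g x) \<longlonglongrightarrow> indicator (box a c) x *\<^sub>R g x"
        by (intro AE_I2 tendsto_intros box_bump_tendsto)
      show "AE x in lborel. norm (box_bump n a c x *\<^sub>R g x) \<le> norm (indicator (box a c) x *\<^sub>R g x)" for n
        using box_bump_bounds[of n a c] box_bump_outside[of _ a c n]
        by (intro AE_I2) (auto split: split_indicator simp: mult_left_le_one_le)
    qed
    then show ?thesis
      by (simp add: orth[OF box_bump_test] set_lebesgue_integral_def LIMSEQ_const_iff)
  qed
  define D where "D = (\<lambda>n::nat. box (- real n *\<^sub>R One) (real n *\<^sub>R One) :: 'a set)"
  have D [measurable]: "D n \<in> sets borel" "bounded (D n)" for n by (auto simp: D_def)
  have *: "(LINT x:A \<inter> D n|lborel. g x) = 0" if "A \<in> sets borel" for A n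
  proof -
    have "Int_stable (range (\<lambda>(a, b). box a b :: 'a set))"
      by (auto simp: Int_stable_def box_Int_box)
    moreover have "range (\<lambda>(a, b). box a b :: 'a set) \<subseteq> Pow UNIV" by simp
    moreover have "A \<in> sigma_sets UNIV (range (\<lambda>(a, b). box a b))"
      using that by (simp add: borel_eq_box)
    ultimately show ?thesis
    proof (induction rule: sigma_sets_induct_disjoint)
      case (basic A)
      then show ?case using box by (auto simp: D_def box_Int_box)
    next
      case empty
      then show ?case by (simp add: set_lebesgue_integral_def)
    next
      case (compl A)
      then have A: "A \<in> sets borel" by (simp add: borel_eq_box)
      have "(LINT x:D n|lborel. g x) = (LINT x:(UNIV - A) \<inter> D n|lborel. g x) + (LINT x:A \<inter> D n|lborel. g x)"
        using A D g set_integral_Un[of "(UNIV - A) \<inter> D n" "A \<inter> D n" lborel g]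
        by (subst set_integral_Un[symmetric])
           (auto intro!: L2_set_integrable bounded_Int intro: arg_cong2[where f = "\<lambda>A. set_lebesgue_integral lborel A"])
      moreover have "(LINT x:D n|lborel. g x) = 0" unfolding D_def by (rule box)
      ultimately show ?case using compl by simp
    next
      case (union A)
      then have A: "A i \<in> sets borel" for i by (auto simp: borel_eq_box)
      have "(LINT x:(\<Union>i. A i \<inter> D n)|lborel. g x) = (\<Sum>i. (LINT x:A i \<inter> D n|lborel. g x))"
      proof (rule lebesgue_integral_countable_add)
        show "set_integrable lborel (\<Union>i. A i \<inter> D n) g"
          using A D g by (intro L2_set_integrable) (auto intro: bounded_subset[of "D n"])
        show "A i \<inter> D n \<inter> (A j \<inter> D n) = {}" if "i \<noteq> j" for i j
          using union(1) that by (auto simp: disjoint_family_on_def)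
      qed (use A D in auto)
      then show ?case using union by (simp add: Int_UN_distrib2 image_image)
    qed
  qed
  have "AE x in lborel. x \<in> D n \<longrightarrow> g x = 0" for n
  proof -
    have "AE x in lborel. indicator (D n) x *\<^sub>R g x = 0"
    proof (rule sigma_finite_measure.density_unique_banach[OF sigma_finite_lborel])
      show "integrable lborel (\<lambda>x. indicator (D n) x *\<^sub>R g x)"
        using L2_set_integrable[of "D n" g] D g by (simp add: set_integrable_def)
      fix A assume "A \<in> sets (lborel :: 'a measure)"
      then have "(LINT x:A \<inter> D n|lborel. g x) = 0" using * by simp
      then show "(LINT x:A|lborel. indicator (D n) x *\<^sub>R g x) = (LINT x:A|lborel. 0)"
        by (simp add: set_lebesgue_integral_def indicator_inter_arith)
    qed simp
    then show ?thesis by eventually_elim (auto split: split_indicator_asm)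
  qed
  then have "AE x in lborel. \<forall>n. x \<in> D n \<longrightarrow> g x = 0" unfolding AE_all_countable by blast
  then show ?thesis
  proof eventually_elim
    case (elim x)
    have "x \<in> (\<Union>n. D n)" using UN_box_eq_UNIV by (auto simp: D_def)
    with elim show ?case by blast
  qed
qed

section \<open>The Sobolev space and coercive energy forms\<close>

text \<open>Distributional identities become identities between inner products, to which Cauchy-Schwarz and
  \<open>L\<^sup>2\<close> limits apply.\<close>

lemma test_pairing: "(\<integral>x. \<phi> x *\<^sub>R f x \<partial>lborel) = L2_inner f (\<lambda>x. complex_of_real (\<phi> x))"
  unfolding L2_inner_def by (simp add: scaleR_conv_of_real mult.commute)

lemma has_weak_deriv_inner:
  assumes "u \<in> L2"
  shows "has_weak_deriv u b g \<longleftrightarrow> g \<in> L2 \<and>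
     (\<forall>\<phi>. test_function \<phi> \<longrightarrow>
        L2_inner u (\<lambda>x. complex_of_real (frechet_derivative \<phi> (at x) b)) = - L2_inner g (\<lambda>x. complex_of_real (\<phi> x)))"
  unfolding has_weak_deriv_def test_pairing by simp

lemma has_weak_deriv_L2: "has_weak_deriv u b g \<Longrightarrow> g \<in> L2"
  by (simp add: has_weak_deriv_def)

lemma has_weak_deriv_unique:
  assumes "has_weak_deriv u b g" "has_weak_deriv u b g'"
  shows "AE x in lborel. g x = g' x"
proof -
  have g: "g \<in> L2" "g' \<in> L2" using assms by (auto dest: has_weak_deriv_L2)
  have "AE x in lborel. g x - g' x = 0"
  proof (rule fundamental_lemma)
    show "(\<lambda>x. g x - g' x) \<in> L2" using g by (rule L2.mem_diff)
    fix \<phi> :: "'a \<Rightarrow> real" assume \<phi>: "test_function \<phi>"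
    have "(\<integral>x. \<phi> x *\<^sub>R g x \<partial>lborel) = (\<integral>x. \<phi> x *\<^sub>R g' x \<partial>lborel)"
      using assms \<phi> unfolding has_weak_deriv_def by (metis minus_equation_iff)
    then show "(\<integral>x. \<phi> x *\<^sub>R (g x - g' x) \<partial>lborel) = 0"
      using test_function_integrable[OF \<phi> g(1)] test_function_integrable[OF \<phi> g(2)]
      by (simp add: scaleR_diff_right)
  qed
  then show ?thesis by simp
qed

lemma H1_L2: "u \<in> H1 \<Longrightarrow> u \<in> L2"
  by (simp add: H1_def)

lemma has_weak_deriv_weak_deriv:
  assumes "u \<in> H1" "b \<in> Basis"
  shows "has_weak_deriv u b (weak_deriv u b)"
  unfolding weak_deriv_def using assms by (intro someI_ex[of "has_weak_deriv u b"]) (simp add: H1_def)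

lemma weak_deriv_L2: "u \<in> H1 \<Longrightarrow> b \<in> Basis \<Longrightarrow> weak_deriv u b \<in> L2"
  using has_weak_deriv_weak_deriv has_weak_deriv_L2 by blast

lemma weak_deriv_AE_eq:
  assumes "u \<in> H1" "b \<in> Basis" "has_weak_deriv u b g"
  shows "AE x in lborel. weak_deriv u b x = g x"
  using has_weak_deriv_unique[OF has_weak_deriv_weak_deriv[OF assms(1,2)] assms(3)] .

lemma has_weak_deriv_add:
  assumes "u \<in> L2" "v \<in> L2" "has_weak_deriv u b g" "has_weak_deriv v b k" "b \<in> Basis"
  shows "has_weak_deriv (\<lambda>x. u x + v x) b (\<lambda>x. g x + k x)"
  using assms has_weak_deriv_L2[OF assms(3)] has_weak_deriv_L2[OF assms(4)]
  by (simp add: has_weak_deriv_inner L2_add L2.add_left test_function_L2 test_function_derivative)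

lemma has_weak_deriv_scale:
  assumes "u \<in> L2" "has_weak_deriv u b g" "b \<in> Basis"
  shows "has_weak_deriv (\<lambda>x. c * u x) b (\<lambda>x. c * g x)"
  using assms has_weak_deriv_L2[OF assms(2)]
  by (simp add: has_weak_deriv_inner L2_scale L2.scale_left test_function_L2 test_function_derivative)

lemma H1I:
  assumes "u \<in> L2" "\<And>b. b \<in> Basis \<Longrightarrow> has_weak_deriv u b (g b)"
  shows "u \<in> H1"
  using assms by (auto simp: H1_def)

lemma H1_add: "u \<in> H1 \<Longrightarrow> v \<in> H1 \<Longrightarrow> (\<lambda>x. u x + v x) \<in> H1"
  by (rule H1I) (auto intro: L2_add H1_L2 has_weak_deriv_add has_weak_deriv_weak_deriv)

lemma H1_scale: "u \<in> H1 \<Longrightarrow> (\<lambda>x. c * u x) \<in> H1"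
  by (rule H1I) (auto intro: L2_scale H1_L2 has_weak_deriv_scale has_weak_deriv_weak_deriv)

lemma H1_zero: "(\<lambda>x. 0) \<in> H1"
  by (rule H1I[where g = "\<lambda>_ _. 0"]) (auto simp: L2_zero has_weak_deriv_def)

lemma weak_deriv_add:
  "u \<in> H1 \<Longrightarrow> v \<in> H1 \<Longrightarrow> b \<in> Basis \<Longrightarrow>
    AE x in lborel. weak_deriv (\<lambda>x. u x + v x) b x = weak_deriv u b x + weak_deriv v b x"
  by (intro weak_deriv_AE_eq H1_add has_weak_deriv_add has_weak_deriv_weak_deriv H1_L2)

lemma weak_deriv_scale:
  "u \<in> H1 \<Longrightarrow> b \<in> Basis \<Longrightarrow>
    AE x in lborel. weak_deriv (\<lambda>x. c * u x) b x = c * weak_deriv u b x"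
  by (intro weak_deriv_AE_eq H1_scale has_weak_deriv_scale has_weak_deriv_weak_deriv H1_L2)

lemma L2_inner_weak_deriv_add_left:
  assumes "u \<in> H1" "v \<in> H1" "w \<in> L2" "b \<in> Basis"
  shows "L2_inner (weak_deriv (\<lambda>x. u x + v x) b) w = L2_inner (weak_deriv u b) w + L2_inner (weak_deriv v b) w"
proof -
  have "L2_inner (weak_deriv (\<lambda>x. u x + v x) b) w = L2_inner (\<lambda>x. weak_deriv u b x + weak_deriv v b x) w"
    using assms by (intro L2_inner_cong_AE weak_deriv_add) (auto intro: weak_deriv_L2 H1_add L2_add)
  then show ?thesis using assms by (simp add: L2.add_left weak_deriv_L2)
qed

lemma L2_inner_weak_deriv_scale_left:
  assumes "u \<in> H1" "w \<in> L2" "b \<in> Basis"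
  shows "L2_inner (weak_deriv (\<lambda>x. c * u x) b) w = c * L2_inner (weak_deriv u b) w"
proof -
  have "L2_inner (weak_deriv (\<lambda>x. c * u x) b) w = L2_inner (\<lambda>x. c * weak_deriv u b x) w"
    using assms by (intro L2_inner_cong_AE weak_deriv_scale) (auto intro: weak_deriv_L2 H1_scale L2_scale)
  then show ?thesis using assms by (simp add: L2.scale_left weak_deriv_L2)
qed

lemma L2_inner_tendsto:
  assumes "\<And>n. s n \<in> L2" "f \<in> L2" "g \<in> L2" "(\<lambda>n. (L2_norm (\<lambda>x. s n x - f x))\<^sup>2) \<longlonglongrightarrow> 0"
  shows "(\<lambda>n. L2_inner (s n) g) \<longlonglongrightarrow> L2_inner f g"
proof (rule LIM_zero_cancel, rule tendsto_norm_zero_cancel)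
  have lim: "(\<lambda>n. L2_norm (\<lambda>x. s n x - f x) * L2_norm g) \<longlonglongrightarrow> 0"
    using tendsto_mult_left_zero[OF tendsto_real_sqrt[OF assms(4), simplified]]
    by (simp add: L2_norm_nonneg)
  show "(\<lambda>n. cmod (L2_inner (s n) g - L2_inner f g)) \<longlonglongrightarrow> 0"
  proof (rule tendsto_sandwich[OF _ _ tendsto_const lim])
    have "cmod (L2_inner (s n) g - L2_inner f g) \<le> L2_norm (\<lambda>x. s n x - f x) * L2_norm g" for n
      using L2_Cauchy_Schwarz[OF L2.mem_diff[OF assms(1,2)] assms(3)]
      by (simp add: L2.diff_left[OF assms(1,2,3)])
    then show "\<forall>\<^sub>F n in sequentially. cmod (L2_inner (s n) g - L2_inner f g) \<le> L2_norm (\<lambda>x. s n x - f x) * L2_norm g"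
      by simp
  qed simp
qed

text \<open>The weak derivative is a closed operator, because both sides of its defining identity are
  \<open>L\<^sup>2\<close>-continuous.\<close>

lemma has_weak_deriv_limit:
  assumes "\<And>n. s n \<in> L2" "u \<in> L2" "g \<in> L2" "b \<in> Basis"
    and "\<And>n. has_weak_deriv (s n) b (k n)"
    and "(\<lambda>n. (L2_norm (\<lambda>x. s n x - u x))\<^sup>2) \<longlonglongrightarrow> 0"
    and "(\<lambda>n. (L2_norm (\<lambda>x. k n x - g x))\<^sup>2) \<longlonglongrightarrow> 0"
  shows "has_weak_deriv u b g"
  unfolding has_weak_deriv_inner[OF assms(2)]
proof (intro conjI allI impI)
  fix \<phi> :: "'a \<Rightarrow> real" assume \<phi>: "test_function \<phi>"
  have k: "k n \<in> L2" for n using assms(5) by (rule has_weak_deriv_L2)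
  have 1: "(\<lambda>n. L2_inner (s n) (\<lambda>x. complex_of_real (frechet_derivative \<phi> (at x) b)))
      \<longlonglongrightarrow> L2_inner u (\<lambda>x. complex_of_real (frechet_derivative \<phi> (at x) b))"
    using assms \<phi> by (intro L2_inner_tendsto test_function_L2 test_function_derivative) auto
  have 2: "(\<lambda>n. - L2_inner (k n) (\<lambda>x. complex_of_real (\<phi> x))) \<longlonglongrightarrow> - L2_inner g (\<lambda>x. complex_of_real (\<phi> x))"
    using assms k \<phi> by (intro tendsto_minus L2_inner_tendsto test_function_L2) auto
  have "L2_inner (s n) (\<lambda>x. complex_of_real (frechet_derivative \<phi> (at x) b)) = - L2_inner (k n) (\<lambda>x. complex_of_real (\<phi> x))" for n
    using assms(5)[of n] \<phi> unfolding has_weak_deriv_inner[OF assms(1)] by blast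
  with 1 2 show "L2_inner u (\<lambda>x. complex_of_real (frechet_derivative \<phi> (at x) b)) = - L2_inner g (\<lambda>x. complex_of_real (\<phi> x))"
    using LIMSEQ_unique by fastforce
qed fact

lemma L2_tendsto_AE_subseq:
  assumes "\<And>n. s n \<in> L2" "f \<in> L2" "(\<lambda>n. (L2_norm (\<lambda>x. s n x - f x))\<^sup>2) \<longlonglongrightarrow> 0"
  obtains r where "strict_mono (r :: nat \<Rightarrow> nat)" "AE x in lborel. (\<lambda>n. s (r n) x) \<longlonglongrightarrow> f x"
proof -
  have "\<exists>r::nat\<Rightarrow>nat. strict_mono r \<and> (AE x in lborel. (\<lambda>n. (norm (s (r n) x - f x))\<^sup>2) \<longlonglongrightarrow> 0)"
  proof (rule tendsto_L1_AE_subseq)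
    show "integrable lborel (\<lambda>x. (norm (s n x - f x))\<^sup>2)" for n
      using L2_square_integrable[OF L2.mem_diff[OF assms(1,2)]] .
    show "(\<lambda>n. \<integral>x. norm ((norm (s n x - f x))\<^sup>2) \<partial>lborel) \<longlonglongrightarrow> 0"
      using assms(3) by (simp add: L2_norm_square_eq)
  qed
  then obtain r :: "nat \<Rightarrow> nat" where r: "strict_mono r" "AE x in lborel. (\<lambda>n. (norm (s (r n) x - f x))\<^sup>2) \<longlonglongrightarrow> 0"
    by blast
  from r(2) have "AE x in lborel. (\<lambda>n. s (r n) x) \<longlonglongrightarrow> f x"
  proof eventually_elim
    case (elim x)
    from tendsto_real_sqrt[OF this] have "(\<lambda>n. norm (s (r n) x - f x)) \<longlonglongrightarrow> 0" by simp
    then have "(\<lambda>n. s (r n) x - f x) \<longlonglongrightarrow> 0" by (rule tendsto_norm_zero_cancel)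
    then show ?case by (rule LIM_zero_cancel)
  qed
  with r(1) show thesis by (rule that)
qed

text \<open>Multiplication by \<open>V\<^sup>1\<^sup>/\<^sup>2\<close> is a closed operator: the two \<open>L\<^sup>2\<close> limits are compared along a common
  subsequence that converges almost everywhere.\<close>

lemma sqrt_mult_limit:
  assumes [measurable]: "V \<in> borel_measurable borel"
    and "\<And>n. s n \<in> L2" "u \<in> L2" "(\<lambda>n. (L2_norm (\<lambda>x. s n x - u x))\<^sup>2) \<longlonglongrightarrow> 0"
    and "\<And>n. sqrt_mult V (s n) \<in> L2" "p \<in> L2" "(\<lambda>n. (L2_norm (\<lambda>x. sqrt_mult V (s n) x - p x))\<^sup>2) \<longlonglongrightarrow> 0"
  shows "sqrt_mult V u \<in> L2" "AE x in lborel. sqrt_mult V u x = p x"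
proof -
  from L2_tendsto_AE_subseq[OF assms(2-4)] obtain r where
    r: "strict_mono r" "AE x in lborel. (\<lambda>n. s (r n) x) \<longlonglongrightarrow> u x" by blast
  have "(\<lambda>n. (L2_norm (\<lambda>x. sqrt_mult V (s (r n)) x - p x))\<^sup>2) \<longlonglongrightarrow> 0"
    using LIMSEQ_subseq_LIMSEQ[OF assms(7) r(1)] by (simp add: o_def)
  from L2_tendsto_AE_subseq[OF assms(5,6) this] obtain r' where
    r': "strict_mono r'" "AE x in lborel. (\<lambda>n. sqrt_mult V (s (r (r' n))) x) \<longlonglongrightarrow> p x" by blast
  from r(2) r'(2) show eq: "AE x in lborel. sqrt_mult V u x = p x"
  proof eventually_elim
    case (elim x)
    have "(\<lambda>n. s (r (r' n)) x) \<longlonglongrightarrow> u x"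
      using LIMSEQ_subseq_LIMSEQ[OF elim(1) r'(1)] by (simp add: o_def)
    then have "(\<lambda>n. sqrt_mult V (s (r (r' n))) x) \<longlonglongrightarrow> sqrt_mult V u x"
      unfolding sqrt_mult_def by (intro tendsto_intros)
    with elim(2) show ?case by (rule LIMSEQ_unique[symmetric])
  qed
  have [measurable]: "u \<in> borel_measurable borel" using L2_measurable[OF assms(3)] by simp
  show "sqrt_mult V u \<in> L2"
  proof (rule L2I)
    show meas: "sqrt_mult V u \<in> borel_measurable lborel" unfolding sqrt_mult_def by measurable
    show "integrable lborel (\<lambda>x. (norm (sqrt_mult V u x))\<^sup>2)"
      by (rule integrable_cong_AE_imp[OF L2_square_integrable[OF assms(6)]])
         (use meas eq in \<open>auto elim!: eventually_mono\<close>)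
  qed
qed

definition gradient_energy :: "('a::euclidean_space \<Rightarrow> complex) \<Rightarrow> real" where
  "gradient_energy u = (\<Sum>b\<in>Basis. (L2_norm (weak_deriv u b))\<^sup>2)"

definition potential_energy :: "('a::euclidean_space \<Rightarrow> real) \<Rightarrow> ('a \<Rightarrow> complex) \<Rightarrow> real" where
  "potential_energy V u = (L2_norm (sqrt_mult V u))\<^sup>2"

text \<open>One family of forms serves both purposes: the resolvent equation at \<open>\<mu>\<close> has
  \<open>(\<alpha>, \<beta>, \<gamma>) = (h\<^sup>2, 1, - \<mu>)\<close>, and the compactness argument has \<open>(1, n, 1)\<close>.\<close>

definition energy_form ::
    "real \<Rightarrow> real \<Rightarrow> real \<Rightarrow> ('a::euclidean_space \<Rightarrow> real) \<Rightarrow> ('a \<Rightarrow> complex) \<Rightarrow> ('a \<Rightarrow> complex) \<Rightarrow> complex" where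
  "energy_form \<alpha> \<beta> \<gamma> V u v =
     complex_of_real \<alpha> * (\<Sum>b\<in>Basis. L2_inner (weak_deriv u b) (weak_deriv v b))
     + complex_of_real \<beta> * L2_inner (sqrt_mult V u) (sqrt_mult V v) + complex_of_real \<gamma> * L2_inner u v"

lemma gradient_energy_nonneg: "gradient_energy u \<ge> 0"
  by (simp add: gradient_energy_def sum_nonneg)

lemma potential_energy_nonneg: "potential_energy V u \<ge> 0"
  by (simp add: potential_energy_def)

lemma weak_deriv_le_gradient_energy:
  "b \<in> Basis \<Longrightarrow> (L2_norm (weak_deriv u b))\<^sup>2 \<le> gradient_energy u"
  unfolding gradient_energy_def by (rule member_le_sum) auto

lemma schrodinger_domainD:
  assumes "u \<in> schrodinger_domain V"
  shows "u \<in> H1" "u \<in> L2" "sqrt_mult V u \<in> L2"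
  using assms by (auto simp: schrodinger_domain_def H1_L2)

lemma schrodinger_domainI: "u \<in> H1 \<Longrightarrow> sqrt_mult V u \<in> L2 \<Longrightarrow> u \<in> schrodinger_domain V"
  by (simp add: schrodinger_domain_def)

lemma Re_energy_form:
  "Re (energy_form \<alpha> \<beta> \<gamma> V u u) = \<alpha> * gradient_energy u + \<beta> * potential_energy V u + \<gamma> * (L2_norm u)\<^sup>2"
  by (simp add: energy_form_def gradient_energy_def potential_energy_def L2_inner_self)

lemma sqrt_mult_add: "sqrt_mult V (\<lambda>x. u x + v x) = (\<lambda>x. sqrt_mult V u x + sqrt_mult V v x)"
  by (simp add: sqrt_mult_def distrib_left)

lemma sqrt_mult_scale: "sqrt_mult V (\<lambda>x. c * u x) = (\<lambda>x. c * sqrt_mult V u x)"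
  by (simp add: sqrt_mult_def mult_ac)

lemma semi_inner_space_energy_form:
  assumes "\<And>u. u \<in> schrodinger_domain V \<Longrightarrow> 0 \<le> \<alpha> * gradient_energy u + \<beta> * potential_energy V u + \<gamma> * (L2_norm u)\<^sup>2"
  shows "semi_inner_space (schrodinger_domain V) (energy_form \<alpha> \<beta> \<gamma> V)"
proof
  have "(\<lambda>x. 0) \<in> schrodinger_domain V"
    by (rule schrodinger_domainI) (simp_all add: H1_zero L2_zero sqrt_mult_def)
  then show "schrodinger_domain V \<noteq> {}" by blast
next
  fix u v assume "u \<in> schrodinger_domain V" "v \<in> schrodinger_domain V"
  then show "(\<lambda>x. u x + v x) \<in> schrodinger_domain V"
    by (simp add: schrodinger_domain_def sqrt_mult_add H1_add L2_add)
  show "energy_form \<alpha> \<beta> \<gamma> V v u = cnj (energy_form \<alpha> \<beta> \<gamma> V u v)"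
    by (simp add: energy_form_def L2_inner_commute[of v] L2_inner_commute[of "sqrt_mult V v"] L2_inner_commute[of "weak_deriv v _"])
next
  fix u c assume "u \<in> schrodinger_domain V"
  then show "(\<lambda>x. c * u x) \<in> schrodinger_domain V"
    by (simp add: schrodinger_domain_def sqrt_mult_scale H1_scale L2_scale)
next
  fix u v w assume "u \<in> schrodinger_domain V" "v \<in> schrodinger_domain V" "w \<in> schrodinger_domain V"
  note D = this[THEN schrodinger_domainD(1)] this[THEN schrodinger_domainD(2)] this[THEN schrodinger_domainD(3)]
  show "energy_form \<alpha> \<beta> \<gamma> V (\<lambda>x. u x + v x) w = energy_form \<alpha> \<beta> \<gamma> V u w + energy_form \<alpha> \<beta> \<gamma> V v w"
    using D by (simp add: energy_form_def sqrt_mult_add L2.add_left L2_inner_weak_deriv_add_left weak_deriv_L2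
        sum.distrib algebra_simps)
next
  fix u w c assume "u \<in> schrodinger_domain V" "w \<in> schrodinger_domain V"
  note D = this[THEN schrodinger_domainD(1)] this[THEN schrodinger_domainD(2)] this[THEN schrodinger_domainD(3)]
  show "energy_form \<alpha> \<beta> \<gamma> V (\<lambda>x. c * u x) w = c * energy_form \<alpha> \<beta> \<gamma> V u w"
    using D by (simp add: energy_form_def sqrt_mult_scale L2.scale_left L2_inner_weak_deriv_scale_left weak_deriv_L2
        sum_distrib_left algebra_simps)
next
  fix u assume "u \<in> schrodinger_domain V"
  then show "0 \<le> Re (energy_form \<alpha> \<beta> \<gamma> V u u)" using assms by (simp add: Re_energy_form)
qed

text \<open>Coercivity bounds each of the three terms by the total energy even when \<open>\<gamma>\<close> is negative.  A
  Cauchy sequence for the energy therefore converges together with its gradient and with its product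
  with \<open>V\<^sup>1\<^sup>/\<^sup>2\<close>, and closedness identifies the limits.\<close>

lemma coercive_energy_form_complete:
  fixes s :: "nat \<Rightarrow> 'a::euclidean_space \<Rightarrow> complex"
  defines "E \<equiv> \<lambda>\<alpha> \<beta> \<gamma> V u. \<alpha> * gradient_energy u + \<beta> * potential_energy V u + \<gamma> * (L2_norm u)\<^sup>2"
  assumes V: "V \<in> borel_measurable borel" and pos: "\<alpha> > 0" "\<beta> > 0" "c > 0"
    and coercive: "\<And>u. u \<in> schrodinger_domain V \<Longrightarrow> c * (L2_norm u)\<^sup>2 \<le> E \<alpha> \<beta> \<gamma> V u"
    and s: "\<And>n. s n \<in> schrodinger_domain V"
    and Cauchy: "\<And>e::real. e > 0 \<Longrightarrow> \<exists>N. \<forall>m\<ge>N. \<forall>n\<ge>N. E \<alpha> \<beta> \<gamma> V (\<lambda>x. s m x - s n x) \<le> e"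
  shows "\<exists>w\<in>schrodinger_domain V. (\<lambda>n. E \<alpha> \<beta> \<gamma> V (\<lambda>x. s n x - w x)) \<longlonglongrightarrow> 0"
proof -
  interpret D: semi_inner_space "schrodinger_domain V" "energy_form 0 0 0 V"
    by (rule semi_inner_space_energy_form) simp
  note sD = s[THEN schrodinger_domainD(1)] s[THEN schrodinger_domainD(2)] s[THEN schrodinger_domainD(3)]
  \<comment> \<open>A single constant that dominates the constants of all three terms.\<close>
  define C where "C = (1 + \<bar>\<gamma>\<bar> / c) / \<alpha> + (1 + \<bar>\<gamma>\<bar> / c) / \<beta> + 1 / c"
  have C: "C > 0" using pos by (simp add: C_def add_nonneg_pos divide_nonneg_nonneg)
  have bound: "(L2_norm u)\<^sup>2 \<le> C * E \<alpha> \<beta> \<gamma> V u" "gradient_energy u \<le> C * E \<alpha> \<beta> \<gamma> V u"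
      "potential_energy V u \<le> C * E \<alpha> \<beta> \<gamma> V u" if "u \<in> schrodinger_domain V" for u
  proof -
    define e where "e = E \<alpha> \<beta> \<gamma> V u"
    have n: "(L2_norm u)\<^sup>2 \<le> e / c"
      using coercive[OF that] pos by (simp add: e_def field_simps)
    have "0 \<le> c * (L2_norm u)\<^sup>2" using pos by simp
    then have e0: "e \<ge> 0" using coercive[OF that] unfolding e_def by (rule order_trans)
    have "- \<gamma> * (L2_norm u)\<^sup>2 \<le> \<bar>\<gamma>\<bar> * (e / c)"
      using n by (intro mult_mono) auto
    then have sum: "\<alpha> * gradient_energy u + \<beta> * potential_energy V u \<le> (1 + \<bar>\<gamma>\<bar> / c) * e"
      unfolding distrib_right by (simp add: e_def E_def)
    have "\<beta> * potential_energy V u \<ge> 0" "\<alpha> * gradient_energy u \<ge> 0"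
      using pos potential_energy_nonneg[of V u] gradient_energy_nonneg[of u] by auto
    note parts = this sum
    then have "\<alpha> * gradient_energy u \<le> (1 + \<bar>\<gamma>\<bar> / c) * e"
      by linarith
    then have g: "gradient_energy u \<le> (1 + \<bar>\<gamma>\<bar> / c) / \<alpha> * e"
      using pos by (simp add: pos_le_divide_eq mult.commute)
    from parts have "\<beta> * potential_energy V u \<le> (1 + \<bar>\<gamma>\<bar> / c) * e"
      by linarith
    then have p: "potential_energy V u \<le> (1 + \<bar>\<gamma>\<bar> / c) / \<beta> * e"
      using pos by (simp add: pos_le_divide_eq mult.commute)
    have "(1 + \<bar>\<gamma>\<bar> / c) / \<alpha> \<ge> 0" "(1 + \<bar>\<gamma>\<bar> / c) / \<beta> \<ge> 0" "1 / c \<ge> 0"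
      using pos by (auto intro!: divide_nonneg_nonneg add_nonneg_nonneg)
    then have "(1 + \<bar>\<gamma>\<bar> / c) / \<alpha> \<le> C" "(1 + \<bar>\<gamma>\<bar> / c) / \<beta> \<le> C" "1 / c \<le> C"
      unfolding C_def by linarith+
    from this[THEN mult_right_mono[OF _ e0]]
    have "(1 + \<bar>\<gamma>\<bar> / c) / \<alpha> * e \<le> C * e" "(1 + \<bar>\<gamma>\<bar> / c) / \<beta> * e \<le> C * e" "1 / c * e \<le> C * e"
      by auto
    with n g p show "(L2_norm u)\<^sup>2 \<le> C * E \<alpha> \<beta> \<gamma> V u" "gradient_energy u \<le> C * E \<alpha> \<beta> \<gamma> V u"
      "potential_energy V u \<le> C * E \<alpha> \<beta> \<gamma> V u" unfolding e_def by auto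
  qed
  have diff: "(\<lambda>x. s m x - s n x) \<in> schrodinger_domain V" for m n by (intro D.mem_diff s)
  have transfer: "\<exists>N. \<forall>m\<ge>N. \<forall>n\<ge>N. F m n \<le> e"
    if bd: "\<And>m n. F m n \<le> C * E \<alpha> \<beta> \<gamma> V (\<lambda>x. s m x - s n x)" and e: "e > 0" for F :: "nat \<Rightarrow> nat \<Rightarrow> real" and e
  proof -
    obtain N where N: "\<forall>m\<ge>N. \<forall>n\<ge>N. E \<alpha> \<beta> \<gamma> V (\<lambda>x. s m x - s n x) \<le> e / C"
      using Cauchy[of "e / C"] C e by auto
    have "F m n \<le> e" if "m \<ge> N" "n \<ge> N" for m n
    proof -
      have "C * E \<alpha> \<beta> \<gamma> V (\<lambda>x. s m x - s n x) \<le> C * (e / C)"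
        using C N that by (intro mult_left_mono) auto
      then show ?thesis using bd[of m n] C by simp
    qed
    then show ?thesis by blast
  qed
  have wd_diff: "AE x in lborel. weak_deriv (\<lambda>x. s m x - u x) b x = weak_deriv (s m) b x - weak_deriv u b x"
    if "b \<in> Basis" "u \<in> H1" for m b u
  proof -
    have "has_weak_deriv (\<lambda>x. s m x + (-1) * u x) b (\<lambda>x. weak_deriv (s m) b x + (-1) * weak_deriv u b x)"
      using that sD by (intro has_weak_deriv_add has_weak_deriv_scale L2_scale has_weak_deriv_weak_deriv H1_L2)
    moreover have "(\<lambda>x. s m x + (-1) * u x) \<in> H1" using that sD by (intro H1_add H1_scale)
    ultimately show ?thesis using weak_deriv_AE_eq[of "\<lambda>x. s m x + (-1) * u x" b] that by simp
  qed
  have norm_wd_diff: "L2_norm (weak_deriv (\<lambda>x. s m x - u x) b) = L2_norm (\<lambda>x. weak_deriv (s m) b x - weak_deriv u b x)"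
    if "b \<in> Basis" "u \<in> schrodinger_domain V" for m b u
    using that sD schrodinger_domainD[OF that(2)]
      schrodinger_domainD[OF D.mem_diff[OF s[of m] that(2)]]
    by (intro L2_norm_cong_AE wd_diff L2.mem_diff weak_deriv_L2) auto
  have sm_diff: "sqrt_mult V (\<lambda>x. s m x - u x) = (\<lambda>x. sqrt_mult V (s m) x - sqrt_mult V u x)" for m u
    by (simp add: sqrt_mult_def right_diff_distrib)
  have "\<exists>w\<in>L2. (\<lambda>n. (L2_norm (\<lambda>x. s n x - w x))\<^sup>2) \<longlonglongrightarrow> 0"
    by (rule L2_complete[OF sD(2)], rule transfer) (use bound diff in auto)
  then obtain w where w: "w \<in> L2" "(\<lambda>n. (L2_norm (\<lambda>x. s n x - w x))\<^sup>2) \<longlonglongrightarrow> 0" by blast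
  have "\<exists>g\<in>L2. (\<lambda>n. (L2_norm (\<lambda>x. weak_deriv (s n) b x - g x))\<^sup>2) \<longlonglongrightarrow> 0" if b: "b \<in> Basis" for b
  proof (rule L2_complete, fact weak_deriv_L2[OF sD(1) b], rule transfer)
    fix m n
    have "(L2_norm (\<lambda>x. weak_deriv (s m) b x - weak_deriv (s n) b x))\<^sup>2 \<le> gradient_energy (\<lambda>x. s m x - s n x)"
      unfolding norm_wd_diff[OF b s, symmetric] using b by (rule weak_deriv_le_gradient_energy)
    then show "(L2_norm (\<lambda>x. weak_deriv (s m) b x - weak_deriv (s n) b x))\<^sup>2 \<le> C * E \<alpha> \<beta> \<gamma> V (\<lambda>x. s m x - s n x)"
      using bound(2)[OF diff] by (rule order_trans)
  qed
  then have "\<forall>b\<in>Basis. \<exists>g. g \<in> L2 \<and> (\<lambda>n. (L2_norm (\<lambda>x. weak_deriv (s n) b x - g x))\<^sup>2) \<longlonglongrightarrow> 0"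
    by blast
  from bchoice[OF this] obtain g where g: "\<And>b. b \<in> Basis \<Longrightarrow> g b \<in> L2"
    "\<And>b. b \<in> Basis \<Longrightarrow> (\<lambda>n. (L2_norm (\<lambda>x. weak_deriv (s n) b x - g b x))\<^sup>2) \<longlonglongrightarrow> 0" by blast
  have "\<exists>p\<in>L2. (\<lambda>n. (L2_norm (\<lambda>x. sqrt_mult V (s n) x - p x))\<^sup>2) \<longlonglongrightarrow> 0"
  proof (rule L2_complete[OF sD(3)], rule transfer)
    show "(L2_norm (\<lambda>x. sqrt_mult V (s m) x - sqrt_mult V (s n) x))\<^sup>2 \<le> C * E \<alpha> \<beta> \<gamma> V (\<lambda>x. s m x - s n x)" for m n
      using bound(3)[OF diff[of m n]] by (simp add: potential_energy_def sm_diff)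
  qed
  then obtain p where p: "p \<in> L2" "(\<lambda>n. (L2_norm (\<lambda>x. sqrt_mult V (s n) x - p x))\<^sup>2) \<longlonglongrightarrow> 0" by blast
  have wd: "has_weak_deriv w b (g b)" if "b \<in> Basis" for b
    by (rule has_weak_deriv_limit[OF sD(2) w(1) g(1)[OF that] that has_weak_deriv_weak_deriv[OF sD(1) that] w(2) g(2)[OF that]])
  have wH1: "w \<in> H1" using w(1) wd by (rule H1I)
  note sm = sqrt_mult_limit[OF V sD(2) w sD(3) p]
  have wQ: "w \<in> schrodinger_domain V" using wH1 sm(1) by (rule schrodinger_domainI)
  have "(\<lambda>n. (L2_norm (weak_deriv (\<lambda>x. s n x - w x) b))\<^sup>2) \<longlonglongrightarrow> 0" if b: "b \<in> Basis" for b
  proof -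
    have "L2_norm (\<lambda>x. weak_deriv (s n) b x - weak_deriv w b x) = L2_norm (\<lambda>x. weak_deriv (s n) b x - g b x)" for n
    proof (rule L2_norm_cong_AE)
      show "AE x in lborel. weak_deriv (s n) b x - weak_deriv w b x = weak_deriv (s n) b x - g b x"
        using weak_deriv_AE_eq[OF wH1 b wd[OF b]] by eventually_elim simp
    qed (auto intro!: L2.mem_diff weak_deriv_L2 g(1) sD(1) wH1 b)
    then show ?thesis using g(2)[OF b] by (simp add: norm_wd_diff[OF b wQ])
  qed
  then have 1: "(\<lambda>n. gradient_energy (\<lambda>x. s n x - w x)) \<longlonglongrightarrow> 0"
    unfolding gradient_energy_def by (intro tendsto_null_sum)
  have "L2_norm (\<lambda>x. sqrt_mult V (s n) x - sqrt_mult V w x) = L2_norm (\<lambda>x. sqrt_mult V (s n) x - p x)" for n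
  proof (rule L2_norm_cong_AE)
    show "AE x in lborel. sqrt_mult V (s n) x - sqrt_mult V w x = sqrt_mult V (s n) x - p x"
      using sm(2) by eventually_elim simp
  qed (auto intro!: L2.mem_diff sD(3) sm(1) p(1))
  then have 2: "(\<lambda>n. potential_energy V (\<lambda>x. s n x - w x)) \<longlonglongrightarrow> 0"
    using p(2) by (simp add: potential_energy_def sm_diff)
  have "(\<lambda>n. E \<alpha> \<beta> \<gamma> V (\<lambda>x. s n x - w x)) \<longlonglongrightarrow> \<alpha> * 0 + \<beta> * 0 + \<gamma> * 0"
    unfolding E_def by (intro tendsto_intros 1 2 w(2))
  with wQ show ?thesis by auto
qed

lemma coercive_energy_form_representation:
  fixes f :: "'a::euclidean_space \<Rightarrow> complex"
  assumes V: "V \<in> borel_measurable borel" and pos: "\<alpha> > 0" "\<beta> > 0" "c > 0"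
    and coercive: "\<And>u. u \<in> schrodinger_domain V \<Longrightarrow>
      c * (L2_norm u)\<^sup>2 \<le> \<alpha> * gradient_energy u + \<beta> * potential_energy V u + \<gamma> * (L2_norm u)\<^sup>2"
    and f: "f \<in> L2"
  shows "\<exists>w\<in>schrodinger_domain V. \<forall>v\<in>schrodinger_domain V. energy_form \<alpha> \<beta> \<gamma> V w v = L2_inner f v"
proof -
  have nonneg: "0 \<le> \<alpha> * gradient_energy u + \<beta> * potential_energy V u + \<gamma> * (L2_norm u)\<^sup>2"
    if "u \<in> schrodinger_domain V" for u
  proof -
    have "0 \<le> c * (L2_norm u)\<^sup>2" using pos by simp
    then show ?thesis using coercive[OF that] by (rule order_trans)
  qed
  interpret D: semi_inner_space "schrodinger_domain V" "energy_form \<alpha> \<beta> \<gamma> V"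
    by (rule semi_inner_space_energy_form) (rule nonneg)
  show ?thesis
  proof (rule D.Riesz_representation)
    fix s :: "nat \<Rightarrow> 'a \<Rightarrow> complex"
    assume "\<And>n. s n \<in> schrodinger_domain V"
      "\<And>e. e > 0 \<Longrightarrow> \<exists>N. \<forall>m\<ge>N. \<forall>n\<ge>N. Re (energy_form \<alpha> \<beta> \<gamma> V (\<lambda>x. s m x - s n x) (\<lambda>x. s m x - s n x)) \<le> e"
    then show "\<exists>w\<in>schrodinger_domain V. (\<lambda>n. Re (energy_form \<alpha> \<beta> \<gamma> V (\<lambda>x. s n x - w x) (\<lambda>x. s n x - w x))) \<longlonglongrightarrow> 0"
      using coercive_energy_form_complete[OF V pos coercive, of s] by (simp add: Re_energy_form)
  next
    show "(cmod (L2_inner f u))\<^sup>2 \<le> ((L2_norm f)\<^sup>2 / c) * Re (energy_form \<alpha> \<beta> \<gamma> V u u)" if u: "u \<in> schrodinger_domain V" for u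
    proof -
      have "(cmod (L2_inner f u))\<^sup>2 \<le> (L2_norm f)\<^sup>2 * (L2_norm u)\<^sup>2"
        using L2.Cauchy_Schwarz[OF f schrodinger_domainD(2)[OF u]] by (simp add: Re_L2_inner_self)
      also have "\<dots> = ((L2_norm f)\<^sup>2 / c) * (c * (L2_norm u)\<^sup>2)" using pos by simp
      also have "\<dots> \<le> ((L2_norm f)\<^sup>2 / c) * Re (energy_form \<alpha> \<beta> \<gamma> V u u)"
        unfolding Re_energy_form using pos by (intro mult_left_mono coercive u) auto
      finally show ?thesis .
    qed
  next
    show "L2_inner f (\<lambda>x. u x + v x) = L2_inner f u + L2_inner f v"
      if "u \<in> schrodinger_domain V" "v \<in> schrodinger_domain V" for u v
      using that[THEN schrodinger_domainD(2)] f by (intro L2.add_right)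
    show "L2_inner f (\<lambda>x. k * u x) = cnj k * L2_inner f u" if "u \<in> schrodinger_domain V" for u k
      using that[THEN schrodinger_domainD(2)] f by (intro L2.scale_right)
    show "(L2_norm f)\<^sup>2 / c \<ge> 0" using pos by simp
  qed
qed

section \<open>The first eigenvalue and the Rayleigh quotient\<close>

lemma eigenvalue_count_ge_1_iff:
  "1 \<le> eigenvalue_count T S \<longleftrightarrow> (\<exists>z\<in>S. \<exists>u\<in>eigenspace T z. \<not> (AE x in lborel. u x = 0))"
proof
  assume "1 \<le> eigenvalue_count T S"
  then have "0 < eigenvalue_count T S" by (simp add: Suc_ile_eq one_enat_def zero_enat_def)
  then obtain n u where n: "n > 0" "L2_independent n u" "\<forall>i<n. \<exists>z\<in>S. u i \<in> eigenspace T z"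
    unfolding eigenvalue_count_def less_Sup_iff by (auto simp: zero_enat_def)
  from n obtain z where z: "z \<in> S" "u 0 \<in> eigenspace T z" by blast
  have "\<not> (AE x in lborel. u 0 x = 0)"
  proof
    assume ae: "AE x in lborel. u 0 x = 0"
    define c :: "nat \<Rightarrow> complex" where "c = (\<lambda>i. if i = 0 then 1 else 0)"
    have "(\<Sum>i<n. c i * u i x) = u 0 x" for x
    proof -
      have "(\<Sum>i<n. c i * u i x) = (\<Sum>i<n. if i = 0 then u i x else 0)"
        by (intro sum.cong) (auto simp: c_def)
      also have "\<dots> = u 0 x" using n(1) by (subst sum.delta) auto
      finally show ?thesis .
    qed
    with ae have "AE x in lborel. (\<Sum>i<n. c i * u i x) = 0" by simp
    with n(2) have "\<forall>i<n. c i = 0" unfolding L2_independent_def by blast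
    with n(1) show False by (auto simp: c_def)
  qed
  with z show "\<exists>z\<in>S. \<exists>u\<in>eigenspace T z. \<not> (AE x in lborel. u x = 0)" by blast
next
  assume "\<exists>z\<in>S. \<exists>u\<in>eigenspace T z. \<not> (AE x in lborel. u x = 0)"
  then obtain z u where z: "z \<in> S" "u \<in> eigenspace T z" "\<not> (AE x in lborel. u x = 0)" by blast
  have "L2_independent 1 (\<lambda>_. u)"
    unfolding L2_independent_def
  proof (intro allI impI)
    fix c :: "nat \<Rightarrow> complex" and i :: nat
    assume ae: "AE x in lborel. (\<Sum>i<1. c i * u x) = 0" and "i < 1"
    show "c i = 0"
    proof (rule ccontr)
      assume "c i \<noteq> 0"
      then have "AE x in lborel. u x = 0" using ae \<open>i < 1\<close> by simp
      with z(3) show False ..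
    qed
  qed
  with z have "enat 1 \<in> {enat n | n. \<exists>u. L2_independent n u \<and> (\<forall>i<n. \<exists>z\<in>S. u i \<in> eigenspace T z)}"
    by blast
  then show "1 \<le> eigenvalue_count T S"
    unfolding eigenvalue_count_def one_enat_def by (rule Sup_upper)
qed

lemma multiplicity_pos_iff: "0 < multiplicity T z \<longleftrightarrow> 1 \<le> eigenvalue_count T {z}"
  unfolding multiplicity_def by (simp add: Suc_ile_eq one_enat_def zero_enat_def)

text \<open>A spectral point either belongs to the essential spectrum, so that the bottom of the latter lies
  below it, or is itself an eigenvalue.\<close>

lemma eigval_1_le_of_spectrum:
  assumes "complex_of_real m \<in> spectrum T"
  shows "eigval 1 T \<le> ereal m"
proof -
  let ?eb = "essential_bottom T"
  let ?S = "{complex_of_real \<mu> | \<mu>. ereal \<mu> < ?eb}"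
  have enat1: "enat 1 = 1" by (simp add: one_enat_def)
  have Inf_le: "eigval 1 T \<le> ereal \<mu>"
    if "ereal \<mu> < ?eb" and ev: "1 \<le> eigenvalue_count T {complex_of_real \<mu>}" for \<mu>
  proof -
    have "1 \<le> eigenvalue_count T ?S" "1 \<le> eigenvalue_count T (complex_of_real ` {..\<mu>})"
      using ev that(1) unfolding eigenvalue_count_ge_1_iff by auto
    moreover have "0 < multiplicity T (complex_of_real \<mu>)"
      using ev by (simp only: multiplicity_pos_iff)
    ultimately show ?thesis
      unfolding eigval_def enat1 by (auto intro!: Inf_lower)
  qed
  show ?thesis
  proof (cases "?eb \<le> ereal m")
    case True
    show ?thesis
    proof (cases "1 \<le> eigenvalue_count T ?S")
      case 1: True
      then obtain \<mu> where "ereal \<mu> < ?eb" "1 \<le> eigenvalue_count T {complex_of_real \<mu>}"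
        unfolding eigenvalue_count_ge_1_iff by blast
      from Inf_le[OF this] this(1) True show ?thesis by simp
    next
      case False
      then have "eigval 1 T = ?eb" unfolding eigval_def enat1 by (rule if_not_P)
      with True show ?thesis by simp
    qed
  next
    case False
    have "complex_of_real m \<notin> essential_spectrum T"
    proof
      assume "complex_of_real m \<in> essential_spectrum T"
      then have "?eb \<le> ereal m" unfolding essential_bottom_def by (intro Inf_lower) blast
      with False show False ..
    qed
    with assms have "0 < multiplicity T (complex_of_real m)"
      by (simp add: essential_spectrum_def discrete_spectrum_def)
    then have "1 \<le> eigenvalue_count T {complex_of_real m}" by (simp only: multiplicity_pos_iff)
    with False show ?thesis by (intro Inf_le) simp_all
  qed
qed

lemma eigval_1_ge:
  assumes res: "\<And>\<mu>. \<mu> < m \<Longrightarrow> complex_of_real \<mu> \<in> resolvent_set T"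
    and ev: "\<And>\<mu> u. u \<in> eigenspace T (complex_of_real \<mu>) \<Longrightarrow> \<not> (AE x in lborel. u x = 0) \<Longrightarrow> m \<le> \<mu>"
  shows "ereal m \<le> eigval 1 T"
proof -
  have "ereal m \<le> essential_bottom T"
    unfolding essential_bottom_def
  proof (rule Inf_greatest, clarsimp)
    fix \<mu> assume "complex_of_real \<mu> \<in> essential_spectrum T"
    then have "complex_of_real \<mu> \<notin> resolvent_set T" by (simp add: essential_spectrum_def spectrum_def)
    with res show "m \<le> \<mu>" by (meson not_le)
  qed
  moreover have "ereal m \<le> Inf {ereal \<mu> | \<mu>. 0 < multiplicity T (complex_of_real \<mu>) \<and>
                  enat 1 \<le> eigenvalue_count T (complex_of_real ` {..\<mu>})}"
    using ev unfolding multiplicity_pos_iff eigenvalue_count_ge_1_iff by (intro Inf_greatest) auto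
  ultimately show ?thesis by (simp add: eigval_def)
qed

lemma schrodinger_form_eq: "schrodinger_form h V = energy_form (h\<^sup>2) 1 0 V"
  by (intro ext) (simp add: schrodinger_form_def energy_form_def)

lemma energy_form_shift:
  "energy_form \<alpha> \<beta> \<gamma> V u v = energy_form \<alpha> \<beta> 0 V u v + complex_of_real \<gamma> * L2_inner u v"
  by (simp add: energy_form_def)

text \<open>The resolvent equation \<open>(P - \<mu>) w = f\<close> in weak form: the term \<open>\<mu> w\<close> on the right is a shift of
  the form on the left.\<close>

lemma schrodinger_iff:
  assumes "f \<in> L2"
  shows "(w, \<lambda>x. f x + complex_of_real \<mu> * w x) \<in> schrodinger h V \<longleftrightarrow>
    w \<in> schrodinger_domain V \<and> (\<forall>v\<in>schrodinger_domain V. energy_form (h\<^sup>2) 1 (- \<mu>) V w v = L2_inner f v)"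
proof (cases "w \<in> schrodinger_domain V")
  case True
  have w: "w \<in> L2" using True by (rule schrodinger_domainD)
  have "(\<lambda>x. f x + complex_of_real \<mu> * w x) \<in> L2" using assms w by (intro L2_add L2_scale)
  moreover have "L2_inner (\<lambda>x. f x + complex_of_real \<mu> * w x) v = L2_inner f v + complex_of_real \<mu> * L2_inner w v"
    if "v \<in> schrodinger_domain V" for v
    using assms w schrodinger_domainD(2)[OF that] by (simp add: L2.add_left L2.scale_left L2_scale)
  ultimately show ?thesis
    using True unfolding schrodinger_def form_operator_def schrodinger_form_eq energy_form_shift[of _ _ "- \<mu>"]
    by (auto simp: algebra_simps)
qed (simp add: schrodinger_def form_operator_def)

text \<open>For \<open>\<mu> < m\<close> the shifted form is coercive with constant \<open>m - \<mu>\<close>; the Riesz representation solves the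
  resolvent equation, with norm bound \<open>1 / (m - \<mu>)\<close>.  An eigenfunction attains its eigenvalue as
  Rayleigh quotient.\<close>

theorem eigval_1_schrodinger_ge:
  fixes V :: "'a::euclidean_space \<Rightarrow> real"
  assumes V: "V \<in> borel_measurable borel" and h: "h \<noteq> 0"
    and lower: "\<And>u. u \<in> schrodinger_domain V \<Longrightarrow>
      m * (L2_norm u)\<^sup>2 \<le> h\<^sup>2 * gradient_energy u + potential_energy V u"
  shows "ereal m \<le> eigval 1 (schrodinger h V)"
proof (rule eigval_1_ge)
  fix \<mu> assume \<mu>: "\<mu> < m"
  have coercive: "(m - \<mu>) * (L2_norm u)\<^sup>2 \<le> h\<^sup>2 * gradient_energy u + 1 * potential_energy V u + - \<mu> * (L2_norm u)\<^sup>2"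
    if "u \<in> schrodinger_domain V" for u
    using lower[OF that] by (simp add: algebra_simps)
  interpret D: semi_inner_space "schrodinger_domain V" "energy_form (h\<^sup>2) 1 (- \<mu>) V"
  proof (rule semi_inner_space_energy_form)
    fix u :: "'a \<Rightarrow> complex" assume "u \<in> schrodinger_domain V"
    have "0 \<le> (m - \<mu>) * (L2_norm u)\<^sup>2" using \<mu> by simp
    also note coercive[OF \<open>u \<in> _\<close>]
    finally show "0 \<le> h\<^sup>2 * gradient_energy u + 1 * potential_energy V u + - \<mu> * (L2_norm u)\<^sup>2" .
  qed
  show "complex_of_real \<mu> \<in> resolvent_set (schrodinger h V)"
    unfolding resolvent_set_def
  proof (rule CollectI, rule exI[of _ "1 / (m - \<mu>)"], intro ballI)
    fix f :: "'a \<Rightarrow> complex" assume f: "f \<in> L2"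
    have "\<exists>w\<in>schrodinger_domain V. \<forall>v\<in>schrodinger_domain V. energy_form (h\<^sup>2) 1 (- \<mu>) V w v = L2_inner f v"
      by (rule coercive_energy_form_representation[OF V _ _ _ coercive f]) (use h \<mu> in auto)
    then obtain w where w: "w \<in> schrodinger_domain V"
      and rep: "\<And>v. v \<in> schrodinger_domain V \<Longrightarrow> energy_form (h\<^sup>2) 1 (- \<mu>) V w v = L2_inner f v" by blast
    have "(w, \<lambda>x. f x + complex_of_real \<mu> * w x) \<in> schrodinger h V"
      using w rep schrodinger_iff[OF f] by blast
    moreover have "L2_norm w \<le> 1 / (m - \<mu>) * L2_norm f"
    proof (cases "L2_norm w = 0")
      case False
      have "(m - \<mu>) * L2_norm w * L2_norm w \<le> Re (energy_form (h\<^sup>2) 1 (- \<mu>) V w w)"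
        using coercive[OF w] unfolding Re_energy_form by (simp add: power2_eq_square)
      also have "\<dots> \<le> L2_norm f * L2_norm w"
        unfolding rep[OF w] using L2_Cauchy_Schwarz[OF f schrodinger_domainD(2)[OF w]] complex_Re_le_cmod order_trans by blast
      finally have "(m - \<mu>) * L2_norm w \<le> L2_norm f"
        using False L2_norm_nonneg[of w] by (simp add: mult_le_cancel_right)
      then show ?thesis using \<mu> by (simp add: field_simps)
    qed (use \<mu> in \<open>simp add: L2_norm_nonneg\<close>)
    moreover have "AE x in lborel. w' x = w x"
      if "(w', \<lambda>x. f x + complex_of_real \<mu> * w' x) \<in> schrodinger h V" for w'
    proof -
      have w': "w' \<in> schrodinger_domain V"
        and rep': "\<And>v. v \<in> schrodinger_domain V \<Longrightarrow> energy_form (h\<^sup>2) 1 (- \<mu>) V w' v = L2_inner f v"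
        using that schrodinger_iff[OF f] by blast+
      have d: "(\<lambda>x. w' x - w x) \<in> schrodinger_domain V" using w' w by (rule D.mem_diff)
      have "energy_form (h\<^sup>2) 1 (- \<mu>) V (\<lambda>x. w' x - w x) (\<lambda>x. w' x - w x) = 0"
        using D.diff_left[OF w' w d] rep[OF d] rep'[OF d] by simp
      then have "Re (energy_form (h\<^sup>2) 1 (- \<mu>) V (\<lambda>x. w' x - w x) (\<lambda>x. w' x - w x)) = 0" by simp
      then have "(m - \<mu>) * (L2_norm (\<lambda>x. w' x - w x))\<^sup>2 \<le> 0"
        using coercive[OF d] unfolding Re_energy_form by simp
      then have "L2_norm (\<lambda>x. w' x - w x) = 0"
        using \<mu> by (simp add: mult_le_0_iff)
      then show ?thesis using L2_norm_eq_0_iff[OF schrodinger_domainD(2)[OF d]] by simp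
    qed
    ultimately show "\<exists>u. (u, \<lambda>x. f x + complex_of_real \<mu> * u x) \<in> schrodinger h V \<and>
        L2_norm u \<le> 1 / (m - \<mu>) * L2_norm f \<and>
        (\<forall>w. (w, \<lambda>x. f x + complex_of_real \<mu> * w x) \<in> schrodinger h V \<longrightarrow> (AE x in lborel. w x = u x))"
      by blast
  qed
next
  fix \<mu> and u :: "'a \<Rightarrow> complex"
  assume u: "u \<in> eigenspace (schrodinger h V) (complex_of_real \<mu>)" "\<not> (AE x in lborel. u x = 0)"
  then have Q: "u \<in> schrodinger_domain V"
    and eq: "energy_form (h\<^sup>2) 1 (- \<mu>) V u u = L2_inner (\<lambda>x. 0) u"
    using schrodinger_iff[OF L2_zero, of u \<mu> h V] by (auto simp: eigenspace_def)
  have "Re (energy_form (h\<^sup>2) 1 (- \<mu>) V u u) = 0"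
    unfolding eq by (simp add: L2_inner_def)
  then have "m * (L2_norm u)\<^sup>2 \<le> \<mu> * (L2_norm u)\<^sup>2"
    using lower[OF Q] unfolding Re_energy_form by simp
  moreover have "L2_norm u \<noteq> 0" using u(2) L2_norm_eq_0_iff[OF schrodinger_domainD(2)[OF Q]] by blast
  ultimately show "m \<le> \<mu>" by (simp add: mult_le_cancel_right)
qed

text \<open>The infimum \<open>m\<close> of the Rayleigh quotient is a spectral point.  Otherwise let \<open>w\<close> solve
  \<open>(P - m) w = u\<close> with \<open>\<parallel>w\<parallel> \<le> C \<parallel>u\<parallel>\<close>, and let \<open>b \<ge> 0\<close> be the form of \<open>P - m\<close>.  Then
  \<open>\<parallel>u\<parallel>\<^sup>4 = \<bar>b(w, u)\<bar>\<^sup>2 \<le> b(w, w) b(u, u) \<le> C \<parallel>u\<parallel>\<^sup>2 b(u, u)\<close>, which fails when the quotient of \<open>u\<close> is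
  close to \<open>m\<close>.\<close>

theorem eigval_1_schrodinger_le:
  fixes V :: "'a::euclidean_space \<Rightarrow> real"
  assumes u0: "u0 \<in> schrodinger_domain V" "L2_norm u0 \<noteq> 0"
    and upper: "h\<^sup>2 * gradient_energy u0 + potential_energy V u0 \<le> M * (L2_norm u0)\<^sup>2"
  shows "eigval 1 (schrodinger h V) \<le> ereal M"
proof -
  define q where "q = (\<lambda>u. h\<^sup>2 * gradient_energy u + potential_energy V u)"
  define A where "A = (\<lambda>u. q u / (L2_norm u)\<^sup>2) ` {u \<in> schrodinger_domain V. L2_norm u \<noteq> 0}"
  define m where "m = Inf A"
  have q0: "q u \<ge> 0" for u
    by (simp add: q_def gradient_energy_nonneg potential_energy_nonneg)
  have bdd: "bdd_below A" unfolding A_def by (intro bdd_belowI2[of _ 0]) (simp add: q0)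
  have nonempty: "A \<noteq> {}" using u0 by (auto simp: A_def)
  have mM: "m \<le> M"
  proof -
    have "m \<le> q u0 / (L2_norm u0)\<^sup>2" unfolding m_def using u0 by (intro cInf_lower bdd) (auto simp: A_def)
    also have "\<dots> \<le> M" using upper u0(2) by (simp add: q_def pos_divide_le_eq)
    finally show ?thesis .
  qed
  have mq: "m * (L2_norm u)\<^sup>2 \<le> q u" if "u \<in> schrodinger_domain V" for u
  proof (cases "L2_norm u = 0")
    case False
    then have "m \<le> q u / (L2_norm u)\<^sup>2" unfolding m_def using that by (intro cInf_lower bdd) (auto simp: A_def)
    then show ?thesis using False by (simp add: pos_le_divide_eq)
  qed (simp add: q0)
  interpret D: semi_inner_space "schrodinger_domain V" "energy_form (h\<^sup>2) 1 (- m) V"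
    by (rule semi_inner_space_energy_form) (use mq in \<open>simp add: q_def\<close>)
  have "complex_of_real m \<in> spectrum (schrodinger h V)"
  proof (rule ccontr)
    assume "complex_of_real m \<notin> spectrum (schrodinger h V)"
    then obtain C where C: "\<And>f. f \<in> L2 \<Longrightarrow> \<exists>u. (u, \<lambda>x. f x + complex_of_real m * u x) \<in> schrodinger h V
        \<and> L2_norm u \<le> C * L2_norm f"
      unfolding spectrum_def resolvent_set_def by blast
    \<comment> \<open>Chosen so that \<open>\<bar>C\<bar> \<epsilon> < 1\<close>.\<close>
    define \<epsilon> where "\<epsilon> = 1 / (\<bar>C\<bar> + 1)"
    have \<epsilon>: "\<epsilon> > 0" by (simp add: \<epsilon>_def)
    from cInf_lessD[OF nonempty, of "m + \<epsilon>"] \<epsilon> obtain u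
      where u: "u \<in> schrodinger_domain V" "L2_norm u \<noteq> 0" and qu: "q u / (L2_norm u)\<^sup>2 < m + \<epsilon>"
      unfolding m_def[symmetric] by (auto simp: A_def)
    have uL2: "u \<in> L2" using u(1) by (rule schrodinger_domainD)
    define n where "n = (L2_norm u)\<^sup>2"
    have n: "n > 0" using u(2) by (simp add: n_def)
    have small: "Re (energy_form (h\<^sup>2) 1 (- m) V u u) < \<epsilon> * n"
      using qu n unfolding Re_energy_form by (simp add: q_def n_def pos_divide_less_eq algebra_simps)
    from C[OF uL2] obtain w where w: "(w, \<lambda>x. u x + complex_of_real m * w x) \<in> schrodinger h V"
      and wC: "L2_norm w \<le> C * L2_norm u" by blast
    have wQ: "w \<in> schrodinger_domain V"
      and rep: "\<And>v. v \<in> schrodinger_domain V \<Longrightarrow> energy_form (h\<^sup>2) 1 (- m) V w v = L2_inner u v"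
      using w schrodinger_iff[OF uL2] by blast+
    have "Re (energy_form (h\<^sup>2) 1 (- m) V w w) \<le> L2_norm u * L2_norm w"
      unfolding rep[OF wQ] using L2_Cauchy_Schwarz[OF uL2 schrodinger_domainD(2)[OF wQ]] complex_Re_le_cmod order_trans by blast
    also have "\<dots> \<le> L2_norm u * (C * L2_norm u)" using wC by (intro mult_left_mono L2_norm_nonneg)
    also have "\<dots> = C * n" by (simp add: n_def power2_eq_square)
    also have "\<dots> \<le> \<bar>C\<bar> * n" using n by (intro mult_right_mono) auto
    finally have w_le: "Re (energy_form (h\<^sup>2) 1 (- m) V w w) \<le> \<bar>C\<bar> * n" .
    have "n\<^sup>2 = (cmod (energy_form (h\<^sup>2) 1 (- m) V w u))\<^sup>2"
      unfolding rep[OF u(1)] by (simp add: L2_inner_self n_def norm_power)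
    also have "\<dots> \<le> Re (energy_form (h\<^sup>2) 1 (- m) V w w) * Re (energy_form (h\<^sup>2) 1 (- m) V u u)"
      by (rule D.Cauchy_Schwarz[OF wQ u(1)])
    also have "\<dots> \<le> (\<bar>C\<bar> * n) * (\<epsilon> * n)"
      using w_le small D.nonneg[OF u(1)] n by (intro mult_mono) auto
    also have "\<dots> = (\<bar>C\<bar> * \<epsilon>) * n\<^sup>2" by (simp add: power2_eq_square)
    also have "\<dots> < 1 * n\<^sup>2"
      using n by (intro mult_strict_right_mono) (auto simp: \<epsilon>_def)
    finally show False by simp
  qed
  from eigval_1_le_of_spectrum[OF this] mM show ?thesis
    by (meson ereal_less_eq(3) order_trans)
qed

section \<open>Translations of Sobolev functions\<close>

lemma nn_integral_translate:
  fixes f :: "'a::euclidean_space \<Rightarrow> ennreal"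
  assumes [measurable]: "f \<in> borel_measurable borel"
  shows "(\<integral>\<^sup>+x. f (x + z) \<partial>lborel) = (\<integral>\<^sup>+x. f x \<partial>lborel)"
proof -
  have "(\<integral>\<^sup>+x. f x \<partial>lborel) = (\<integral>\<^sup>+x. f x \<partial>(distr lborel borel ((+) z)))"
    by (simp add: lborel_distr_plus)
  also have "\<dots> = (\<integral>\<^sup>+x. f (z + x) \<partial>lborel)" by (rule nn_integral_distr) measurable
  finally show ?thesis by (simp add: add.commute)
qed

lemma integral_translate:
  fixes f :: "'a::euclidean_space \<Rightarrow> complex"
  assumes [measurable]: "f \<in> borel_measurable borel"
  shows "(\<integral>x. f (x + z) \<partial>lborel) = (\<integral>x. f x \<partial>lborel)"
proof -
  have "(\<integral>x. f x \<partial>lborel) = (\<integral>x. f x \<partial>(distr lborel borel ((+) z)))"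
    by (simp add: lborel_distr_plus)
  also have "\<dots> = (\<integral>x. f (z + x) \<partial>lborel)" by (rule integral_distr) measurable
  finally show ?thesis by (simp add: add.commute)
qed

lemma L2_translate:
  assumes "u \<in> L2"
  shows "(\<lambda>x. u (x + z)) \<in> L2" "L2_norm (\<lambda>x. u (x + z)) = L2_norm u"
proof -
  have [measurable]: "u \<in> borel_measurable borel" using L2_measurable[OF assms] by simp
  have eq: "(\<integral>\<^sup>+x. ennreal ((norm (u (x + z)))\<^sup>2) \<partial>lborel) = (\<integral>\<^sup>+x. ennreal ((norm (u x))\<^sup>2) \<partial>lborel)"
    by (rule nn_integral_translate) measurable
  show 1: "(\<lambda>x. u (x + z)) \<in> L2"
    using assms unfolding L2_iff_nn_integral eq by simp
  have "ennreal ((L2_norm (\<lambda>x. u (x + z)))\<^sup>2) = ennreal ((L2_norm u)\<^sup>2)"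
    using eq unfolding nn_integral_L2_norm[OF 1] nn_integral_L2_norm[OF assms] .
  then have "(L2_norm (\<lambda>x. u (x + z)))\<^sup>2 = (L2_norm u)\<^sup>2" by simp
  then show "L2_norm (\<lambda>x. u (x + z)) = L2_norm u"
    using L2_norm_nonneg by (metis power2_eq_iff_nonneg)
qed

text \<open>The bound is uniform in \<open>s\<close> and the interval is bounded, which makes the kernel integrable on the
  product.\<close>

lemma Fubini_slab:
  fixes K :: "'a::euclidean_space \<Rightarrow> real \<Rightarrow> complex"
  assumes [measurable]: "(\<lambda>(x, s). K x s) \<in> borel_measurable (borel \<Otimes>\<^sub>M borel)"
    and bound: "\<And>s. (\<integral>\<^sup>+x. ennreal (norm (K x s)) \<partial>lborel) \<le> ennreal C"
  shows "(\<integral>x. (\<integral>s. indicator {0..t} s *\<^sub>R K x s \<partial>lborel) \<partial>lborel)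
    = (\<integral>s. indicator {0..t} s *\<^sub>R (\<integral>x. K x s \<partial>lborel) \<partial>lborel)"
proof -
  have [measurable]: "(\<lambda>(x, s). K x s) \<in> borel_measurable (lborel \<Otimes>\<^sub>M lborel)"
    by (subst measurable_cong_sets[OF sets_pair_measure_cong[OF sets_lborel sets_lborel] refl]) fact
  have "integrable (lborel \<Otimes>\<^sub>M lborel) (\<lambda>(x, s). indicator {0..t} s *\<^sub>R K x s)"
  proof (rule integrableI_bounded)
    show "(\<lambda>(x, s). indicator {0..t} s *\<^sub>R K x s) \<in> borel_measurable (lborel \<Otimes>\<^sub>M lborel)"
      by measurable
    have "(\<integral>\<^sup>+p. ennreal (norm (case p of (x, s) \<Rightarrow> indicator {0..t} s *\<^sub>R K x s)) \<partial>(lborel \<Otimes>\<^sub>M lborel))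
        = (\<integral>\<^sup>+s. (\<integral>\<^sup>+x. ennreal (norm (indicator {0..t} s *\<^sub>R K x s)) \<partial>lborel) \<partial>lborel)"
      by (subst lborel_pair.nn_integral_snd[symmetric]) (simp_all add: split_beta)
    also have "\<dots> \<le> (\<integral>\<^sup>+s. ennreal C * indicator {0..t} s \<partial>lborel)"
      using bound by (intro nn_integral_mono) (auto split: split_indicator)
    also have "\<dots> < \<infinity>"
      by (cases "0 \<le> t") (auto simp: nn_integral_cmult_indicator ennreal_mult_less_top)
    finally show "(\<integral>\<^sup>+p. ennreal (norm (case p of (x, s) \<Rightarrow> indicator {0..t} s *\<^sub>R K x s)) \<partial>(lborel \<Otimes>\<^sub>M lborel)) < \<infinity>" .
  qed
  from lborel_pair.Fubini_integral[OF this] show ?thesis by simp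
qed

lemma test_function_measurable: "test_function \<phi> \<Longrightarrow> \<phi> \<in> borel_measurable borel"
  by (intro borel_measurable_continuous_onI test_function_continuous)

lemma nn_integral_product_le:
  assumes "f \<in> L2" "g \<in> L2"
  shows "(\<integral>\<^sup>+x. ennreal (norm (f x * g x)) \<partial>lborel) \<le> ennreal ((L2_norm f)\<^sup>2 + (L2_norm g)\<^sup>2)"
proof -
  note [measurable] = assms[THEN L2_measurable]
  have "(\<integral>\<^sup>+x. ennreal (norm (f x * g x)) \<partial>lborel) \<le> (\<integral>\<^sup>+x. ennreal ((norm (f x))\<^sup>2) + ennreal ((norm (g x))\<^sup>2) \<partial>lborel)"
  proof (rule nn_integral_mono)
    fix x
    have "0 \<le> norm (f x) * norm (g x)" by simp
    then have "norm (f x) * norm (g x) \<le> (norm (f x))\<^sup>2 + (norm (g x))\<^sup>2"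
      using sum_squares_bound[of "norm (f x)" "norm (g x)"] by linarith
    then show "ennreal (norm (f x * g x)) \<le> ennreal ((norm (f x))\<^sup>2) + ennreal ((norm (g x))\<^sup>2)"
      by (simp add: norm_mult flip: ennreal_plus)
  qed
  also have "\<dots> = ennreal ((L2_norm f)\<^sup>2) + ennreal ((L2_norm g)\<^sup>2)"
    by (subst nn_integral_add) (simp_all add: nn_integral_L2_norm assms)
  finally show ?thesis by (simp flip: ennreal_plus)
qed

definition line_integral :: "real \<Rightarrow> 'a::euclidean_space \<Rightarrow> ('a \<Rightarrow> complex) \<Rightarrow> 'a \<Rightarrow> complex" where
  "line_integral t b g x = (\<integral>s. indicator {0..t} s *\<^sub>R g (x + s *\<^sub>R b) \<partial>lborel)"

text \<open>Cauchy-Schwarz along each segment, then Tonelli and translation invariance (Minkowski's integral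
  inequality in this special case).\<close>

lemma line_integral_L2:
  fixes g :: "'a::euclidean_space \<Rightarrow> complex"
  assumes "g \<in> L2" "t \<ge> 0"
  shows "line_integral t b g \<in> L2" "L2_norm (line_integral t b g) \<le> t * L2_norm g"
proof -
  have [measurable]: "g \<in> borel_measurable borel" using L2_measurable[OF assms(1)] by simp
  have meas [measurable]: "line_integral t b g \<in> borel_measurable lborel"
    unfolding line_integral_def by measurable
  have pointwise: "ennreal ((norm (line_integral t b g x))\<^sup>2)
      \<le> ennreal t * (\<integral>\<^sup>+s. ennreal ((norm (g (x + s *\<^sub>R b)))\<^sup>2) * indicator {0..t} s \<partial>lborel)" for x
  proof -
    have "ennreal (norm (line_integral t b g x)) \<le> (\<integral>\<^sup>+s. ennreal (norm (g (x + s *\<^sub>R b))) * indicator {0..t} s \<partial>lborel)"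
    proof (cases "integrable lborel (\<lambda>s. indicator {0..t} s *\<^sub>R g (x + s *\<^sub>R b))")
      case True
      from integral_norm_bound_ennreal[OF this] show ?thesis
        by (simp add: line_integral_def ennreal_mult'' ennreal_indicator mult.commute)
    qed (simp add: line_integral_def not_integrable_integral_eq)
    also have "\<dots> = (\<integral>\<^sup>+s. indicator {0..t} s * (ennreal (norm (g (x + s *\<^sub>R b))) * indicator {0..t} s) \<partial>lborel)"
      by (intro nn_integral_cong) (auto split: split_indicator)
    finally have "(ennreal (norm (line_integral t b g x)))\<^sup>2
        \<le> (\<integral>\<^sup>+s. indicator {0..t} s * (ennreal (norm (g (x + s *\<^sub>R b))) * indicator {0..t} s) \<partial>lborel)\<^sup>2"
      by (rule power_mono) simp
    also have "\<dots> \<le> (\<integral>\<^sup>+s. (indicator {0..t} s)\<^sup>2 \<partial>lborel)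
        * (\<integral>\<^sup>+s. (ennreal (norm (g (x + s *\<^sub>R b))) * indicator {0..t} s)\<^sup>2 \<partial>lborel)"
      by (rule Cauchy_Schwarz_nn_integral) measurable
    also have "(\<integral>\<^sup>+s. (indicator {0..t} s)\<^sup>2 \<partial>lborel) = (\<integral>\<^sup>+s. indicator {0..t} s \<partial>lborel)"
      by (intro nn_integral_cong) (auto split: split_indicator)
    also have "\<dots> = ennreal t" using assms(2) by simp
    also have "(\<integral>\<^sup>+s. (ennreal (norm (g (x + s *\<^sub>R b))) * indicator {0..t} s)\<^sup>2 \<partial>lborel)
        = (\<integral>\<^sup>+s. ennreal ((norm (g (x + s *\<^sub>R b)))\<^sup>2) * indicator {0..t} s \<partial>lborel)"
      by (intro nn_integral_cong) (auto simp: ennreal_power split: split_indicator)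
    finally show ?thesis by (simp add: ennreal_power)
  qed
  have "(\<integral>\<^sup>+x. ennreal ((norm (line_integral t b g x))\<^sup>2) \<partial>lborel)
      \<le> (\<integral>\<^sup>+x. ennreal t * (\<integral>\<^sup>+s. ennreal ((norm (g (x + s *\<^sub>R b)))\<^sup>2) * indicator {0..t} s \<partial>lborel) \<partial>lborel)"
    by (intro nn_integral_mono pointwise)
  also have "\<dots> = ennreal t * (\<integral>\<^sup>+x. (\<integral>\<^sup>+s. ennreal ((norm (g (x + s *\<^sub>R b)))\<^sup>2) * indicator {0..t} s \<partial>lborel) \<partial>lborel)"
    by (rule nn_integral_cmult) measurable
  also have "(\<integral>\<^sup>+x. (\<integral>\<^sup>+s. ennreal ((norm (g (x + s *\<^sub>R b)))\<^sup>2) * indicator {0..t} s \<partial>lborel) \<partial>lborel)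
      = (\<integral>\<^sup>+s. (\<integral>\<^sup>+x. ennreal ((norm (g (x + s *\<^sub>R b)))\<^sup>2) * indicator {0..t} s \<partial>lborel) \<partial>lborel)"
    by (rule lborel_pair.Fubini'[symmetric]) measurable
  also have "\<dots> = (\<integral>\<^sup>+s. ennreal ((L2_norm g)\<^sup>2) * indicator {0..t} s \<partial>lborel)"
  proof (rule nn_integral_cong)
    fix s
    have "(\<integral>\<^sup>+x. ennreal ((norm (g (x + s *\<^sub>R b)))\<^sup>2) * indicator {0..t} s \<partial>lborel)
        = (\<integral>\<^sup>+x. ennreal ((norm (g (x + s *\<^sub>R b)))\<^sup>2) \<partial>lborel) * indicator {0..t} s"
      by (rule nn_integral_multc) measurable
    also have "(\<integral>\<^sup>+x. ennreal ((norm (g (x + s *\<^sub>R b)))\<^sup>2) \<partial>lborel) = ennreal ((L2_norm g)\<^sup>2)"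
      using nn_integral_L2_norm[OF L2_translate(1)[OF assms(1), of "s *\<^sub>R b"]]
      by (simp add: L2_translate(2)[OF assms(1)])
    finally show "(\<integral>\<^sup>+x. ennreal ((norm (g (x + s *\<^sub>R b)))\<^sup>2) * indicator {0..t} s \<partial>lborel) = ennreal ((L2_norm g)\<^sup>2) * indicator {0..t} s" .
  qed
  also have "\<dots> = ennreal ((L2_norm g)\<^sup>2) * ennreal t"
    using assms(2) by (simp add: nn_integral_cmult_indicator)
  also have "ennreal t * (ennreal ((L2_norm g)\<^sup>2) * ennreal t) = ennreal ((t * L2_norm g)\<^sup>2)"
    using assms(2) by (simp add: ennreal_mult[symmetric] power2_eq_square mult_ac)
  finally have le: "(\<integral>\<^sup>+x. ennreal ((norm (line_integral t b g x))\<^sup>2) \<partial>lborel) \<le> ennreal ((t * L2_norm g)\<^sup>2)" .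
  show L2: "line_integral t b g \<in> L2"
    unfolding L2_iff_nn_integral using le meas by (auto intro: le_less_trans)
  have "(L2_norm (line_integral t b g))\<^sup>2 \<le> (t * L2_norm g)\<^sup>2"
    using le by (simp add: nn_integral_L2_norm[OF L2])
  then show "L2_norm (line_integral t b g) \<le> t * L2_norm g"
    using assms(2) L2_norm_nonneg[of g] by (auto intro: power2_le_imp_le)
qed

lemma test_function_line_FTC:
  fixes \<phi> :: "'a::euclidean_space \<Rightarrow> real"
  assumes \<phi>: "test_function \<phi>" and b: "b \<in> Basis" and t: "t \<ge> 0"
  shows "(\<integral>s. indicator {0..t} s *\<^sub>R frechet_derivative \<phi> (at (x - s *\<^sub>R b)) b \<partial>lborel) = \<phi> x - \<phi> (x - t *\<^sub>R b)"
proof -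
  have "(\<integral>s. indicator {0..t} s *\<^sub>R frechet_derivative \<phi> (at (x - s *\<^sub>R b)) b \<partial>lborel)
      = - \<phi> (x - t *\<^sub>R b) - (- \<phi> (x - 0 *\<^sub>R b))"
  proof (rule integral_FTC_Icc[OF t])
    fix s :: real
    let ?D = "frechet_derivative \<phi> (at (x - s *\<^sub>R b))"
    have D: "(\<phi> has_derivative ?D) (at (x - s *\<^sub>R b))"
      by (rule has_derivative_frechet[OF test_function_differentiable[OF \<phi>]])
    have 1: "((\<lambda>s. x - s *\<^sub>R b) has_derivative (\<lambda>h. - (h *\<^sub>R b))) (at s)"
      by (auto intro!: derivative_eq_intros)
    have "((\<lambda>s. - \<phi> (x - s *\<^sub>R b)) has_derivative (\<lambda>h. - ?D (- (h *\<^sub>R b)))) (at s)"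
      by (intro has_derivative_minus has_derivative_compose[OF 1 D])
    also have "(\<lambda>h. - ?D (- (h *\<^sub>R b))) = (\<lambda>h. h *\<^sub>R ?D b)"
      using has_derivative_linear[OF D] by (simp add: linear_neg linear_scale)
    finally show "((\<lambda>s. - \<phi> (x - s *\<^sub>R b)) has_vector_derivative ?D b) (at s within {0..t})"
      unfolding has_vector_derivative_def by (rule has_derivative_at_withinI)
  next
    show "continuous_on {0..t} (\<lambda>s. frechet_derivative \<phi> (at (x - s *\<^sub>R b)) b)"
      by (rule continuous_on_compose2[OF test_function_continuous[OF test_function_derivative[OF \<phi> b]]])
         (auto intro!: continuous_intros)
  qed
  then show ?thesis by simp
qed

text \<open>The fundamental theorem of calculus for weak derivatives, up to null sets.  Against a test function
  \<open>\<phi>\<close>, translations and the derivative are moved onto \<open>\<phi>\<close>, where the classical theorem applies;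
  the fundamental lemma removes \<open>\<phi>\<close>.\<close>

theorem difference_eq_line_integral:
  fixes u g :: "'a::euclidean_space \<Rightarrow> complex"
  assumes u: "u \<in> L2" and g: "has_weak_deriv u b g" and b: "b \<in> Basis" and t: "t \<ge> 0"
  shows "AE x in lborel. u (x + t *\<^sub>R b) - u x = line_integral t b g x"
proof -
  have gL2: "g \<in> L2" using g by (rule has_weak_deriv_L2)
  have [measurable]: "u \<in> borel_measurable borel" "g \<in> borel_measurable borel"
    using L2_measurable[OF u] L2_measurable[OF gL2] by simp_all
  note ut = L2_translate(1)[OF u, of "t *\<^sub>R b"]
  note G = line_integral_L2(1)[OF gL2 t, of b]
  have "AE x in lborel. (u (x + t *\<^sub>R b) - u x) - line_integral t b g x = 0"
  proof (rule fundamental_lemma)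
    show "(\<lambda>x. (u (x + t *\<^sub>R b) - u x) - line_integral t b g x) \<in> L2"
      by (intro L2.mem_diff ut u G)
    fix \<phi> :: "'a \<Rightarrow> real" assume \<phi>: "test_function \<phi>"
    note \<phi>' = test_function_derivative[OF \<phi> b]
    define D where "D = (\<lambda>x. frechet_derivative \<phi> (at x) b)"
    have D: "test_function D" unfolding D_def by (rule \<phi>')
    have [measurable]: "\<phi> \<in> borel_measurable borel" "D \<in> borel_measurable borel"
      using \<phi> D by (auto intro: test_function_measurable)
    have shift: "test_function (\<lambda>x. \<psi> (x - z))" if "test_function \<psi>" for \<psi> and z :: 'a
      using test_function_translate[OF that, of "- z"] by simp
    have move: "(\<integral>x. \<phi> x *\<^sub>R f (x + z) \<partial>lborel) = (\<integral>x. \<phi> (x - z) *\<^sub>R f x \<partial>lborel)"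
      if [measurable]: "f \<in> borel_measurable borel" for f :: "'a \<Rightarrow> complex" and z
      using integral_translate[of "\<lambda>x. \<phi> (x - z) *\<^sub>R f x" z] by simp
    have "(\<integral>x. \<phi> x *\<^sub>R line_integral t b g x \<partial>lborel)
        = (\<integral>x. (\<integral>s. indicator {0..t} s *\<^sub>R (\<phi> x *\<^sub>R g (x + s *\<^sub>R b)) \<partial>lborel) \<partial>lborel)"
      unfolding line_integral_def integral_scaleR_right[symmetric] by (simp add: mult.commute)
    also have "\<dots> = (\<integral>s. indicator {0..t} s *\<^sub>R (\<integral>x. \<phi> x *\<^sub>R g (x + s *\<^sub>R b) \<partial>lborel) \<partial>lborel)"
    proof (rule Fubini_slab)
      show "(\<integral>\<^sup>+x. ennreal (norm (\<phi> x *\<^sub>R g (x + s *\<^sub>R b))) \<partial>lborel)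
          \<le> ennreal ((L2_norm (\<lambda>x. complex_of_real (\<phi> x)))\<^sup>2 + (L2_norm g)\<^sup>2)" for s
        using nn_integral_product_le[OF test_function_L2[OF \<phi>] L2_translate(1)[OF gL2, of "s *\<^sub>R b"]]
        by (simp add: scaleR_conv_of_real L2_translate(2)[OF gL2])
    qed measurable
    \<comment> \<open>The translate of \<open>\<phi>\<close> is itself a test function, so the definition of \<open>g\<close> applies to it.\<close>
    also have "\<dots> = (\<integral>s. indicator {0..t} s *\<^sub>R (\<integral>x. - (D (x - s *\<^sub>R b) *\<^sub>R u x) \<partial>lborel) \<partial>lborel)"
    proof -
      have "(\<integral>x. \<phi> x *\<^sub>R g (x + s *\<^sub>R b) \<partial>lborel) = (\<integral>x. - (D (x - s *\<^sub>R b) *\<^sub>R u x) \<partial>lborel)" for s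
      proof -
        have "(\<integral>x. D (x - s *\<^sub>R b) *\<^sub>R u x \<partial>lborel) = - (\<integral>x. \<phi> (x - s *\<^sub>R b) *\<^sub>R g x \<partial>lborel)"
          using g shift[OF \<phi>, of "s *\<^sub>R b"]
            frechet_derivative_translate[OF test_function_differentiable[OF \<phi>], of "- s *\<^sub>R b"]
          unfolding has_weak_deriv_def by (auto simp: D_def)
        then show ?thesis by (simp add: move)
      qed
      then show ?thesis by simp
    qed
    also have "\<dots> = (\<integral>x. (\<integral>s. indicator {0..t} s *\<^sub>R (- (D (x - s *\<^sub>R b) *\<^sub>R u x)) \<partial>lborel) \<partial>lborel)"
    proof (rule Fubini_slab[symmetric])
      have "(\<lambda>x. complex_of_real (D (x - s *\<^sub>R b))) \<in> L2"
         "L2_norm (\<lambda>x. complex_of_real (D (x - s *\<^sub>R b))) = L2_norm (\<lambda>x. complex_of_real (D x))" for s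
        using L2_translate[OF test_function_L2[OF D], of "- s *\<^sub>R b"] by simp_all
      then show "(\<integral>\<^sup>+x. ennreal (norm (- (D (x - s *\<^sub>R b) *\<^sub>R u x))) \<partial>lborel)
          \<le> ennreal ((L2_norm (\<lambda>x. complex_of_real (D x)))\<^sup>2 + (L2_norm u)\<^sup>2)" for s
        using nn_integral_product_le[OF _ u, of "\<lambda>x. complex_of_real (D (x - s *\<^sub>R b))"]
        by (simp add: scaleR_conv_of_real)
    qed measurable
    also have "\<dots> = (\<integral>x. \<phi> (x - t *\<^sub>R b) *\<^sub>R u x - \<phi> x *\<^sub>R u x \<partial>lborel)"
    proof (rule Bochner_Integration.integral_cong[OF refl])
      fix x
      have "(\<integral>s. indicator {0..t} s *\<^sub>R (- (D (x - s *\<^sub>R b) *\<^sub>R u x)) \<partial>lborel)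
          = (\<integral>s. (indicator {0..t} s *\<^sub>R D (x - s *\<^sub>R b)) *\<^sub>R (- u x) \<partial>lborel)"
        by simp
      also have "\<dots> = (\<integral>s. indicator {0..t} s *\<^sub>R D (x - s *\<^sub>R b) \<partial>lborel) *\<^sub>R (- u x)"
      proof (rule integral_scaleR_left)
        have "continuous_on {0..t} (\<lambda>s. D (x - s *\<^sub>R b))"
          by (rule continuous_on_compose2[OF test_function_continuous[OF D]]) (auto intro!: continuous_intros)
        then show "integrable lborel (\<lambda>s. indicator {0..t} s *\<^sub>R D (x - s *\<^sub>R b))"
          by (rule borel_integrable_compact[OF compact_Icc])
      qed
      also have "(\<integral>s. indicator {0..t} s *\<^sub>R D (x - s *\<^sub>R b) \<partial>lborel) = \<phi> x - \<phi> (x - t *\<^sub>R b)"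
        unfolding D_def by (rule test_function_line_FTC[OF \<phi> b t])
      finally show "(\<integral>s. indicator {0..t} s *\<^sub>R (- (D (x - s *\<^sub>R b) *\<^sub>R u x)) \<partial>lborel) = \<phi> (x - t *\<^sub>R b) *\<^sub>R u x - \<phi> x *\<^sub>R u x"
        by (simp add: algebra_simps)
    qed
    also have "\<dots> = (\<integral>x. \<phi> (x - t *\<^sub>R b) *\<^sub>R u x \<partial>lborel) - (\<integral>x. \<phi> x *\<^sub>R u x \<partial>lborel)"
      by (intro Bochner_Integration.integral_diff test_function_integrable shift \<phi> u)
    also have "\<dots> = (\<integral>x. \<phi> x *\<^sub>R u (x + t *\<^sub>R b) \<partial>lborel) - (\<integral>x. \<phi> x *\<^sub>R u x \<partial>lborel)"
      by (simp add: move)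
    finally have eq: "(\<integral>x. \<phi> x *\<^sub>R line_integral t b g x \<partial>lborel)
      = (\<integral>x. \<phi> x *\<^sub>R u (x + t *\<^sub>R b) \<partial>lborel) - (\<integral>x. \<phi> x *\<^sub>R u x \<partial>lborel)" .
    have "(\<integral>x. \<phi> x *\<^sub>R ((u (x + t *\<^sub>R b) - u x) - line_integral t b g x) \<partial>lborel)
        = ((\<integral>x. \<phi> x *\<^sub>R u (x + t *\<^sub>R b) \<partial>lborel) - (\<integral>x. \<phi> x *\<^sub>R u x \<partial>lborel)) - (\<integral>x. \<phi> x *\<^sub>R line_integral t b g x \<partial>lborel)"
      using test_function_integrable[OF \<phi> ut] test_function_integrable[OF \<phi> u] test_function_integrable[OF \<phi> G]
      by (simp add: scaleR_diff_right)
    then show "(\<integral>x. \<phi> x *\<^sub>R ((u (x + t *\<^sub>R b) - u x) - line_integral t b g x) \<partial>lborel) = 0"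
      using eq by simp
  qed
  then show ?thesis by eventually_elim simp
qed

lemma L2_norm_minus_commute: "L2_norm (\<lambda>x. f x - g x) = L2_norm (\<lambda>x. g x - f x)"
  by (simp add: L2_norm_def norm_minus_commute)

lemma translation_direction_le:
  fixes u g :: "'a::euclidean_space \<Rightarrow> complex"
  assumes u: "u \<in> L2" and g: "has_weak_deriv u b g" and b: "b \<in> Basis"
  shows "L2_norm (\<lambda>x. u (x + t *\<^sub>R b) - u x) \<le> \<bar>t\<bar> * L2_norm g"
proof -
  have gL2: "g \<in> L2" using g by (rule has_weak_deriv_L2)
  have pos: "L2_norm (\<lambda>x. u (x + r *\<^sub>R b) - u x) \<le> r * L2_norm g" if "r \<ge> 0" for r
    using line_integral_L2[OF gL2 that, of b]
      L2_norm_cong_AE[OF difference_eq_line_integral[OF u g b that] L2.mem_diff[OF L2_translate(1)[OF u] u]]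
    by simp
  show ?thesis
  proof (cases "t \<ge> 0")
    case True
    then show ?thesis using pos by simp
  next
    case False
    have "L2_norm (\<lambda>x. u (x + t *\<^sub>R b) - u x) = L2_norm (\<lambda>x. u ((x + (- t) *\<^sub>R b) + t *\<^sub>R b) - u (x + (- t) *\<^sub>R b))"
      by (rule L2_translate(2)[OF L2.mem_diff[OF L2_translate(1)[OF u] u], symmetric])
    also have "\<dots> = L2_norm (\<lambda>x. u x - u (x + (- t) *\<^sub>R b))" by simp
    also have "\<dots> = L2_norm (\<lambda>x. u (x + (- t) *\<^sub>R b) - u x)" by (rule L2_norm_minus_commute)
    finally have "L2_norm (\<lambda>x. u (x + t *\<^sub>R b) - u x) = L2_norm (\<lambda>x. u (x + (- t) *\<^sub>R b) - u x)" .
    then show ?thesis using pos[of "- t"] False by simp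
  qed
qed

text \<open>The translation by \<open>z\<close> is performed one coordinate at a time.\<close>

lemma translation_le:
  fixes u :: "'a::euclidean_space \<Rightarrow> complex"
  assumes u: "u \<in> H1"
  shows "L2_norm (\<lambda>x. u (x + z) - u x) \<le> (\<Sum>b\<in>Basis. \<bar>z \<bullet> b\<bar> * L2_norm (weak_deriv u b))"
proof -
  have uL2: "u \<in> L2" using u by (rule H1_L2)
  have "L2_norm (\<lambda>x. u (x + (\<Sum>b\<in>A. (z \<bullet> b) *\<^sub>R b)) - u x) \<le> (\<Sum>b\<in>A. \<bar>z \<bullet> b\<bar> * L2_norm (weak_deriv u b))"
    if "A \<subseteq> Basis" for A
  proof -
    have "finite A" using that finite_Basis by (rule finite_subset)
    then show ?thesis using that
    proof (induction A rule: finite_induct)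
      case empty
      then show ?case by (simp add: L2_norm_def)
    next
      case (insert b A)
      let ?y = "\<Sum>b\<in>A. (z \<bullet> b) *\<^sub>R b" and ?t = "z \<bullet> b"
      have eq: "u (x + (\<Sum>b\<in>insert b A. (z \<bullet> b) *\<^sub>R b)) - u x
          = (u ((x + ?t *\<^sub>R b) + ?y) - u (x + ?t *\<^sub>R b)) + (u (x + ?t *\<^sub>R b) - u x)" for x
        using insert.hyps by (simp add: algebra_simps)
      have 1: "(\<lambda>x. u (x + ?y) - u x) \<in> L2" by (intro L2.mem_diff L2_translate uL2)
      have "L2_norm (\<lambda>x. u (x + (\<Sum>b\<in>insert b A. (z \<bullet> b) *\<^sub>R b)) - u x)
          \<le> L2_norm (\<lambda>x. u ((x + ?t *\<^sub>R b) + ?y) - u (x + ?t *\<^sub>R b)) + L2_norm (\<lambda>x. u (x + ?t *\<^sub>R b) - u x)"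
        unfolding eq by (intro L2_norm_triangle L2_translate(1)[OF 1] L2.mem_diff L2_translate(1) uL2)
      also have "L2_norm (\<lambda>x. u ((x + ?t *\<^sub>R b) + ?y) - u (x + ?t *\<^sub>R b)) = L2_norm (\<lambda>x. u (x + ?y) - u x)"
        by (rule L2_translate(2)[OF 1])
      also have "\<dots> \<le> (\<Sum>b\<in>A. \<bar>z \<bullet> b\<bar> * L2_norm (weak_deriv u b))"
        using insert by simp
      also have "L2_norm (\<lambda>x. u (x + ?t *\<^sub>R b) - u x) \<le> \<bar>?t\<bar> * L2_norm (weak_deriv u b)"
        using insert.prems by (intro translation_direction_le uL2 has_weak_deriv_weak_deriv u) auto
      finally show ?case using insert.hyps by simp
    qed
  qed
  from this[OF subset_refl] show ?thesis by (simp add: euclidean_representation)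
qed

lemma translation_square_le:
  fixes u :: "'a::euclidean_space \<Rightarrow> complex" and \<delta> :: real
  assumes u: "u \<in> H1" and z: "\<And>b. b \<in> Basis \<Longrightarrow> \<bar>z \<bullet> b\<bar> \<le> \<delta>"
  shows "(L2_norm (\<lambda>x. u (x + z) - u x))\<^sup>2 \<le> real DIM('a) * \<delta>\<^sup>2 * gradient_energy u"
proof -
  have "L2_norm (\<lambda>x. u (x + z) - u x) \<le> (\<Sum>b\<in>Basis. \<delta> * L2_norm (weak_deriv u b))"
    by (rule order_trans[OF translation_le[OF u]]) (intro sum_mono mult_right_mono z L2_norm_nonneg)
  then have "(L2_norm (\<lambda>x. u (x + z) - u x))\<^sup>2 \<le> (\<Sum>b\<in>Basis. \<delta> * L2_norm (weak_deriv u b))\<^sup>2"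
    by (intro power_mono L2_norm_nonneg)
  also have "\<dots> \<le> real DIM('a) * (\<Sum>b\<in>Basis. (\<delta> * L2_norm (weak_deriv u b))\<^sup>2)"
    using Cauchy_Schwarz_ineq_sum[of "\<lambda>_. 1" "\<lambda>b. \<delta> * L2_norm (weak_deriv u b)" "Basis :: 'a set"] by simp
  also have "\<dots> = real DIM('a) * \<delta>\<^sup>2 * gradient_energy u"
    by (simp add: gradient_energy_def power_mult_distrib sum_distrib_left mult.assoc)
  finally show ?thesis .
qed

section \<open>A local Poincare inequality on a grid\<close>

text \<open>Up to a factor, both sides are the variance of \<open>w\<close> on \<open>A\<close>; the square under the double integral is
  expanded.\<close>

lemma square_integral_over_pairs:
  fixes w :: "'a::euclidean_space \<Rightarrow> complex"
  assumes A [measurable]: "A \<in> sets borel" and bA: "bounded A" and w: "w \<in> L2"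
  defines "M \<equiv> measure lborel A" and "S \<equiv> \<integral>x. indicator A x * (norm (w x))\<^sup>2 \<partial>lborel"
    and "W \<equiv> \<integral>x. indicator A x *\<^sub>R w x \<partial>lborel"
  shows "(\<integral>\<^sup>+x. (\<integral>\<^sup>+y. ennreal (indicator A x * indicator A y * (norm (w x - w y))\<^sup>2) \<partial>lborel) \<partial>lborel)
    = ennreal (2 * (M * S - (norm W)\<^sup>2))"
proof -
  have [measurable]: "w \<in> borel_measurable borel" using L2_measurable[OF w] by simp
  have iA: "integrable lborel (\<lambda>x. indicator A x :: real)"
    using A emeasure_bounded_finite[OF bA] by (auto simp: less_top)
  have IA: "(\<integral>x. indicator A x \<partial>lborel) = M" by (simp add: M_def)
  have iw: "integrable lborel (\<lambda>x. indicator A x *\<^sub>R w x)"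
    using L2_set_integrable[OF _ bA w] by (simp add: set_integrable_def)
  have iS: "integrable lborel (\<lambda>x. indicator A x * (norm (w x))\<^sup>2)"
    by (rule Bochner_Integration.integrable_bound[OF L2_square_integrable[OF w]]) (auto split: split_indicator)
  have lin: "integrable lborel (\<lambda>y. indicator A y * Re (c * cnj (w y)))"
    "(\<integral>y. indicator A y * Re (c * cnj (w y)) \<partial>lborel) = Re (c * cnj W)" for c
  proof -
    have eq: "(\<lambda>y. indicator A y * Re (c * cnj (w y))) = (\<lambda>y. Re (c * cnj (indicator A y *\<^sub>R w y)))"
      by (auto split: split_indicator)
    have int: "integrable lborel (\<lambda>y. c * cnj (indicator A y *\<^sub>R w y))"
      by (intro integrable_mult_right integrable_cnj iw)
    show "integrable lborel (\<lambda>y. indicator A y * Re (c * cnj (w y)))"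
      unfolding eq by (rule integrable_Re[OF int])
    show "(\<integral>y. indicator A y * Re (c * cnj (w y)) \<partial>lborel) = Re (c * cnj W)"
      unfolding eq integral_Re[OF int] integral_mult_right_zero Bochner_Integration.integral_cnj W_def ..
  qed
  have expand: "(norm (a - b))\<^sup>2 = (norm a)\<^sup>2 - 2 * Re (a * cnj b) + (norm b)\<^sup>2" for a b :: complex
    unfolding cmod_power2 by (simp add: power2_eq_square algebra_simps)
  have hb: "has_bochner_integral lborel (\<lambda>y. indicator A y * (norm (w x - w y))\<^sup>2)
      (M * (norm (w x))\<^sup>2 - 2 * Re (W * cnj (w x)) + S)" for x
  proof -
    have "has_bochner_integral lborel
        (\<lambda>y. indicator A y * (norm (w x))\<^sup>2 - 2 * (indicator A y * Re (w x * cnj (w y))) + indicator A y * (norm (w y))\<^sup>2)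
        (M * (norm (w x))\<^sup>2 - 2 * Re (w x * cnj W) + S)"
      using iA iS lin[of "w x"] IA
      by (intro has_bochner_integral_add has_bochner_integral_diff has_bochner_integral_mult_right
          has_bochner_integral_mult_left) (auto simp: has_bochner_integral_iff S_def)
    moreover have "(\<lambda>y. indicator A y * (norm (w x))\<^sup>2 - 2 * (indicator A y * Re (w x * cnj (w y))) + indicator A y * (norm (w y))\<^sup>2)
        = (\<lambda>y. indicator A y * (norm (w x - w y))\<^sup>2)"
      unfolding expand by (intro ext) (simp add: algebra_simps)
    moreover have "Re (w x * cnj W) = Re (W * cnj (w x))" by (simp add: mult.commute)
    ultimately show ?thesis by (simp only:)
  qed
  have inner: "(\<integral>\<^sup>+y. ennreal (indicator A x * indicator A y * (norm (w x - w y))\<^sup>2) \<partial>lborel)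
      = ennreal (indicator A x * (M * (norm (w x))\<^sup>2 - 2 * Re (W * cnj (w x)) + S))" for x
  proof (cases "x \<in> A")
    case True
    have "(\<integral>\<^sup>+y. ennreal (indicator A y * (norm (w x - w y))\<^sup>2) \<partial>lborel)
        = ennreal (M * (norm (w x))\<^sup>2 - 2 * Re (W * cnj (w x)) + S)"
      using hb[of x] by (subst nn_integral_eq_integral) (simp_all only: has_bochner_integral_iff, auto)
    then show ?thesis using True by simp
  qed simp
  have nonneg: "0 \<le> indicator A x * (M * (norm (w x))\<^sup>2 - 2 * Re (W * cnj (w x)) + S)" for x
  proof -
    have "0 \<le> (\<integral>y. indicator A y * (norm (w x - w y))\<^sup>2 \<partial>lborel)" by (intro integral_nonneg_AE) simp
    then have "0 \<le> M * (norm (w x))\<^sup>2 - 2 * Re (W * cnj (w x)) + S"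
      unfolding has_bochner_integral_integral_eq[OF hb] .
    then show ?thesis by (intro mult_nonneg_nonneg) simp_all
  qed
  have "has_bochner_integral lborel
      (\<lambda>x. M * (indicator A x * (norm (w x))\<^sup>2) - 2 * (indicator A x * Re (W * cnj (w x))) + indicator A x * S)
      (M * S - 2 * Re (W * cnj W) + M * S)"
    using iA iS lin[of W] IA
    by (intro has_bochner_integral_add has_bochner_integral_diff has_bochner_integral_mult_right
        has_bochner_integral_mult_left) (auto simp: has_bochner_integral_iff S_def)
  also have "(\<lambda>x. M * (indicator A x * (norm (w x))\<^sup>2) - 2 * (indicator A x * Re (W * cnj (w x))) + indicator A x * S)
      = (\<lambda>x. indicator A x * (M * (norm (w x))\<^sup>2 - 2 * Re (W * cnj (w x)) + S))"
    by (intro ext) (simp add: algebra_simps)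
  also have "Re (W * cnj W) = (norm W)\<^sup>2" by (simp only: complex_norm_square[symmetric] Re_complex_of_real)
  also have "M * S - 2 * (norm W)\<^sup>2 + M * S = 2 * (M * S - (norm W)\<^sup>2)" by simp
  finally have int: "integrable lborel (\<lambda>x. indicator A x * (M * (norm (w x))\<^sup>2 - 2 * Re (W * cnj (w x)) + S))"
    and val: "(\<integral>x. indicator A x * (M * (norm (w x))\<^sup>2 - 2 * Re (W * cnj (w x)) + S) \<partial>lborel) = 2 * (M * S - (norm W)\<^sup>2)"
    unfolding has_bochner_integral_iff by blast+
  show ?thesis
    unfolding inner nn_integral_eq_integral[OF int AE_I2[OF nonneg]] val ..
qed

lemma ennreal_add_le: "ennreal (a + b) \<le> ennreal a + ennreal b"
  by (cases "0 \<le> a"; cases "0 \<le> b") (auto simp: ennreal_neg intro!: ennreal_leI)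

text \<open>With \<open>y = x + z\<close>, the inner integral over \<open>x\<close> is a translation difference, and the vectors \<open>z\<close> fill
  a cube of side \<open>2 \<delta>\<close>.\<close>

lemma near_diagonal_le:
  fixes w :: "'a::euclidean_space \<Rightarrow> complex" and \<delta> :: real
  assumes w: "w \<in> H1" and \<delta>: "\<delta> \<ge> 0"
  defines "C \<equiv> {z :: 'a. \<forall>b\<in>Basis. \<bar>z \<bullet> b\<bar> \<le> \<delta>}"
  shows "(\<integral>\<^sup>+x. (\<integral>\<^sup>+y. ennreal (indicator C (y - x) * (norm (w x - w y))\<^sup>2) \<partial>lborel) \<partial>lborel)
    \<le> ennreal ((2 * \<delta>) ^ DIM('a) * (real DIM('a) * \<delta>\<^sup>2 * gradient_energy w))"
proof -
  have wL2: "w \<in> L2" using w by (rule H1_L2)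
  have [measurable]: "w \<in> borel_measurable borel" using L2_measurable[OF wL2] by simp
  have C: "C = cbox (- \<delta> *\<^sub>R One) (\<delta> *\<^sub>R One)"
    by (auto simp: C_def mem_box abs_le_iff) (metis minus_le_iff)+
  have [measurable]: "C \<in> sets borel" unfolding C by simp
  define B where "B = real DIM('a) * \<delta>\<^sup>2 * gradient_energy w"
  have B: "B \<ge> 0" by (simp add: B_def gradient_energy_nonneg)
  have "(\<integral>\<^sup>+x. (\<integral>\<^sup>+y. ennreal (indicator C (y - x) * (norm (w x - w y))\<^sup>2) \<partial>lborel) \<partial>lborel)
      = (\<integral>\<^sup>+x. (\<integral>\<^sup>+z. ennreal (indicator C z * (norm (w x - w (z + x)))\<^sup>2) \<partial>lborel) \<partial>lborel)"
  proof (rule nn_integral_cong)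
    fix x :: 'a
    show "(\<integral>\<^sup>+y. ennreal (indicator C (y - x) * (norm (w x - w y))\<^sup>2) \<partial>lborel)
        = (\<integral>\<^sup>+z. ennreal (indicator C z * (norm (w x - w (z + x)))\<^sup>2) \<partial>lborel)"
      using nn_integral_translate[of "\<lambda>y. ennreal (indicator C (y - x) * (norm (w x - w y))\<^sup>2)" x] by simp
  qed
  also have "\<dots> = (\<integral>\<^sup>+z. (\<integral>\<^sup>+x. ennreal (indicator C z * (norm (w x - w (z + x)))\<^sup>2) \<partial>lborel) \<partial>lborel)"
    by (rule lborel_pair.Fubini'[symmetric]) measurable
  also have "\<dots> \<le> (\<integral>\<^sup>+z. ennreal B * indicator C z \<partial>lborel)"
  proof (rule nn_integral_mono)
    fix z :: 'a
    show "(\<integral>\<^sup>+x. ennreal (indicator C z * (norm (w x - w (z + x)))\<^sup>2) \<partial>lborel) \<le> ennreal B * indicator C z"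
    proof (cases "z \<in> C")
      case True
      have L2: "(\<lambda>x. w (x + z) - w x) \<in> L2" by (intro L2.mem_diff L2_translate wL2)
      have "(\<integral>\<^sup>+x. ennreal (indicator C z * (norm (w x - w (z + x)))\<^sup>2) \<partial>lborel) = ennreal ((L2_norm (\<lambda>x. w (x + z) - w x))\<^sup>2)"
        using True by (simp add: nn_integral_L2_norm[OF L2, symmetric] norm_minus_commute add.commute)
      also have "\<dots> \<le> ennreal B"
        unfolding B_def using True by (intro ennreal_leI translation_square_le[OF w]) (auto simp: C_def)
      finally show ?thesis using True by simp
    qed simp
  qed
  also have "\<dots> = ennreal B * emeasure lborel C" by (rule nn_integral_cmult_indicator) simp
  also have "emeasure lborel C = ennreal ((2 * \<delta>) ^ DIM('a))"
  proof -
    have One: "One \<bullet> b = 1" if "b \<in> Basis" for b :: 'a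
      using that by (simp add: inner_sum_left inner_Basis)
    have "(\<Prod>b\<in>Basis. (\<delta> *\<^sub>R One - - \<delta> *\<^sub>R One :: 'a) \<bullet> b) = (\<Prod>b\<in>(Basis :: 'a set). 2 * \<delta>)"
      by (intro prod.cong) (auto simp: inner_diff_left inner_add_left One)
    also have "\<dots> = (2 * \<delta>) ^ DIM('a)" by (rule prod_constant)
    finally show ?thesis unfolding C using \<delta> by (subst emeasure_lborel_cbox) (simp_all add: One)
  qed
  also have "ennreal B * ennreal ((2 * \<delta>) ^ DIM('a)) = ennreal ((2 * \<delta>) ^ DIM('a) * B)"
    using B \<delta> by (simp add: ennreal_mult mult.commute)
  finally show ?thesis by (simp add: B_def)
qed

text \<open>The Poincare inequality, summed over disjoint cells of equal measure.  On a single cell the variance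
  is an integral over pairs of points of that cell; all these pairs together are disjoint and lie
  near the diagonal.\<close>

theorem square_integral_over_cells_le:
  fixes w :: "'a::euclidean_space \<Rightarrow> complex" and \<delta> :: real
  assumes w: "w \<in> H1" and \<delta>: "\<delta> \<ge> 0" and fin: "finite \<Q>"
    and disj: "\<And>Q Q'. Q \<in> \<Q> \<Longrightarrow> Q' \<in> \<Q> \<Longrightarrow> Q \<noteq> Q' \<Longrightarrow> Q \<inter> Q' = {}"
    and meas: "\<And>Q. Q \<in> \<Q> \<Longrightarrow> Q \<in> sets borel" and bdd: "\<And>Q. Q \<in> \<Q> \<Longrightarrow> bounded Q"
    and M: "\<And>Q. Q \<in> \<Q> \<Longrightarrow> measure lborel Q = M"
    and diam: "\<And>Q x y b. Q \<in> \<Q> \<Longrightarrow> x \<in> Q \<Longrightarrow> y \<in> Q \<Longrightarrow> b \<in> Basis \<Longrightarrow> \<bar>(y - x) \<bullet> b\<bar> \<le> \<delta>"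
  shows "M * (\<Sum>Q\<in>\<Q>. \<integral>x. indicator Q x * (norm (w x))\<^sup>2 \<partial>lborel)
    \<le> (\<Sum>Q\<in>\<Q>. (norm (\<integral>x. indicator Q x *\<^sub>R w x \<partial>lborel))\<^sup>2)
      + (2 * \<delta>) ^ DIM('a) * (real DIM('a) * \<delta>\<^sup>2 * gradient_energy w) / 2"
proof -
  have wL2: "w \<in> L2" using w by (rule H1_L2)
  have [measurable]: "w \<in> borel_measurable borel" using L2_measurable[OF wL2] by simp
  note [measurable] = meas
  define C where "C = {z :: 'a. \<forall>b\<in>Basis. \<bar>z \<bullet> b\<bar> \<le> \<delta>}"
  define S where "S = (\<lambda>Q. \<integral>x. indicator Q x * (norm (w x))\<^sup>2 \<partial>lborel)"
  define W where "W = (\<lambda>Q. \<integral>x. indicator Q x *\<^sub>R w x \<partial>lborel)"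
  define I where "I = (\<lambda>Q. \<integral>\<^sup>+x. (\<integral>\<^sup>+y. ennreal (indicator Q x * indicator Q y * (norm (w x - w y))\<^sup>2) \<partial>lborel) \<partial>lborel)"
  have I: "I Q = ennreal (2 * (M * S Q - (norm (W Q))\<^sup>2))" if "Q \<in> \<Q>" for Q
    using square_integral_over_pairs[OF meas[OF that] bdd[OF that] wL2]
    by (simp add: I_def S_def W_def M[OF that])
  have pointwise: "(\<Sum>Q\<in>\<Q>. ennreal (indicator Q x * indicator Q y * a)) \<le> ennreal (indicator C (y - x) * a)" if "a \<ge> 0" for x y a
  proof (cases "\<exists>Q\<in>\<Q>. x \<in> Q \<and> y \<in> Q")
    case True
    then obtain Q where Q: "Q \<in> \<Q>" "x \<in> Q" "y \<in> Q" by blast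
    have "ennreal (indicator Q' x * indicator Q' y * a) = 0" if "Q' \<in> \<Q> - {Q}" for Q'
      using disj[of Q Q'] that Q by (auto split: split_indicator)
    then have "(\<Sum>Q\<in>\<Q>. ennreal (indicator Q x * indicator Q y * a)) = ennreal (indicator Q x * indicator Q y * a)"
      using fin Q by (subst sum.remove[of _ Q]) auto
    moreover have "y - x \<in> C" using diam Q by (auto simp: C_def)
    ultimately show ?thesis using Q by simp
  next
    case False
    then have "(\<Sum>Q\<in>\<Q>. ennreal (indicator Q x * indicator Q y * a)) = 0"
      by (intro sum.neutral) (auto split: split_indicator)
    then show ?thesis by simp
  qed
  \<comment> \<open>Subadditivity avoids a separate proof that each variance is non-negative.\<close>
  have "ennreal (\<Sum>Q\<in>\<Q>. 2 * (M * S Q - (norm (W Q))\<^sup>2)) \<le> (\<Sum>Q\<in>\<Q>. ennreal (2 * (M * S Q - (norm (W Q))\<^sup>2)))"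
    using fin
  proof (induction rule: finite_induct)
    case (insert Q F)
    then show ?case
      by (simp del: ennreal_plus) (meson add_left_mono ennreal_add_le order_trans)
  qed simp
  also have "\<dots> = (\<Sum>Q\<in>\<Q>. I Q)" using I by simp
  also have "\<dots> = (\<integral>\<^sup>+x. (\<integral>\<^sup>+y. (\<Sum>Q\<in>\<Q>. ennreal (indicator Q x * indicator Q y * (norm (w x - w y))\<^sup>2)) \<partial>lborel) \<partial>lborel)"
  proof -
    have "(\<Sum>Q\<in>\<Q>. I Q) = (\<integral>\<^sup>+x. (\<Sum>Q\<in>\<Q>. \<integral>\<^sup>+y. ennreal (indicator Q x * indicator Q y * (norm (w x - w y))\<^sup>2) \<partial>lborel) \<partial>lborel)"
      unfolding I_def
    proof (rule nn_integral_sum[symmetric])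
      fix Q assume "Q \<in> \<Q>"
      note [measurable] = meas[OF this]
      show "(\<lambda>x. \<integral>\<^sup>+y. ennreal (indicator Q x * indicator Q y * (norm (w x - w y))\<^sup>2) \<partial>lborel) \<in> borel_measurable lborel"
        by measurable
    qed
    also have "\<dots> = (\<integral>\<^sup>+x. (\<integral>\<^sup>+y. (\<Sum>Q\<in>\<Q>. ennreal (indicator Q x * indicator Q y * (norm (w x - w y))\<^sup>2)) \<partial>lborel) \<partial>lborel)"
    proof (intro nn_integral_cong nn_integral_sum[symmetric])
      fix Q x assume "Q \<in> \<Q>"
      note [measurable] = meas[OF this]
      show "(\<lambda>y. ennreal (indicator Q x * indicator Q y * (norm (w x - w y))\<^sup>2)) \<in> borel_measurable lborel"
        by measurable
    qed
    finally show ?thesis .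
  qed
  also have "\<dots> \<le> (\<integral>\<^sup>+x. (\<integral>\<^sup>+y. ennreal (indicator C (y - x) * (norm (w x - w y))\<^sup>2) \<partial>lborel) \<partial>lborel)"
    by (intro nn_integral_mono pointwise) simp
  also have "\<dots> \<le> ennreal ((2 * \<delta>) ^ DIM('a) * (real DIM('a) * \<delta>\<^sup>2 * gradient_energy w))"
    unfolding C_def by (rule near_diagonal_le[OF w \<delta>])
  finally have "(\<Sum>Q\<in>\<Q>. 2 * (M * S Q - (norm (W Q))\<^sup>2)) \<le> (2 * \<delta>) ^ DIM('a) * (real DIM('a) * \<delta>\<^sup>2 * gradient_energy w)"
    using \<delta> gradient_energy_nonneg[of w] by (subst (asm) ennreal_le_iff) auto
  then have "M * (\<Sum>Q\<in>\<Q>. S Q) \<le> (\<Sum>Q\<in>\<Q>. (norm (W Q))\<^sup>2) + (2 * \<delta>) ^ DIM('a) * (real DIM('a) * \<delta>\<^sup>2 * gradient_energy w) / 2"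
    by (simp add: sum_distrib_left[symmetric] sum_subtractf)
  then show ?thesis by (simp add: S_def W_def)
qed

text \<open>Half-open cubes, so that distinct cells are disjoint.\<close>

definition grid_cell :: "real \<Rightarrow> ('a::euclidean_space \<Rightarrow> int) \<Rightarrow> 'a set" where
  "grid_cell \<delta> k = {x. \<forall>b\<in>Basis. \<delta> * k b \<le> x \<bullet> b \<and> x \<bullet> b < \<delta> * (k b + 1)}"

lemma grid_cell_bounds:
  fixes k :: "'a::euclidean_space \<Rightarrow> int" and \<delta> :: real
  defines "l \<equiv> (\<Sum>b\<in>Basis. (\<delta> * k b) *\<^sub>R b)" and "u \<equiv> (\<Sum>b\<in>Basis. (\<delta> * (k b + 1)) *\<^sub>R b)"
  shows "box l u \<subseteq> grid_cell \<delta> k" "grid_cell \<delta> k \<subseteq> cbox l u"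
  by (auto simp: l_def u_def grid_cell_def mem_box inner_sum_left_Basis less_imp_le)

lemma grid_cell_borel: "grid_cell \<delta> k \<in> sets borel"
proof -
  have "grid_cell \<delta> k = (\<Inter>b\<in>Basis. {x. \<delta> * k b \<le> x \<bullet> b} \<inter> {x. x \<bullet> b < \<delta> * (k b + 1)})"
    by (auto simp: grid_cell_def)
  also have "\<dots> \<in> sets borel"
    by (intro sets.finite_INT) (auto intro!: sets.Int borel_closed borel_open closed_Collect_le open_Collect_less continuous_intros)
  finally show ?thesis .
qed

lemma measure_grid_cell:
  fixes k :: "'a::euclidean_space \<Rightarrow> int"
  assumes "\<delta> > 0"
  shows "measure lborel (grid_cell \<delta> k) = \<delta> ^ DIM('a)"
proof -
  define l u :: 'a where "l = (\<Sum>b\<in>Basis. (\<delta> * k b) *\<^sub>R b)" and "u = (\<Sum>b\<in>Basis. (\<delta> * (k b + 1)) *\<^sub>R b)"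
  have side: "(u - l) \<bullet> b = \<delta>" if "b \<in> Basis" for b
  proof -
    have "l \<bullet> b = \<delta> * k b" "u \<bullet> b = \<delta> * (k b + 1)"
      using that unfolding l_def u_def by (simp_all only: inner_sum_left_Basis)
    then show ?thesis by (simp add: inner_diff_left distrib_left)
  qed
  then have lu: "l \<bullet> b \<le> u \<bullet> b" if "b \<in> Basis" for b
    using that assms by (metis diff_ge_0_iff_ge inner_diff_left less_imp_le)
  have "emeasure lborel (box l u) \<le> emeasure lborel (grid_cell \<delta> k)"
    using grid_cell_bounds(1)[where \<delta> = \<delta> and k = k] grid_cell_borel unfolding l_def u_def by (intro emeasure_mono) auto
  moreover have "emeasure lborel (grid_cell \<delta> k) \<le> emeasure lborel (cbox l u)"
    using grid_cell_bounds(2)[where \<delta> = \<delta> and k = k] unfolding l_def u_def by (intro emeasure_mono) auto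
  moreover have "(\<Prod>b\<in>Basis. (u - l) \<bullet> b) = \<delta> ^ DIM('a)" by (simp add: side)
  ultimately have "emeasure lborel (grid_cell \<delta> k) = ennreal (\<delta> ^ DIM('a))"
    using lu by (simp add: emeasure_lborel_cbox emeasure_lborel_box)
  then show ?thesis using assms by (simp add: measure_def)
qed

lemma grid_cell_floor: "\<delta> > 0 \<Longrightarrow> x \<in> grid_cell \<delta> k \<longleftrightarrow> (\<forall>b\<in>Basis. k b = \<lfloor>x \<bullet> b / \<delta>\<rfloor>)"
  unfolding grid_cell_def
  by (auto simp: floor_eq_iff[symmetric] pos_le_divide_eq pos_divide_less_eq mult.commute floor_unique eq_commute[of "k _"])
     (auto simp: floor_eq_iff pos_le_divide_eq pos_divide_less_eq mult.commute)

lemma grid_cover: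
  fixes R :: real
  assumes \<delta>: "\<delta> > 0"
  obtains \<Q> :: "'a::euclidean_space set set" where "finite \<Q>" "cball 0 R \<subseteq> \<Union>\<Q>"
    "\<And>Q Q'. Q \<in> \<Q> \<Longrightarrow> Q' \<in> \<Q> \<Longrightarrow> Q \<noteq> Q' \<Longrightarrow> Q \<inter> Q' = {}"
    "\<And>Q. Q \<in> \<Q> \<Longrightarrow> Q \<in> sets borel" "\<And>Q. Q \<in> \<Q> \<Longrightarrow> bounded Q"
    "\<And>Q. Q \<in> \<Q> \<Longrightarrow> measure lborel Q = \<delta> ^ DIM('a)"
    "\<And>Q x y b. Q \<in> \<Q> \<Longrightarrow> x \<in> Q \<Longrightarrow> y \<in> Q \<Longrightarrow> b \<in> Basis \<Longrightarrow> \<bar>(y - x) \<bullet> b\<bar> \<le> \<delta>"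
proof -
  define N where "N = \<lceil>R / \<delta>\<rceil>"
  define \<Q> :: "'a set set" where "\<Q> = grid_cell \<delta> ` (Basis \<rightarrow>\<^sub>E {- N..N})"
  have 1: "finite \<Q>" unfolding \<Q>_def by (intro finite_imageI finite_PiE) auto
  have 2: "cball 0 R \<subseteq> \<Union>\<Q>"
  proof
    fix x :: 'a assume x: "x \<in> cball 0 R"
    define k where "k = restrict (\<lambda>b. \<lfloor>x \<bullet> b / \<delta>\<rfloor>) Basis"
    have "\<lfloor>x \<bullet> b / \<delta>\<rfloor> \<in> {- N..N}" if b: "b \<in> Basis" for b
    proof -
      have "\<bar>x \<bullet> b\<bar> \<le> R" using Basis_le_norm[OF b, of x] x by simp
      then have "\<bar>x \<bullet> b / \<delta>\<bar> \<le> R / \<delta>" using \<delta> by (simp add: divide_right_mono)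
      then have "- (R / \<delta>) \<le> x \<bullet> b / \<delta>" "x \<bullet> b / \<delta> \<le> R / \<delta>" by linarith+
      from this[THEN floor_mono] show ?thesis
        unfolding N_def by (simp add: floor_minus) linarith
    qed
    then have "k \<in> Basis \<rightarrow>\<^sub>E {- N..N}" by (auto simp: k_def)
    moreover have "x \<in> grid_cell \<delta> k" unfolding grid_cell_floor[OF \<delta>] by (simp add: k_def)
    ultimately show "x \<in> \<Union>\<Q>" by (auto simp: \<Q>_def)
  qed
  have 3: "Q \<inter> Q' = {}" if "Q \<in> \<Q>" "Q' \<in> \<Q>" "Q \<noteq> Q'" for Q Q'
  proof (rule ccontr)
    assume "Q \<inter> Q' \<noteq> {}"
    then obtain x where x: "x \<in> Q" "x \<in> Q'" by blast
    from that obtain k k' where k: "Q = grid_cell \<delta> k" "Q' = grid_cell \<delta> k'" by (auto simp: \<Q>_def)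
    have "\<forall>b\<in>Basis. k b = k' b" using x unfolding k grid_cell_floor[OF \<delta>] by simp
    then have "Q = Q'" unfolding k by (auto simp: grid_cell_def)
    with that show False by simp
  qed
  have 4: "Q \<in> sets borel" "bounded Q" "measure lborel Q = \<delta> ^ DIM('a)" if "Q \<in> \<Q>" for Q
  proof -
    from that obtain k where k: "Q = grid_cell \<delta> k" by (auto simp: \<Q>_def)
    show "Q \<in> sets borel" unfolding k by (rule grid_cell_borel)
    show "bounded Q" unfolding k by (rule bounded_subset[OF bounded_cbox grid_cell_bounds(2)])
    show "measure lborel Q = \<delta> ^ DIM('a)" unfolding k by (rule measure_grid_cell[OF \<delta>])
  qed
  have 5: "\<bar>(y - x) \<bullet> b\<bar> \<le> \<delta>" if "Q \<in> \<Q>" "x \<in> Q" "y \<in> Q" "b \<in> Basis" for Q x y b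
  proof -
    from that(1) obtain k where k: "Q = grid_cell \<delta> k" by (auto simp: \<Q>_def)
    have "\<delta> * k b \<le> x \<bullet> b" "x \<bullet> b < \<delta> * k b + \<delta>" "\<delta> * k b \<le> y \<bullet> b" "y \<bullet> b < \<delta> * k b + \<delta>"
      using that(2-4) unfolding k grid_cell_def by (auto simp: distrib_left)
    then show ?thesis by (simp add: inner_diff_left abs_le_iff)
  qed
  show thesis by (rule that[OF 1 2 3 4 5])
qed

section \<open>The semiclassical limit\<close>

text \<open>By the Lindelof property, the union of open sets in the definition of the support may be taken
  countable.\<close>

lemma vanishes_outside_ess_support:
  fixes f :: "'a::euclidean_space \<Rightarrow> complex"
  shows "AE x in lborel. x \<notin> ess_support f \<longrightarrow> f x = 0"
proof -
  define \<U> where "\<U> = {U. open U \<and> (AE x in lborel. x \<in> U \<longrightarrow> f x = 0)}"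
  obtain \<V> where \<V>: "\<V> \<subseteq> \<U>" "countable \<V>" "\<Union>\<V> = \<Union>\<U>"
    using Lindelof[of \<U>] by (auto simp: \<U>_def)
  have "AE x in lborel. \<forall>U\<in>\<V>. x \<in> U \<longrightarrow> f x = 0"
    using \<V>(1,2) by (intro AE_ball_countable[THEN iffD2]) (auto simp: \<U>_def)
  then show ?thesis
  proof eventually_elim
    case (elim x)
    show ?case
    proof
      assume "x \<notin> ess_support f"
      then have "x \<in> \<Union>\<V>" unfolding \<V>(3) by (auto simp: ess_support_def \<U>_def)
      with elim show "f x = 0" by blast
    qed
  qed
qed

lemma ess_support_subset_zero_set:
  fixes V :: "'a::euclidean_space \<Rightarrow> real"
  assumes "continuous_on UNIV V" "AE x in lborel. V x \<noteq> 0 \<longrightarrow> f x = 0"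
  shows "ess_support f \<subseteq> V -` {0}"
proof -
  have "open {x. V x \<noteq> 0}"
    using open_Collect_neq[OF assms(1) continuous_on_const] by simp
  with assms(2) have "{x. V x \<noteq> 0} \<in> {U. open U \<and> (AE x in lborel. x \<in> U \<longrightarrow> f x = 0)}" by simp
  then show ?thesis unfolding ess_support_def by blast
qed

lemma sqrt_mult_eq_0_of_support:
  assumes "ess_support f \<subseteq> V -` {0}"
  shows "AE x in lborel. sqrt_mult V f x = 0"
  using vanishes_outside_ess_support[of f]
  by eventually_elim (use assms in \<open>auto simp: sqrt_mult_def\<close>)

lemma potential_energy_add_le:
  assumes "u \<in> schrodinger_domain V" "v \<in> schrodinger_domain V"
  shows "potential_energy V (\<lambda>x. u x + v x) \<le> 2 * potential_energy V u + 2 * potential_energy V v"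
  using L2.quadratic_add_le[OF assms[THEN schrodinger_domainD(3)]]
  by (simp add: potential_energy_def sqrt_mult_add Re_L2_inner_self)

text \<open>For \<open>m \<le> n\<close> the representatives satisfy \<open>q\<^sub>m(w\<^sub>n - w\<^sub>m) \<le> \<langle>f, w\<^sub>m\<rangle> - \<langle>f, w\<^sub>n\<rangle>\<close>, because
  \<open>q\<^sub>m(w\<^sub>n) \<le> q\<^sub>n(w\<^sub>n) = \<langle>f, w\<^sub>n\<rangle>\<close>.  So they converge in \<open>H\<^sup>1\<close>, and \<open>n \<parallel>V\<^sup>1\<^sup>/\<^sup>2 w\<^sub>n\<parallel>\<^sup>2\<close> stays bounded, which
  makes the limit vanish where \<open>V\<close> does not.\<close>

theorem pairing_small_of_one_null:
  fixes V :: "'a::euclidean_space \<Rightarrow> real" and f :: "'a \<Rightarrow> complex"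
  assumes V0: "\<And>x. V x \<ge> 0" and V: "continuous_on UNIV V" and null: "one_null (V -` {0})"
    and f: "f \<in> L2" and \<epsilon>: "\<epsilon> > 0"
  shows "\<exists>n::nat. \<forall>u\<in>schrodinger_domain V.
    (cmod (L2_inner f u))\<^sup>2 \<le> \<epsilon> * (gradient_energy u + real n * potential_energy V u + (L2_norm u)\<^sup>2)"
proof -
  have Vm: "V \<in> borel_measurable borel" using V by (rule borel_measurable_continuous_onI)
  \<comment> \<open>The weight \<open>Suc n\<close> keeps the coefficient of the potential positive at \<open>n = 0\<close>; the factors \<open>1\<close> match the coefficients of the form.\<close>
  define q where "q = (\<lambda>n u. 1 * gradient_energy u + real (Suc n) * potential_energy V u + 1 * (L2_norm u)\<^sup>2)"
  define E where "E = (\<lambda>n. energy_form 1 (real (Suc n)) 1 V)"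
  have weighted_nonneg: "0 \<le> real (Suc n) * potential_energy V u" for n u
    by (simp add: potential_energy_nonneg)
  have q0: "0 \<le> q n u" for n u using gradient_energy_nonneg[of u] weighted_nonneg[of n u] by (simp add: q_def)
  have q_mono: "q m u \<le> q n u" if "m \<le> n" for m n u
    using that by (simp add: q_def mult_right_mono potential_energy_nonneg)
  have ReE: "Re (E n u u) = q n u" for n u by (simp only: E_def Re_energy_form q_def)
  interpret D: semi_inner_space "schrodinger_domain V" "E n" for n
    unfolding E_def by (rule semi_inner_space_energy_form) (use q0 in \<open>simp add: q_def\<close>)
  have Re_sym: "Re (E k v u) = Re (E k u v)"
    if "u \<in> schrodinger_domain V" "v \<in> schrodinger_domain V" for k u v
    by (subst D.hermitian[OF that]) simp
  have q_diff: "q k (\<lambda>x. u x - v x) = q k u - 2 * Re (E k u v) + q k v"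
    if "u \<in> schrodinger_domain V" "v \<in> schrodinger_domain V" for k u v
    unfolding ReE[symmetric] by (rule D.quadratic_diff[OF that])
  have q_sym: "q k (\<lambda>x. u x - v x) = q k (\<lambda>x. v x - u x)"
    if "u \<in> schrodinger_domain V" "v \<in> schrodinger_domain V" for k u v
    using q_diff[OF that, of k] q_diff[OF that(2,1), of k] Re_sym[OF that, of k] by simp
  have coercive: "1 * (L2_norm u)\<^sup>2 \<le> 1 * gradient_energy u + real (Suc n) * potential_energy V u + 1 * (L2_norm u)\<^sup>2" for n u
    using gradient_energy_nonneg[of u] weighted_nonneg[of n u] by simp
  have "\<exists>w\<in>schrodinger_domain V. \<forall>v\<in>schrodinger_domain V. E n w v = L2_inner f v" for n
    unfolding E_def
    by (rule coercive_energy_form_representation[OF Vm _ _ _ coercive f]) auto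
  then obtain w where w: "\<And>n. w n \<in> schrodinger_domain V"
    and rep: "\<And>n v. v \<in> schrodinger_domain V \<Longrightarrow> E n (w n) v = L2_inner f v"
    by metis
  define l where "l = (\<lambda>n. q n (w n))"
  have l_eq: "l n = Re (L2_inner f (w n))" for n
    unfolding l_def ReE[symmetric] rep[OF w] ..
  have dist: "q m (\<lambda>x. w n x - w m x) \<le> l m - l n" if "m \<le> n" for m n
  proof -
    have "Re (E m (w n) (w m)) = l n"
      unfolding Re_sym[OF w[of m] w[of n]] rep[OF w] l_eq ..
    then have "q m (\<lambda>x. w n x - w m x) = q m (w n) - 2 * l n + q m (w m)"
      using q_diff[OF w[of n] w[of m], of m] by simp
    then show ?thesis using q_mono[OF that, of "w n"] by (simp add: l_def)
  qed
  have l_mono: "l n \<le> l m" if "m \<le> n" for m n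
    using dist[OF that] q0[of m "\<lambda>x. w n x - w m x"] by linarith
  have l_nonneg: "0 \<le> l n" for n unfolding l_def by (rule q0)
  have "decseq l" using l_mono by (simp add: decseq_def)
  then obtain L where L: "l \<longlonglongrightarrow> L"
    using decseq_convergent[of l 0] l_nonneg by blast
  have "Cauchy l" using L by (intro LIMSEQ_imp_Cauchy)
  have "\<exists>w'\<in>schrodinger_domain V. (\<lambda>n. 1 * gradient_energy (\<lambda>x. w n x - w' x)
      + real (Suc 0) * potential_energy V (\<lambda>x. w n x - w' x) + 1 * (L2_norm (\<lambda>x. w n x - w' x))\<^sup>2) \<longlonglongrightarrow> 0"
  proof (rule coercive_energy_form_complete[OF Vm _ _ _ coercive w])
    fix e :: real assume "e > 0"
    then obtain N where N: "\<And>m n. m \<ge> N \<Longrightarrow> n \<ge> N \<Longrightarrow> \<bar>l m - l n\<bar> < e"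
      using \<open>Cauchy l\<close> unfolding Cauchy_def dist_real_def by blast
    have *: "q 0 (\<lambda>x. w n x - w m x) \<le> e" if "m \<ge> N" "m \<le> n" for m n
      using q_mono[of 0 m "\<lambda>x. w n x - w m x"] dist[OF that(2)] N[of m n] that by simp
    have "q 0 (\<lambda>x. w m x - w n x) \<le> e" if "m \<ge> N" "n \<ge> N" for m n
      using *[of m n] *[of n m] q_sym[OF w[of m] w[of n], of 0] that by (cases "m \<le> n") auto
    then show "\<exists>N. \<forall>m\<ge>N. \<forall>n\<ge>N. 1 * gradient_energy (\<lambda>x. w m x - w n x)
        + real (Suc 0) * potential_energy V (\<lambda>x. w m x - w n x) + 1 * (L2_norm (\<lambda>x. w m x - w n x))\<^sup>2 \<le> e"
      unfolding q_def by blast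
  qed auto
  then obtain w' where w': "w' \<in> schrodinger_domain V" and conv: "(\<lambda>n. q 0 (\<lambda>x. w n x - w' x)) \<longlonglongrightarrow> 0"
    unfolding q_def by blast
  have "potential_energy V w' \<le> 0"
  proof (rule LIMSEQ_le_const)
    have "(\<lambda>n. 2 * (l 0 * (1 / real (Suc n))) + 2 * q 0 (\<lambda>x. w n x - w' x)) \<longlonglongrightarrow> 2 * (l 0 * 0) + 2 * 0"
      by (intro tendsto_intros conv LIMSEQ_Suc[OF lim_1_over_n])
    then show "(\<lambda>n. 2 * (l 0 * (1 / real (Suc n))) + 2 * q 0 (\<lambda>x. w n x - w' x)) \<longlonglongrightarrow> 0" by simp
    have "potential_energy V w' \<le> 2 * (l 0 * (1 / real (Suc n))) + 2 * q 0 (\<lambda>x. w n x - w' x)" for n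
    proof -
      have d: "(\<lambda>x. w' x - w n x) \<in> schrodinger_domain V" using w' w by (rule D.mem_diff)
      have "real (Suc n) * potential_energy V (w n) \<le> l 0"
        using l_mono[of 0 n] gradient_energy_nonneg[of "w n"] weighted_nonneg[of n "w n"] zero_le_power2[of "L2_norm (w n)"]
        unfolding l_def q_def by linarith
      then have 1: "potential_energy V (w n) \<le> l 0 * (1 / real (Suc n))"
        by (simp add: field_simps)
      have "q 0 (\<lambda>x. w' x - w n x) = q 0 (\<lambda>x. w n x - w' x)"
        by (rule q_sym[OF w' w])
      moreover have "potential_energy V (\<lambda>x. w' x - w n x) \<le> q 0 (\<lambda>x. w' x - w n x)"
        by (simp add: q_def gradient_energy_nonneg)
      ultimately have 2: "potential_energy V (\<lambda>x. w' x - w n x) \<le> q 0 (\<lambda>x. w n x - w' x)" by simp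
      have "potential_energy V w' \<le> 2 * potential_energy V (w n) + 2 * potential_energy V (\<lambda>x. w' x - w n x)"
        using potential_energy_add_le[OF w[of n] d] by simp
      with 1 2 show ?thesis by linarith
    qed
    then show "\<exists>N. \<forall>n\<ge>N. potential_energy V w' \<le> 2 * (l 0 * (1 / real (Suc n))) + 2 * q 0 (\<lambda>x. w n x - w' x)" by blast
  qed
  then have "L2_norm (sqrt_mult V w') = 0"
    by (simp add: potential_energy_def)
  then have "AE x in lborel. sqrt_mult V w' x = 0"
    using L2_norm_eq_0_iff[OF schrodinger_domainD(3)[OF w']] by simp
  then have "AE x in lborel. V x \<noteq> 0 \<longrightarrow> w' x = 0"
    by eventually_elim (auto simp: sqrt_mult_def)
  from ess_support_subset_zero_set[OF V this] have w'0: "AE x in lborel. w' x = 0"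
    using null schrodinger_domainD(1)[OF w'] by (auto simp: one_null_def)
  have "(\<lambda>n. (L2_norm (\<lambda>x. w n x - w' x))\<^sup>2) \<longlonglongrightarrow> 0"
  proof (rule tendsto_sandwich[OF _ _ tendsto_const conv])
    show "\<forall>\<^sub>F n in sequentially. (L2_norm (\<lambda>x. w n x - w' x))\<^sup>2 \<le> q 0 (\<lambda>x. w n x - w' x)"
      using coercive[of _ 0] by (intro always_eventually) (simp add: q_def)
  qed simp
  from L2_inner_tendsto[OF schrodinger_domainD(2)[OF w] schrodinger_domainD(2)[OF w'] f this]
  have "(\<lambda>n. L2_inner (w n) f) \<longlonglongrightarrow> L2_inner w' f" .
  moreover have "L2_inner w' f = 0"
    using L2_inner_cong_AE[OF w'0 _ schrodinger_domainD(2)[OF w'] L2_zero f f] by (simp add: L2_inner_def)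
  ultimately have "(\<lambda>n. Re (L2_inner (w n) f)) \<longlonglongrightarrow> Re 0" by (intro tendsto_Re) simp
  then have "l \<longlonglongrightarrow> 0" unfolding l_eq[abs_def] by (subst L2_inner_commute) simp
  from order_tendstoD(2)[OF this \<epsilon>] obtain n where n: "l n < \<epsilon>"
    by (auto simp: eventually_sequentially)
  have "(cmod (L2_inner f u))\<^sup>2 \<le> \<epsilon> * (gradient_energy u + real (Suc n) * potential_energy V u + (L2_norm u)\<^sup>2)"
    if u: "u \<in> schrodinger_domain V" for u
  proof -
    have "(cmod (L2_inner f u))\<^sup>2 \<le> l n * q n u"
      using D.Cauchy_Schwarz[OF w[of n] u, of n] unfolding rep[OF u] ReE l_def .
    also have "\<dots> \<le> \<epsilon> * q n u" using n q0 by (intro mult_right_mono) auto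
    finally show ?thesis by (simp add: q_def)
  qed
  then show ?thesis by blast
qed

lemma pairing_indicator:
  assumes "Q \<in> sets borel"
  shows "cmod (\<integral>x. indicator Q x *\<^sub>R u x \<partial>lborel) = cmod (L2_inner (indicator Q) u)"
proof -
  have "L2_inner u (indicator Q) = (\<integral>x. indicator Q x *\<^sub>R u x \<partial>lborel)"
    unfolding L2_inner_def by (intro Bochner_Integration.integral_cong) (auto split: split_indicator)
  then show ?thesis by (metis L2_inner_commute complex_mod_cnj)
qed

lemma L2_norm_le_tail_plus_cells:
  fixes u :: "'a::euclidean_space \<Rightarrow> complex"
  assumes V0: "\<And>x. V x \<ge> 0" and u: "u \<in> schrodinger_domain V"
    and c: "c > 0" "\<And>x. norm x \<ge> R \<Longrightarrow> V x \<ge> c"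
    and fin: "finite \<Q>" and cover: "cball 0 R \<subseteq> \<Union>\<Q>" and meas: "\<And>Q. Q \<in> \<Q> \<Longrightarrow> Q \<in> sets borel"
  shows "(L2_norm u)\<^sup>2 \<le> potential_energy V u / c + (\<Sum>Q\<in>\<Q>. \<integral>x. indicator Q x * (norm (u x))\<^sup>2 \<partial>lborel)"
proof -
  note L2 = schrodinger_domainD(2,3)[OF u]
  note sq = L2_square_integrable[OF L2(1)] L2_square_integrable[OF L2(2)]
  have cell: "integrable lborel (\<lambda>x. indicator Q x * (norm (u x))\<^sup>2)" if "Q \<in> \<Q>" for Q
  proof (rule Bochner_Integration.integrable_bound[OF sq(1)])
    have [measurable]: "Q \<in> sets borel" "u \<in> borel_measurable borel"
      using meas[OF that] L2_measurable[OF L2(1)] by simp_all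
    show "(\<lambda>x. indicator Q x * (norm (u x))\<^sup>2) \<in> borel_measurable lborel" by measurable
  qed (auto split: split_indicator)
  have "(\<integral>x. (norm (u x))\<^sup>2 \<partial>lborel)
      \<le> (\<integral>x. (norm (sqrt_mult V u x))\<^sup>2 / c + (\<Sum>Q\<in>\<Q>. indicator Q x * (norm (u x))\<^sup>2) \<partial>lborel)"
  proof (rule integral_mono)
    show "integrable lborel (\<lambda>x. (norm (sqrt_mult V u x))\<^sup>2 / c + (\<Sum>Q\<in>\<Q>. indicator Q x * (norm (u x))\<^sup>2))"
      using sq cell by (intro Bochner_Integration.integrable_add integrable_divide Bochner_Integration.integrable_sum) auto
    fix x
    have Vu: "(norm (sqrt_mult V u x))\<^sup>2 = V x * (norm (u x))\<^sup>2"
      using V0[of x] by (simp add: sqrt_mult_def norm_mult power_mult_distrib)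
    have nn: "0 \<le> (\<Sum>Q\<in>\<Q>. indicator Q x * (norm (u x))\<^sup>2)" by (intro sum_nonneg) simp
    show "(norm (u x))\<^sup>2 \<le> (norm (sqrt_mult V u x))\<^sup>2 / c + (\<Sum>Q\<in>\<Q>. indicator Q x * (norm (u x))\<^sup>2)"
    proof (cases "norm x \<ge> R")
      case True
      then have "c * (norm (u x))\<^sup>2 \<le> V x * (norm (u x))\<^sup>2" using c(2) by (intro mult_right_mono) auto
      then have "(norm (u x))\<^sup>2 \<le> (norm (sqrt_mult V u x))\<^sup>2 / c"
        using c(1) unfolding Vu by (simp add: pos_le_divide_eq mult.commute)
      with nn show ?thesis by linarith
    next
      case False
      then have "x \<in> cball 0 R" by simp
      then obtain Q where Q: "Q \<in> \<Q>" "x \<in> Q" using cover by blast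
      have "indicator Q x * (norm (u x))\<^sup>2 \<le> (\<Sum>Q\<in>\<Q>. indicator Q x * (norm (u x))\<^sup>2)"
        using fin Q by (intro member_le_sum) auto
      moreover have "0 \<le> (norm (sqrt_mult V u x))\<^sup>2 / c" using c(1) by simp
      ultimately show ?thesis using Q by simp
    qed
  qed (rule sq(1))
  also have "\<dots> = potential_energy V u / c + (\<Sum>Q\<in>\<Q>. \<integral>x. indicator Q x * (norm (u x))\<^sup>2 \<partial>lborel)"
    using sq cell by (subst Bochner_Integration.integral_add) (auto simp: potential_energy_def L2_norm_square_eq Bochner_Integration.integral_sum)
  finally show ?thesis by (simp only: L2_norm_square_eq)
qed

lemma Liminf_pos_imp_lower_bound:
  fixes V :: "'a::euclidean_space \<Rightarrow> real"
  assumes "Liminf at_infinity (\<lambda>x. ereal (V x)) > 0"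
  obtains c R where "c > 0" "\<And>x. norm x \<ge> R \<Longrightarrow> V x \<ge> c"
proof -
  obtain c where c: "0 < ereal c" "ereal c < Liminf at_infinity (\<lambda>x. ereal (V x))"
    using ereal_dense2[OF assms] by auto
  from less_LiminfD[OF c(2)] obtain R where "\<And>x. norm x \<ge> R \<Longrightarrow> c < V x"
    by (auto simp: eventually_at_infinity)
  with c(1) show thesis by (intro that[of c R]) (auto intro: less_imp_le)
qed

text \<open>Suppose that a function \<open>u\<close> violates the bound, and let \<open>s = \<parallel>u\<parallel>\<^sup>2\<close>.  Its energy divided by
  \<open>h\<^sup>2\<close> is then less than \<open>L s\<close>, and for small \<open>h\<close> the tail outside the ball, the cell averages and
  the oscillation inside the cells each contribute at most \<open>s / 4\<close> to \<open>s\<close>.\<close>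

theorem rayleigh_lower_bound_of_one_null:
  fixes V :: "'a::euclidean_space \<Rightarrow> real"
  assumes V0: "\<And>x. V x \<ge> 0" and V: "continuous_on UNIV V"
    and lim: "Liminf at_infinity (\<lambda>x. ereal (V x)) > 0" and null: "one_null (V -` {0})" and L: "L > 0"
  shows "\<forall>\<^sub>F h in at_right 0. \<forall>u\<in>schrodinger_domain V.
    L * h\<^sup>2 * (L2_norm u)\<^sup>2 \<le> h\<^sup>2 * gradient_energy u + potential_energy V u"
proof -
  obtain c R where c: "c > 0" "\<And>x. norm x \<ge> R \<Longrightarrow> V x \<ge> c"
    using Liminf_pos_imp_lower_bound[OF lim] by blast
  define A where "A = 2 ^ DIM('a) * real DIM('a) * L"
  have A: "A > 0" using L by (simp add: A_def)
  \<comment> \<open>The cell size for which the oscillation term of the Poincare inequality is \<open>s / 4\<close>.\<close>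
  define \<delta> where "\<delta> = sqrt (1 / (2 * A))"
  have \<delta>: "\<delta> > 0" "A * \<delta>\<^sup>2 = 1 / 2" using A by (simp_all add: \<delta>_def)
  obtain \<Q> :: "'a set set" where \<Q>: "finite \<Q>" "cball 0 R \<subseteq> \<Union>\<Q>"
    "\<And>Q Q'. Q \<in> \<Q> \<Longrightarrow> Q' \<in> \<Q> \<Longrightarrow> Q \<noteq> Q' \<Longrightarrow> Q \<inter> Q' = {}"
    "\<And>Q. Q \<in> \<Q> \<Longrightarrow> Q \<in> sets borel" "\<And>Q. Q \<in> \<Q> \<Longrightarrow> bounded Q"
    "\<And>Q. Q \<in> \<Q> \<Longrightarrow> measure lborel Q = \<delta> ^ DIM('a)"
    "\<And>Q x y b. Q \<in> \<Q> \<Longrightarrow> x \<in> Q \<Longrightarrow> y \<in> Q \<Longrightarrow> b \<in> Basis \<Longrightarrow> \<bar>(y - x) \<bullet> b\<bar> \<le> \<delta>"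
    by (rule grid_cover[OF \<delta>(1), of R]) blast
  \<comment> \<open>Small enough for the averages over all cells to contribute \<open>s / 4\<close> in total.\<close>
  define \<epsilon> where "\<epsilon> = \<delta> ^ DIM('a) / (4 * (real (card \<Q>) + 1) * (L + 1))"
  have \<epsilon>: "\<epsilon> > 0" using \<delta> L by (simp add: \<epsilon>_def)
  have "\<exists>n::nat. \<forall>u\<in>schrodinger_domain V. (cmod (\<integral>x. indicator Q x *\<^sub>R u x \<partial>lborel))\<^sup>2
      \<le> \<epsilon> * (gradient_energy u + real n * potential_energy V u + (L2_norm u)\<^sup>2)" if "Q \<in> \<Q>" for Q
    unfolding pairing_indicator[OF \<Q>(4)[OF that]]
    using indicator_L2[of Q] \<Q>(4,5)[OF that] by (intro pairing_small_of_one_null V0 V null \<epsilon>) simp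
  then have "\<forall>Q\<in>\<Q>. \<exists>n::nat. \<forall>u\<in>schrodinger_domain V. (cmod (\<integral>x. indicator Q x *\<^sub>R u x \<partial>lborel))\<^sup>2
      \<le> \<epsilon> * (gradient_energy u + real n * potential_energy V u + (L2_norm u)\<^sup>2)" by blast
  from bchoice[OF this] obtain n where
    n: "\<And>Q u. Q \<in> \<Q> \<Longrightarrow> u \<in> schrodinger_domain V \<Longrightarrow> (cmod (\<integral>x. indicator Q x *\<^sub>R u x \<partial>lborel))\<^sup>2
      \<le> \<epsilon> * (gradient_energy u + real (n Q) * potential_energy V u + (L2_norm u)\<^sup>2)" by blast
  define N where "N = real (\<Sum>Q\<in>\<Q>. n Q)"
  have nN: "real (n Q) \<le> N" if "Q \<in> \<Q>" for Q
    unfolding N_def using member_le_sum[of Q \<Q> n] \<Q>(1) that by (intro of_nat_mono) auto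
  have small: "\<forall>\<^sub>F h::real in at_right 0. K * h\<^sup>2 < a" if "a > 0" for K a
  proof (rule order_tendstoD(2))
    show "((\<lambda>h::real. K * h\<^sup>2) \<longlongrightarrow> K * 0\<^sup>2) (at_right 0)"
      by (intro tendsto_intros)
  qed (use that in simp)
  have "\<forall>\<^sub>F h::real in at_right 0. N * h\<^sup>2 < 1" by (rule small) simp
  moreover have "\<forall>\<^sub>F h::real in at_right 0. L * h\<^sup>2 < c / 4" by (rule small) (use c(1) in simp)
  ultimately show ?thesis
    using eventually_at_right_less[of 0]
  proof eventually_elim
    case (elim h)
    show ?case
    proof (intro ballI, rule ccontr)
      fix u :: "'a \<Rightarrow> complex" assume u: "u \<in> schrodinger_domain V"
        and "\<not> L * h\<^sup>2 * (L2_norm u)\<^sup>2 \<le> h\<^sup>2 * gradient_energy u + potential_energy V u"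
      define s where "s = (L2_norm u)\<^sup>2"
      define g where "g = gradient_energy u"
      define p where "p = potential_energy V u / h\<^sup>2"
      have h: "h\<^sup>2 > 0" using elim by simp
      have pot: "potential_energy V u = p * h\<^sup>2" using h by (simp add: p_def)
      have nonneg: "g \<ge> 0" "p \<ge> 0" "s \<ge> 0"
        by (simp_all add: g_def p_def s_def gradient_energy_nonneg potential_energy_nonneg)
      have "h\<^sup>2 * (g + p) < h\<^sup>2 * (L * s)"
        using \<open>\<not> _\<close> unfolding pot by (simp add: s_def g_def algebra_simps)
      then have gp: "g + p < L * s" using h by (simp only: mult_less_cancel_left_pos)
      have s: "s > 0" using gp nonneg L by (metis add_nonneg_nonneg less_le_not_le mult_zero_right order_le_less)
      have tail: "potential_energy V u / c \<le> s / 4"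
      proof -
        have "p * h\<^sup>2 \<le> (L * s) * h\<^sup>2" using gp nonneg by (intro mult_right_mono) auto
        also have "\<dots> = s * (L * h\<^sup>2)" by simp
        also have "\<dots> \<le> s * (c / 4)" using elim(2) nonneg by (intro mult_left_mono) auto
        finally show ?thesis using c(1) unfolding pot by (simp add: pos_divide_le_eq field_simps)
      qed
      have cell: "(norm (\<integral>x. indicator Q x *\<^sub>R u x \<partial>lborel))\<^sup>2 \<le> \<epsilon> * ((L + 1) * s)" if "Q \<in> \<Q>" for Q
      proof -
        have "real (n Q) * h\<^sup>2 \<le> N * h\<^sup>2" using nN[OF that] by (intro mult_right_mono) auto
        then have "real (n Q) * h\<^sup>2 \<le> 1" using elim(1) by linarith
        then have "p * (real (n Q) * h\<^sup>2) \<le> p * 1" using nonneg by (intro mult_left_mono) auto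
        then have "g + real (n Q) * potential_energy V u + s \<le> (L + 1) * s"
          using gp unfolding pot by (simp add: algebra_simps)
        then have "\<epsilon> * (g + real (n Q) * potential_energy V u + s) \<le> \<epsilon> * ((L + 1) * s)"
          using \<epsilon> by (intro mult_left_mono) auto
        then show ?thesis using n[OF that u] unfolding g_def s_def by linarith
      qed
      define S where "S = (\<Sum>Q\<in>\<Q>. \<integral>x. indicator Q x * (norm (u x))\<^sup>2 \<partial>lborel)"
      have "\<delta> ^ DIM('a) * S \<le> (\<Sum>Q\<in>\<Q>. (norm (\<integral>x. indicator Q x *\<^sub>R u x \<partial>lborel))\<^sup>2)
          + (2 * \<delta>) ^ DIM('a) * (real DIM('a) * \<delta>\<^sup>2 * g) / 2"
        unfolding S_def g_def using schrodinger_domainD(1)[OF u] \<delta>(1) \<Q>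
        by (intro square_integral_over_cells_le) auto
      also have "(\<Sum>Q\<in>\<Q>. (norm (\<integral>x. indicator Q x *\<^sub>R u x \<partial>lborel))\<^sup>2) \<le> real (card \<Q>) * (\<epsilon> * ((L + 1) * s))"
        using sum_bounded_above[of \<Q>, OF cell] by simp
      also have "\<dots> \<le> (real (card \<Q>) + 1) * (\<epsilon> * ((L + 1) * s))"
        using \<epsilon> L nonneg by (intro mult_right_mono) auto
      also have "\<dots> = \<delta> ^ DIM('a) * (s / 4)"
        using L by (simp add: \<epsilon>_def divide_simps)
      also have "(2 * \<delta>) ^ DIM('a) * (real DIM('a) * \<delta>\<^sup>2 * g) / 2
          \<le> (2 * \<delta>) ^ DIM('a) * (real DIM('a) * \<delta>\<^sup>2 * (L * s)) / 2"
        using gp nonneg \<delta>(1) by (intro divide_right_mono mult_left_mono) auto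
      also have "\<dots> = \<delta> ^ DIM('a) * ((A * \<delta>\<^sup>2) * s / 2)"
        by (simp add: A_def power_mult_distrib)
      also have "\<dots> = \<delta> ^ DIM('a) * (s / 4)" by (simp add: \<delta>(2))
      finally have "\<delta> ^ DIM('a) * S \<le> \<delta> ^ DIM('a) * (s / 2)" by (simp add: mult_ac)
      then have "S \<le> s / 2" using \<delta>(1) by (simp only: mult_le_cancel_left_pos zero_less_power)
      moreover have "s \<le> potential_energy V u / c + S"
        unfolding s_def S_def by (rule L2_norm_le_tail_plus_cells[OF V0 u c \<Q>(1,2,4)])
      ultimately show False using tail s by linarith
    qed
  qed
qed

theorem proposition2p2:
  fixes V :: "'a::euclidean_space \<Rightarrow> real"
  assumes "\<And>x. V x \<ge> 0"
    and "continuous_on UNIV V"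
    and "Liminf at_infinity (\<lambda>x. ereal (V x)) > 0"
    and "(INF x. V x) = 0"
    and "\<exists>x. V x = 0"
  shows "one_null (V -` {0}) \<longleftrightarrow>
    ((\<lambda>h. eigval 1 (schrodinger h V) / ereal (h\<^sup>2)) \<longlongrightarrow> \<infinity>) (at_right 0)"
proof
  assume null: "one_null (V -` {0})"
  have Vm: "V \<in> borel_measurable borel" using assms(2) by (rule borel_measurable_continuous_onI)
  show "((\<lambda>h. eigval 1 (schrodinger h V) / ereal (h\<^sup>2)) \<longlongrightarrow> \<infinity>) (at_right 0)"
    unfolding tendsto_PInfty
  proof
    fix r :: real
    define L where "L = \<bar>r\<bar> + 1"
    have "L > 0" by (simp add: L_def)
    from rayleigh_lower_bound_of_one_null[OF assms(1-3) null this] eventually_at_right_less[of 0]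
    show "\<forall>\<^sub>F h in at_right 0. ereal r < eigval 1 (schrodinger h V) / ereal (h\<^sup>2)"
    proof eventually_elim
      case (elim h)
      have "ereal (L * h\<^sup>2) \<le> eigval 1 (schrodinger h V)"
        using elim by (intro eigval_1_schrodinger_ge Vm) auto
      then have "ereal (L * h\<^sup>2) / ereal (h\<^sup>2) \<le> eigval 1 (schrodinger h V) / ereal (h\<^sup>2)"
        using elim by (intro ereal_divide_right_mono) auto
      moreover have "ereal r < ereal (L * h\<^sup>2) / ereal (h\<^sup>2)" using elim by (simp add: L_def)
      ultimately show ?case by (rule less_le_trans[rotated])
    qed
  qed
next
  assume lim: "((\<lambda>h. eigval 1 (schrodinger h V) / ereal (h\<^sup>2)) \<longlongrightarrow> \<infinity>) (at_right 0)"
  show "one_null (V -` {0})"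
    unfolding one_null_def
  proof (intro ballI impI, rule ccontr)
    fix f assume f: "f \<in> H1" "ess_support f \<subseteq> V -` {0}" and nonzero: "\<not> (AE x in lborel. f x = 0)"
    have ae: "AE x in lborel. sqrt_mult V f x = 0" using f(2) by (rule sqrt_mult_eq_0_of_support)
    have Vm: "V \<in> borel_measurable borel" using assms(2) by (rule borel_measurable_continuous_onI)
    have [measurable]: "f \<in> borel_measurable borel" using L2_measurable[OF H1_L2[OF f(1)]] by simp
    have Vf: "sqrt_mult V f \<in> L2"
    proof (rule L2I)
      show meas: "sqrt_mult V f \<in> borel_measurable lborel" unfolding sqrt_mult_def using Vm by measurable
      show "integrable lborel (\<lambda>x. (norm (sqrt_mult V f x))\<^sup>2)"
        by (rule integrable_cong_AE_imp[of _ "\<lambda>x. 0"]) (use meas ae in \<open>auto elim!: eventually_mono\<close>)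
    qed
    have Q: "f \<in> schrodinger_domain V" using f(1) Vf by (rule schrodinger_domainI)
    have n: "L2_norm f \<noteq> 0" using nonzero L2_norm_eq_0_iff[OF H1_L2[OF f(1)]] by simp
    have pot: "potential_energy V f = 0"
      using ae L2_norm_eq_0_iff[OF Vf] by (simp add: potential_energy_def)
    define C where "C = gradient_energy f / (L2_norm f)\<^sup>2"
    have bound: "eigval 1 (schrodinger h V) \<le> ereal (C * h\<^sup>2)" for h
      using n by (intro eigval_1_schrodinger_le[OF Q n]) (simp add: C_def pot)
    have "\<forall>\<^sub>F h in at_right (0::real). ereal C < eigval 1 (schrodinger h V) / ereal (h\<^sup>2)"
      using lim unfolding tendsto_PInfty by blast
    then have "\<forall>\<^sub>F h in at_right (0::real). False"
      using eventually_at_right_less[of 0]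
    proof eventually_elim
      case (elim h)
      have "eigval 1 (schrodinger h V) / ereal (h\<^sup>2) \<le> ereal (C * h\<^sup>2) / ereal (h\<^sup>2)"
        using elim by (intro ereal_divide_right_mono bound) auto
      also have "\<dots> = ereal C" using elim by simp
      finally show False using elim by simp
    qed
    then show False by simp
  qed
qed

end
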